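(* Let $M$ be a skew $(r,s)$-leaper, $r<s$, $o$ one of the characters $\mathtt f$, $\mathtt g$, and $\mathtt h$, and $e=e_1e_2\ldots e_l$ a string composed of the characters $\mathtt f$, $\mathtt g$, $\mathtt h$, and $\hbar$. Then: (1) Both the cycle $C^M_o(e)$ of $L^M_o(e)$ over $B^M_o(e)$ and the cycle $D^M_o(e)$ are trivial. (2) The direction graph extracted from $C^M_o(e)$ depends only on $e$ (and not on $M$ and $o$); denote it by $\Phi(e)$, the fundamental direction cycle of descent $e$. (3) The direction graph extracted from $D^M_o(e)$ depends only on $o$ and $e$ (and not on $M$); denote it by $\Phi^{\mathrm{II}}_o(e)$, the second fundamental direction cycle of origin $o$ and descent $e$. (This continues to apply to non-skew leapers $M$ in the sense that, whenever the initial cycle of $M$ of type $o$ exists, $D^M_o(e)$ is an $M$-instantiation of $\Phi^{\mathrm{II}}_o(e)$.) (4) If the strings $e'$ and $e''$ composed of the characters $\mathtt f$, $\mathtt g$, $\mathtt h$, and $\hbar$ are flips of each other, then the fundamental direction cycle $\Phi(e')$ and the three second fundamental direction cycles $\Phi^{\mathrm{II}}_{\mathtt f}(e'')$, $\Phi^{\mathrm{II}}_{\mathtt g}(e'')$, $\Phi^{\mathrm{II}}_{\mathtt h}(e'')$ are equivalent. (5) Both of $\Phi(e)$ and $\Phi^{\mathrm{II}}_o(e)$ are dual direction graphs. Each of them is a complement of the other, the duality matrix of $\Phi^{\mathrm{II}}_o(e)$ being $A_eA_o$ and that of $\Phi(e)$ its inverse.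
   Context: Leapers. Squares of the infinite chessboard are identified with their centers, the points of $\mathbb Z^2$; a board is a set of squares. For nonnegative integers $p,q$, not both zero, a $(p,q)$-leaper is a piece that moves from a square $a$ to any of $a+(\pm p,\pm q)$, $a+(\pm q,\pm p)$. It is skew if $p,q$ are nonzero and distinct. The leaper graph of $L$ over a board $B$ has the squares of $B$ as vertices, two being adjacent when a move of $L$ joins them. Initial cycles. Number the directions $\mathtt E,\mathtt{NE},\mathtt N,\mathtt{NW},\mathtt W,\mathtt{SW},\mathtt S,\mathtt{SE}$ by $0,1,\ldots,7$ modulo $8$, and let $u_0=(1,0)$, $u_1=(1,1)$, $u_2=(0,1)$, $u_3=(-1,1)$, $u_{i+4}=-u_i$. For an $(r,s)$-leaper $M$, $r\le s$, the initial cycle $D^M_o$ of type $o$ is the cycle of $M$ visiting, in this order, the squares $a_0,a_1,\ldots,a_7$, where $a_i=\alpha u_i$ for $i$ even and $a_i=\beta u_i$ for $i$ odd, with $(\alpha,\beta)=(r+s,r)$ if $o=\mathtt f$ (exists provided $r\ne0$), $(\alpha,\beta)=(s-r,s)$ if $o=\mathtt g$ (exists provided $r\ne s$), and $(\alpha,\beta)=(r+s,s)$ if $o=\mathtt h$ (always exists). It is regarded as a concatenation $a_0a_1\ldots a_7$ of eight one-square paths. Matrices. $A_{\mathtt f}=\begin{pmatrix}1&0\\2&1\end{pmatrix}$, $A_{\mathtt g}=\begin{pmatrix}0&1\\-1&2\end{pmatrix}$, $A_{\mathtt h}=A_{\hbar}=\begin{pmatrix}0&1\\1&2\end{pmatrix}$,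 and $A_{e_1\ldots e_l}=A_{e_1}\cdots A_{e_l}$ (the unit matrix for the empty string). The parameters of $D^M_o$ are $(p,q)$ with $\binom pq=A_o\binom rs$. Lifts. For a path $w$ of squares, $-w$ is $w$ traversed backwards and $w+v$ its translate. Given a cyclic sequence of squares $a_0a_1\ldots a_7$ partitioned into eight paths, with parameters $(p,q)$, its lift of type $t$ is $b_0b_1\ldots b_7$ with parameters $(p',q')$, $\binom{p'}{q'}=A_t\binom pq$, where type $\mathtt f$: $b_i=(-a_{i+5})(-a_{i+4})(-a_{i+3})+(p+q)u_i$ for $i$ even, $b_i=a_i+pu_i$ for $i$ odd; type $\mathtt g$: $b_i=a_i+(q-p)u_i$ for $i$ even, $b_i=(-a_{i+5})(-a_{i+4})(-a_{i+3})+qu_i$ for $i$ odd; type $\mathtt h$: $b_i=(-a_{i+6})(-a_{i+5})(-a_{i+4})(-a_{i+3})(-a_{i+2})+(p+q)u_i$ for $i$ even, $b_i=a_{i-1}a_ia_{i+1}+qu_i$ for $i$ odd; type $\hbar$: $b_i=a_{i-1}a_ia_{i+1}+(p+q)u_i$ for $i$ even, $b_i=(-a_{i+6})(-a_{i+5})(-a_{i+4})(-a_{i+3})(-a_{i+2})+qu_i$ for $i$ odd. $D^M_o(e)$ is obtained from $D^M_o$ by successively applying lifts of types $e_l,e_{l-1},\ldots,e_1$; it is a cycle of $M$, and its parameters $(p,q)$ are given by $\binom pq=A_eA_o\binom rs$. $L^M_o(e)$ is the $(p,q)$-leaper with these parameters, $B^M_o(e)$ is the board formed by the squares of $D^M_o(e)$,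 and $C^M_o(e)$ is the leaper graph of $L^M_o(e)$ over $B^M_o(e)$, which is a cycle. Flip. Let $\overline{\mathtt f}=\mathtt g$, $\overline{\mathtt g}=\mathtt f$, $\overline{\mathtt h}=\mathtt h$, $\overline{\hbar}=\hbar$. The flip of $e_1e_2\ldots e_l$ is $\overline{e_l}\,\overline{e_{l-1}}\ldots\overline{e_1}$. Direction graphs. Let $A_1=\begin{pmatrix}0&1\\1&0\end{pmatrix}$, $A_2=\begin{pmatrix}1&0\\0&1\end{pmatrix}$, $A_3=\begin{pmatrix}-1&0\\0&1\end{pmatrix}$, $A_4=\begin{pmatrix}0&-1\\1&0\end{pmatrix}$, and $A_{i+4}=-A_i$ for $i=1,\ldots,4$; these eight are the direction matrices. A move of a skew $(p,q)$-leaper, $p<q$, by a translation $v$ has (skew) direction $i\in\{1,\ldots,8\}$ and direction matrix $A_i$ if $v^T=A_i\binom pq$. A direction graph is a symmetric directed graph whose arcs are labeled with skew directions so that the sum of the associated direction matrices over every simple directed cycle (including two-cycles) is zero. Two direction graphs are the same if there is a label-preserving isomorphism between them. A simple cycle of a skew leaper is trivial if the sum of the direction matrices of its moves (in either orientation) is zero. The direction graph extracted from a trivial cycle has the squares of the cycle as vertices and, for each pair of consecutive squares $a,b$, an arc from $a$ to $b$ and an arc from $b$ to $a$, each labeled with the direction of the corresponding move. For an arbitrary $(p,q)$-leaper $L$, $p\le q$, a graph $G$ whose vertices are squares is an $L$-instantiation of a direction graph $\Phi$ if there is a mapping $\tau$ from the vertices of $\Phi$ to the vertices of $G$ such that for every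 arc in $\Phi$ from $x$ to $y$ labeled $i$, the move by the translation $v$ with $v^T=A_i\binom pq$ leads from $\tau(x)$ to $\tau(y)$. Equivalence. A permutation $\pi$ of the eight skew directions is an equivalence permutation if there are real $2\times2$ matrices $P,Q$ with $A_{\pi(i)}=PA_iQ$ for all $i$. $\pi(\Phi)$ is obtained from $\Phi$ by applying $\pi$ to every arc label. Two direction graphs $\Phi_1,\Phi_2$ are equivalent if $\pi(\Phi_1)=\Phi_2$ for some equivalence permutation $\pi$. Duality. For vertices $x,y$ in the same connected component of a direction graph, the distance from $x$ to $y$ is the sum of the direction matrices along any path from $x$ to $y$ (it does not depend on the path). A direction graph is coherent if, for all such $x,y$, the distance from $x$ to $y$ is the zero matrix if and only if $x=y$, and is a direction matrix if and only if $x$ and $y$ are joined by an arc. A direction graph $\Phi$ is dual if there exist a direction graph $\Phi'$ (a complement of $\Phi$), a one-to-one mapping $\eta$ between the vertex sets of $\Phi$ and $\Phi'$, and a real $2\times2$ matrix $A_{\mathrm{Dual}}$ (the duality matrix), distinct from all direction matrices, such that: $\Phi$ and $\Phi'$ are coherent and connected; the unlabeled symmetric directed graphs underlying $\Phi$ and $\Phi'$ are isomorphic; and for every arc from $\eta(a)$ to $\eta(b)$ labeled $i$ in $\Phi'$, the distance from $a$ to $b$ in $\Phi$ equals $A_iA_{\mathrm{Dual}}$. *)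

theory Defs
  imports
    "HOL-Analysis.Analysis"
    "HOL-Combinatorics.Permutations"
    "Graph_Theory.Graph_Theory"
begin

section \<open>Squares, leapers and cycles\<close>

type_synonym square = "int^2"

definition mat2 :: "'a::zero \<Rightarrow> 'a \<Rightarrow> 'a \<Rightarrow> 'a \<Rightarrow> 'a^2^2" where
  "mat2 a b c d = vector [vector [a, b], vector [c, d]]"

text \<open>Leapers are given by integers \<open>p, q\<close>, which are nonnegative wherever they are used.\<close>

definition leaper_move :: "int \<Rightarrow> int \<Rightarrow> square \<Rightarrow> bool" where
  "leaper_move p q v \<longleftrightarrow>
     (v$1 \<in> {p, - p} \<and> v$2 \<in> {q, - q}) \<or> (v$1 \<in> {q, - q} \<and> v$2 \<in> {p, - p})"

definition leaper_graph :: "int \<Rightarrow> int \<Rightarrow> square set \<Rightarrow> square pair_pre_digraph" where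
  "leaper_graph p q B =
     \<lparr> pverts = B, parcs = {(a, b). a \<in> B \<and> b \<in> B \<and> leaper_move p q (b - a)} \<rparr>"

definition cyclic_next :: "'a list \<Rightarrow> nat \<Rightarrow> 'a" where
  "cyclic_next cs i = cs ! (Suc i mod length cs)"

definition cycle_graph :: "'a list \<Rightarrow> 'a pair_pre_digraph" where
  "cycle_graph cs =
     \<lparr> pverts = set cs,
       parcs = (\<Union>i<length cs. {(cs ! i, cyclic_next cs i), (cyclic_next cs i, cs ! i)}) \<rparr>"

definition leaper_cycle :: "int \<Rightarrow> int \<Rightarrow> square list \<Rightarrow> bool" where
  "leaper_cycle p q cs \<longleftrightarrow> 3 \<le> length cs \<and> distinct cs \<and>
     (\<forall>i<length cs. leaper_move p q (cyclic_next cs i - cs ! i))"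

section \<open>Directions\<close>

text \<open>Matrices are polymorphic in the entries: integer ones act on squares, real ones are
  used for equivalence and duality.\<close>

definition dir_mat :: "nat \<Rightarrow> 'a::comm_ring_1^2^2" where
  "dir_mat i =
     (let As = [mat2 0 1 1 0, mat2 1 0 0 1, mat2 (- 1) 0 0 1, mat2 0 (- 1) 1 0]
      in if i \<le> 4 then As ! (i - 1) else - (As ! (i - 5)))"

text \<open>Only meaningful when \<open>0 < p < q\<close> and \<open>v\<close> is a move, in which case \<open>i\<close> is unique.\<close>

definition direction :: "int \<Rightarrow> int \<Rightarrow> square \<Rightarrow> nat" where
  "direction p q v = (THE i. i \<in> {1..8} \<and> v = dir_mat i *v vector [p, q])"

definition trivial_cycle :: "int \<Rightarrow> int \<Rightarrow> square list \<Rightarrow> bool" where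
  "trivial_cycle p q cs \<longleftrightarrow> 0 < p \<and> p < q \<and> leaper_cycle p q cs \<and>
     (\<Sum>i<length cs. dir_mat (direction p q (cyclic_next cs i - cs ! i)) :: real^2^2) = 0"

section \<open>Direction graphs\<close>

text \<open>The values of \<open>lab\<close> outside the arcs are irrelevant. Parallel arcs need not be
  represented: in a direction graph they would carry the same label, since each of them
  forms a two-cycle with any reverse arc.\<close>

record 'v lab_digraph =
  base :: "'v pair_pre_digraph"
  lab :: "'v \<times> 'v \<Rightarrow> nat"

abbreviation ugr :: "'v lab_digraph \<Rightarrow> ('v, 'v \<times> 'v) pre_digraph" where
  "ugr \<Phi> \<equiv> with_proj (base \<Phi>)"

definition direction_sum :: "'v lab_digraph \<Rightarrow> ('v \<times> 'v) list \<Rightarrow> real^2^2" where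
  "direction_sum \<Phi> w = (\<Sum>a\<leftarrow>w. dir_mat (lab \<Phi> a))"

definition direction_graph :: "'v lab_digraph \<Rightarrow> bool" where
  "direction_graph \<Phi> \<longleftrightarrow>
     pair_sym_digraph (base \<Phi>) \<and>
     (\<forall>a\<in>parcs (base \<Phi>). lab \<Phi> a \<in> {1..8}) \<and>
     (\<forall>w. pre_digraph.cycle (ugr \<Phi>) w \<longrightarrow> direction_sum \<Phi> w = 0)"

definition same_dg :: "'v lab_digraph \<Rightarrow> 'w lab_digraph \<Rightarrow> bool" where
  "same_dg \<Phi> \<Psi> \<longleftrightarrow>
     (\<exists>f. bij_betw f (pverts (base \<Phi>)) (pverts (base \<Psi>)) \<and>
        (\<forall>x\<in>pverts (base \<Phi>). \<forall>y\<in>pverts (base \<Phi>).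
           ((x, y) \<in> parcs (base \<Phi>) \<longleftrightarrow> (f x, f y) \<in> parcs (base \<Psi>)) \<and>
           ((x, y) \<in> parcs (base \<Phi>) \<longrightarrow> lab \<Psi> (f x, f y) = lab \<Phi> (x, y))))"

text \<open>Extraction from a cycle of a \<open>(p, q)\<close>-leaper, the cycle being given as a graph.\<close>

definition extracted :: "int \<Rightarrow> int \<Rightarrow> square pair_pre_digraph \<Rightarrow> square lab_digraph" where
  "extracted p q C = \<lparr> base = C, lab = (\<lambda>(a, b). direction p q (b - a)) \<rparr>"

definition instantiation_of ::
    "int \<Rightarrow> int \<Rightarrow> square pair_pre_digraph \<Rightarrow> 'v lab_digraph \<Rightarrow> bool" where
  "instantiation_of p q C \<Phi> \<longleftrightarrow>
     (\<exists>\<tau>. \<tau> ` pverts (base \<Phi>) \<subseteq> pverts C \<and>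
        (\<forall>(x, y)\<in>parcs (base \<Phi>). \<tau> x + dir_mat (lab \<Phi> (x, y)) *v vector [p, q] = \<tau> y))"

definition equivalence_permutation :: "(nat \<Rightarrow> nat) \<Rightarrow> bool" where
  "equivalence_permutation \<pi> \<longleftrightarrow> \<pi> permutes {1..8} \<and>
     (\<exists>P Q :: real^2^2. \<forall>i\<in>{1..8}. dir_mat (\<pi> i) = P ** dir_mat i ** Q)"

definition relabel :: "(nat \<Rightarrow> nat) \<Rightarrow> 'v lab_digraph \<Rightarrow> 'v lab_digraph" where
  "relabel \<pi> \<Phi> = \<lparr> base = base \<Phi>, lab = \<pi> \<circ> lab \<Phi> \<rparr>"

definition equivalent_dg :: "'v lab_digraph \<Rightarrow> 'w lab_digraph \<Rightarrow> bool" where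
  "equivalent_dg \<Phi> \<Psi> \<longleftrightarrow>
     (\<exists>\<pi>. equivalence_permutation \<pi> \<and> same_dg (relabel \<pi> \<Phi>) \<Psi>)"

section \<open>Duality\<close>

text \<open>In a direction graph the sum does not depend on the path, so the description is unique
  whenever \<open>x\<close> and \<open>y\<close> lie in the same component.\<close>

definition dg_distance :: "'v lab_digraph \<Rightarrow> 'v \<Rightarrow> 'v \<Rightarrow> real^2^2" where
  "dg_distance \<Phi> x y =
     (THE d. \<exists>w. pre_digraph.apath (ugr \<Phi>) x w y \<and> d = direction_sum \<Phi> w)"

definition coherent :: "'v lab_digraph \<Rightarrow> bool" where
  "coherent \<Phi> \<longleftrightarrow>
     (\<forall>x\<in>pverts (base \<Phi>). \<forall>y\<in>pverts (base \<Phi>). x \<rightarrow>\<^sup>*\<^bsub>ugr \<Phi>\<^esub> y \<longrightarrow>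
        (dg_distance \<Phi> x y = 0 \<longleftrightarrow> x = y) \<and>
        (dg_distance \<Phi> x y \<in> dir_mat ` {1..8} \<longleftrightarrow> (x, y) \<in> parcs (base \<Phi>)))"

text \<open>\<open>\<Psi>\<close> is a complement of \<open>\<Phi>\<close>, and \<open>A\<close> is the corresponding duality matrix of \<open>\<Phi>\<close>.\<close>

definition complement_with ::
    "'v lab_digraph \<Rightarrow> 'w lab_digraph \<Rightarrow> real^2^2 \<Rightarrow> bool" where
  "complement_with \<Phi> \<Psi> A \<longleftrightarrow>
     direction_graph \<Phi> \<and> direction_graph \<Psi> \<and>
     A \<notin> dir_mat ` {1..8} \<and>
     coherent \<Phi> \<and> coherent \<Psi> \<and>
     Digraph_Component.connected (ugr \<Phi>) \<and> Digraph_Component.connected (ugr \<Psi>) \<and>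
     digraph_iso (ugr \<Phi>) (ugr \<Psi>) \<and>
     (\<exists>\<eta>. bij_betw \<eta> (pverts (base \<Phi>)) (pverts (base \<Psi>)) \<and>
        (\<forall>a\<in>pverts (base \<Phi>). \<forall>b\<in>pverts (base \<Phi>).
           (\<eta> a, \<eta> b) \<in> parcs (base \<Psi>) \<longrightarrow>
           dg_distance \<Phi> a b = dir_mat (lab \<Psi> (\<eta> a, \<eta> b)) ** A))"

text \<open>Taking the complement over the same vertex type is no restriction, because its vertex
  set is in bijection with that of \<open>\<Phi>\<close>.\<close>

definition dual_dg :: "'v lab_digraph \<Rightarrow> bool" where
  "dual_dg \<Phi> \<longleftrightarrow> (\<exists>(\<Psi> :: 'v lab_digraph) A. complement_with \<Phi> \<Psi> A)"

section \<open>Initial cycles and lifts\<close>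

text \<open>The types of lifts; the types of initial cycles (origins) are all but \<open>Thbar\<close>.\<close>

datatype ltype = Tf | Tg | Th | Thbar

definition origins :: "ltype set" where
  "origins = {Tf, Tg, Th}"

fun flip_type :: "ltype \<Rightarrow> ltype" where
  "flip_type Tf = Tg"
| "flip_type Tg = Tf"
| "flip_type Th = Th"
| "flip_type Thbar = Thbar"

definition flip :: "ltype list \<Rightarrow> ltype list" where
  "flip e = rev (map flip_type e)"

fun type_mat :: "ltype \<Rightarrow> 'a::comm_ring_1^2^2" where
  "type_mat Tf = mat2 1 0 2 1"
| "type_mat Tg = mat2 0 1 (- 1) 2"
| "type_mat Th = mat2 0 1 1 2"
| "type_mat Thbar = mat2 0 1 1 2"

fun string_mat :: "ltype list \<Rightarrow> 'a::comm_ring_1^2^2" where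
  "string_mat [] = mat 1"
| "string_mat (t # e) = type_mat t ** string_mat e"

definition params :: "int \<Rightarrow> int \<Rightarrow> ltype \<Rightarrow> ltype list \<Rightarrow> int^2" where
  "params r s og e = (string_mat e ** type_mat og) *v vector [r, s]"

definition dvec :: "nat \<Rightarrow> square" where
  "dvec i = [vector [1, 0], vector [1, 1], vector [0, 1], vector [- 1, 1],
             vector [- 1, 0], vector [- 1, - 1], vector [0, - 1], vector [1, - 1]] ! i"

fun initial_exists :: "int \<Rightarrow> int \<Rightarrow> ltype \<Rightarrow> bool" where
  "initial_exists r s Tf \<longleftrightarrow> r \<noteq> 0"
| "initial_exists r s Tg \<longleftrightarrow> r \<noteq> s"
| "initial_exists r s Th \<longleftrightarrow> True"
| "initial_exists r s Thbar \<longleftrightarrow> False"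

text \<open>A cyclic sequence of squares partitioned into eight paths is a function on \<open>{0..<8}\<close>
  whose values are lists of squares.\<close>

type_synonym octet = "nat \<Rightarrow> square list"

definition octet_of :: "int \<Rightarrow> int \<Rightarrow> octet" where
  "octet_of \<alpha> \<beta> i = [(if even i then \<alpha> else \<beta>) *s dvec i]"

fun initial :: "int \<Rightarrow> int \<Rightarrow> ltype \<Rightarrow> octet" where
  "initial r s Tf = octet_of (r + s) r"
| "initial r s Tg = octet_of (s - r) s"
| "initial r s Th = octet_of (r + s) s"
| "initial r s Thbar = undefined"

definition translate :: "square \<Rightarrow> square list \<Rightarrow> square list" where
  "translate v = map (\<lambda>a. a + v)"

text \<open>Below, \<open>x k\<close> is the path with index \<open>i + k\<close> modulo 8 (so that \<open>x 7\<close> has index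
  \<open>i - 1\<close>), and \<open>y k\<close> is the same path traversed backwards.\<close>

fun lift :: "ltype \<Rightarrow> int \<Rightarrow> int \<Rightarrow> octet \<Rightarrow> octet" where
  "lift Tf p q a i =
     (let x = (\<lambda>k. a ((i + k) mod 8)); y = (\<lambda>k. rev (x k)) in
      if even i then translate ((p + q) *s dvec i) (y 5 @ y 4 @ y 3)
      else translate (p *s dvec i) (x 0))"
| "lift Tg p q a i =
     (let x = (\<lambda>k. a ((i + k) mod 8)); y = (\<lambda>k. rev (x k)) in
      if even i then translate ((q - p) *s dvec i) (x 0)
      else translate (q *s dvec i) (y 5 @ y 4 @ y 3))"
| "lift Th p q a i =
     (let x = (\<lambda>k. a ((i + k) mod 8)); y = (\<lambda>k. rev (x k)) in
      if even i then translate ((p + q) *s dvec i) (y 6 @ y 5 @ y 4 @ y 3 @ y 2)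
      else translate (q *s dvec i) (x 7 @ x 0 @ x 1))"
| "lift Thbar p q a i =
     (let x = (\<lambda>k. a ((i + k) mod 8)); y = (\<lambda>k. rev (x k)) in
      if even i then translate ((p + q) *s dvec i) (x 7 @ x 0 @ x 1)
      else translate (q *s dvec i) (y 6 @ y 5 @ y 4 @ y 3 @ y 2))"

text \<open>The last character of the string is the type of the first lift applied.\<close>

fun D_octet :: "int \<Rightarrow> int \<Rightarrow> ltype \<Rightarrow> ltype list \<Rightarrow> octet" where
  "D_octet r s og [] = initial r s og"
| "D_octet r s og (t # e) =
     lift t (params r s og e $ 1) (params r s og e $ 2) (D_octet r s og e)"

definition D_cycle :: "int \<Rightarrow> int \<Rightarrow> ltype \<Rightarrow> ltype list \<Rightarrow> square list" where
  "D_cycle r s og e = concat (map (D_octet r s og e) [0..<8])"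

definition board :: "int \<Rightarrow> int \<Rightarrow> ltype \<Rightarrow> ltype list \<Rightarrow> square set" where
  "board r s og e = set (D_cycle r s og e)"

definition C_graph :: "int \<Rightarrow> int \<Rightarrow> ltype \<Rightarrow> ltype list \<Rightarrow> square pair_pre_digraph" where
  "C_graph r s og e =
     leaper_graph (params r s og e $ 1) (params r s og e $ 2) (board r s og e)"

definition C_extracted :: "int \<Rightarrow> int \<Rightarrow> ltype \<Rightarrow> ltype list \<Rightarrow> square lab_digraph" where
  "C_extracted r s og e =
     extracted (params r s og e $ 1) (params r s og e $ 2) (C_graph r s og e)"

definition D_extracted :: "int \<Rightarrow> int \<Rightarrow> ltype \<Rightarrow> ltype list \<Rightarrow> square lab_digraph" where
  "D_extracted r s og e = extracted r s (cycle_graph (D_cycle r s og e))"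

end

theory Submission imports Defs begin

text \<open>A square of \<open>D\<close> is determined by the word of the indices of the pieces that contain
  it and its ancestors, and its position is the sum of one translation for each level. The legal moves of
  \<open>L\<close> from a square of piece \<open>i\<close> are those in the directions \<open>i + 4\<close>
  and \<open>i + 5\<close>, and inequalities that survive lifting show that no other moves stay on the board,
  so that \<open>C\<close> is a cycle. In both cycles the labels of consecutive moves differ by 1 modulo 8, up
  to equivalence, so the labels are determined by a cyclic word in two letters. Lifts act on the word of
  \<open>C\<close> by substitutions on the side of the first character of \<open>e\<close>, and on the word of
  \<open>D\<close> by the flipped substitutions on the side of the last character; hence the flip. Positions
  are linear in \<open>(r, s)\<close>, and the corresponding matrices are potentials for the direction
  matrices of both cycles, which gives triviality and the duality matrix. \<open>\<Phi>\<close> is coherent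
  since the squares are distinct and only \<open>C\<close> has moves of \<open>L\<close>; the coherence of the
  second cycle is transferred along the equivalence with the cycle \<open>\<Phi>\<close> of the flip.\<close>

section \<open>Boards divided into octants\<close>

text \<open>The origin drops out of the geometry: in the parameters \<open>(p, q)\<close> of the
  cycle being formed, the amplitudes of all initial cycles and the translations of all lifts are
  \<open>q - p\<close> for even and \<open>p\<close> for odd indices. It survives only in the names
  of the moves of M. Disjointness cannot be proved on its own: a common square of lifted pieces 0
  and 1 would be an illegal edge of the previous board, so disjointness and the absence of edges
  pass through the lifts together. The direction matrices form a dihedral group. A turn multiplies
  the current matrix from the right by one of two reflections, while left multiplications commute
  with turns and are transitive; hence a word of turns fixes the labels up to equivalence. The moves
  of C turn by 3 or 5, not by 1 or 7; tripling the directions repairs this and is itself an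
  equivalence. When a first lift is inserted, the pieces of D are not merely substituted: each gains
  or loses a letter at both ends, and only around the closed cycle do these changes cancel, up to
  rotation.\<close>

declare One_nat_def [simp del] add_2_eq_Suc [simp del] add_2_eq_Suc' [simp del]

lemma less_8_cases: "(i::nat) < 8 \<longleftrightarrow> i = 0 \<or> i = 1 \<or> i = 2 \<or> i = 3 \<or> i = 4 \<or> i = 5 \<or> i = 6 \<or> i = 7"
  by auto

text \<open>Directions are counted modulo 8, with 0 in place of 8; direction \<open>d\<close> points
  between the rays of pieces \<open>d - 1\<close> and \<open>d\<close>.\<close>

definition move_x :: "int \<Rightarrow> int \<Rightarrow> nat \<Rightarrow> int" where "move_x p q d = [q, q, p, - p, - q, - q, - p, p] ! d"
definition move_y :: "int \<Rightarrow> int \<Rightarrow> nat \<Rightarrow> int" where "move_y p q d = [- p, p, q, q, p, - p, - q, - q] ! d"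

text \<open>\<open>A i\<close> is piece \<open>i\<close> as a set of squares. The directions
  \<open>i + 4\<close> and \<open>i + 5\<close> lie on the two sides of the ray opposite to piece
  \<open>i\<close>, so legal moves cross the board and end in one of the two pieces between whose
  rays they point.\<close>

locale octant_pieces =
  fixes p q :: int and A :: "nat \<Rightarrow> int \<Rightarrow> int \<Rightarrow> bool"
  assumes p_pos: "0 < p" and p_less: "p < q"
    and rotate: "\<And>i x y. i < 8 \<Longrightarrow> A i x y \<Longrightarrow> A ((i + 2) mod 8) (- y) x"
    and mirror: "\<And>i x y. i < 8 \<Longrightarrow> A i x y \<Longrightarrow> A ((8 - i) mod 8) x (- y)"
    and legal_move: "\<And>i d x y. i < 8 \<Longrightarrow> A i x y \<Longrightarrow> d = (i + 4) mod 8 \<or> d = (i + 5) mod 8 \<Longrightarrow>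
      A d (x + move_x p q d) (y + move_y p q d) \<or> A ((d + 7) mod 8) (x + move_x p q d) (y + move_y p q d)"
begin

lemmas rotates = rotate[of 0, simplified] rotate[of 1, simplified] rotate[of 2, simplified] rotate[of 3, simplified] rotate[of 4, simplified] rotate[of 5, simplified] rotate[of 6, simplified] rotate[of 7, simplified]

lemmas mirrors = mirror[of 0, simplified] mirror[of 1, simplified] mirror[of 2, simplified] mirror[of 3, simplified] mirror[of 4, simplified] mirror[of 5, simplified] mirror[of 6, simplified] mirror[of 7, simplified]

text \<open>Four quarter turns are the identity, so the one-way assumption \<open>rotate\<close>
  yields equivalences, and everything reduces to pieces 0 and 1.\<close>

lemma rotated:
  "A 2 x y \<longleftrightarrow> A 0 y (- x)" "A 4 x y \<longleftrightarrow> A 0 (- x) (- y)" "A 6 x y \<longleftrightarrow> A 0 (- y) x"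
  "A 3 x y \<longleftrightarrow> A 1 y (- x)" "A 5 x y \<longleftrightarrow> A 1 (- x) (- y)" "A 7 x y \<longleftrightarrow> A 1 (- y) x"
proof -
  show 2: "A 2 x y \<longleftrightarrow> A 0 y (- x)" for x y
    using rotates(7)[of "- x" "- y"] rotates(5)[of "- y" x] rotates(3)[of x y] rotates(1)[of y "- x"] by auto
  show "A 4 x y \<longleftrightarrow> A 0 (- x) (- y)"
    using rotates(7)[of "- y" x] rotates(5)[of x y] rotates(3)[of y "- x"] 2[of y "- x"] by auto
  show "A 6 x y \<longleftrightarrow> A 0 (- y) x"
    using rotates(7)[of x y] rotates(5)[of y "- x"] rotates(3)[of "- x" "- y"] 2[of "- x" "- y"] by auto
  show 3: "A 3 x y \<longleftrightarrow> A 1 y (- x)" for x y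
    using rotates(8)[of "- x" "- y"] rotates(6)[of "- y" x] rotates(4)[of x y] rotates(2)[of y "- x"] by auto
  show "A 5 x y \<longleftrightarrow> A 1 (- x) (- y)"
    using rotates(8)[of "- y" x] rotates(6)[of x y] rotates(4)[of y "- x"] 3[of y "- x"] by auto
  show "A 7 x y \<longleftrightarrow> A 1 (- y) x"
    using rotates(8)[of x y] rotates(6)[of y "- x"] rotates(4)[of "- x" "- y"] 3[of "- x" "- y"] by auto
qed

lemma mirror0: "A 0 x (- y) \<longleftrightarrow> A 0 x y"
  by (metis mirrors(1) minus_minus)

text \<open>Reflection in the diagonal is \<open>mirror\<close> followed by a quarter turn.\<close>

lemma mirror1: "A 1 y x \<longleftrightarrow> A 1 x y"
  by (metis mirrors(2) rotated(6) minus_minus)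

text \<open>One legal move from each of the pieces 0 and 1, its target rotated back to these two
  pieces; the other legal move is its mirror image.\<close>

lemma west0': "A 0 x y \<Longrightarrow> A 1 (p + y) (q - x) \<or> A 0 (q - x) (- p - y)"
  using legal_move[of 0 x y 4] by (auto simp: move_x_def move_y_def rotated algebra_simps)

lemma west1': "A 1 x y \<Longrightarrow> A 0 (q - x) (p - y) \<or> A 1 (q - x) (p - y)"
  using legal_move[of 1 x y 5] by (auto simp: move_x_def move_y_def rotated algebra_simps)

end

text \<open>These invariants were found by experiment: the lifts preserve them, and together with the legal moves
  they exclude every other move of the leaper within the board.\<close>

locale octant_board = octant_pieces +
  assumes bounds0: "\<And>x y. A 0 x y \<Longrightarrow> \<bar>y\<bar> < x \<and> x < q \<and> \<bar>y\<bar> < q - p \<and> x + \<bar>y\<bar> < p + q"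
    and bounds1: "\<And>x y. A 1 x y \<Longrightarrow> 0 < x \<and> 0 < y \<and> x < q \<and> y < q \<and> x + y < p + q \<and> \<bar>x - y\<bar> < 2 * p"
    and disjoint01: "\<And>x y. A 0 x y \<Longrightarrow> \<not> A 1 x y"
    and separate01: "\<And>x y. A 0 x y \<Longrightarrow> \<not> A 1 (x - p) (y + q)"

text \<open>The offsets ascend cyclically even where a lift lists the paths in descending order:
  there the whole concatenation is reversed, which is recorded by \<open>backward\<close>.\<close>

fun offsets :: "ltype \<Rightarrow> nat \<Rightarrow> nat list" where
  "offsets Tf i = (if even i then [3, 4, 5] else [0])"
| "offsets Tg i = (if even i then [0] else [3, 4, 5])"
| "offsets Th i = (if even i then [2, 3, 4, 5, 6] else [7, 0, 1])"
| "offsets Thbar i = (if even i then [7, 0, 1] else [2, 3, 4, 5, 6])"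

fun lift_params :: "ltype \<Rightarrow> int \<times> int \<Rightarrow> int \<times> int" where
  "lift_params Tf (p, q) = (p, 2 * p + q)"
| "lift_params Tg (p, q) = (q, 2 * q - p)"
| "lift_params Th (p, q) = (q, p + 2 * q)"
| "lift_params Thbar (p, q) = (q, p + 2 * q)"

text \<open>The axis steps of the eight pieces; as vectors these are \<open>dvec\<close>.\<close>

definition dir_x :: "nat \<Rightarrow> int" where "dir_x i = [1, 1, 0, - 1, - 1, - 1, 0, 1] ! i"
definition dir_y :: "nat \<Rightarrow> int" where "dir_y i = [0, 1, 1, 1, 0, - 1, - 1, - 1] ! i"
definition amp :: "int \<times> int \<Rightarrow> nat \<Rightarrow> int" where "amp b i = (if even i then snd b - fst b else fst b)"

text \<open>Lifting of pieces as mere sets, with order and orientation forgotten. The translation is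
  read off from the new parameters: for each type, \<open>q' - p'\<close> and \<open>p'\<close> are
  the prescribed amplitudes.\<close>

definition lift_pieces :: "ltype \<Rightarrow> int \<Rightarrow> int \<Rightarrow> (nat \<Rightarrow> int \<Rightarrow> int \<Rightarrow> bool) \<Rightarrow> nat \<Rightarrow> int \<Rightarrow> int \<Rightarrow> bool" where
  "lift_pieces t p q A i x y \<longleftrightarrow> (\<exists>k\<in>set (offsets t i).
     A ((i + k) mod 8) (x - amp (lift_params t (p, q)) i * dir_x i) (y - amp (lift_params t (p, q)) i * dir_y i))"

section \<open>Invariants of a board and their behaviour under lifting\<close>

context octant_pieces begin

lemma lift_pieces_0:
  "lift_pieces Tf p q A 0 x y \<longleftrightarrow> A 3 (x - p - q) y \<or> A 4 (x - p - q) y \<or> A 5 (x - p - q) y"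
  "lift_pieces Tg p q A 0 x y \<longleftrightarrow> A 0 (x + p - q) y"
  "lift_pieces Th p q A 0 x y \<longleftrightarrow> A 2 (x - p - q) y \<or> A 3 (x - p - q) y \<or> A 4 (x - p - q) y \<or> A 5 (x - p - q) y \<or> A 6 (x - p - q) y"
  "lift_pieces Thbar p q A 0 x y \<longleftrightarrow> A 7 (x - p - q) y \<or> A 0 (x - p - q) y \<or> A 1 (x - p - q) y"
  by (simp_all add: lift_pieces_def amp_def dir_x_def dir_y_def algebra_simps)

lemma lift_pieces_1:
  "lift_pieces Tf p q A 1 x y \<longleftrightarrow> A 1 (x - p) (y - p)"
  "lift_pieces Tg p q A 1 x y \<longleftrightarrow> A 4 (x - q) (y - q) \<or> A 5 (x - q) (y - q) \<or> A 6 (x - q) (y - q)"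
  "lift_pieces Th p q A 1 x y \<longleftrightarrow> A 0 (x - q) (y - q) \<or> A 1 (x - q) (y - q) \<or> A 2 (x - q) (y - q)"
  "lift_pieces Thbar p q A 1 x y \<longleftrightarrow> A 3 (x - q) (y - q) \<or> A 4 (x - q) (y - q) \<or> A 5 (x - q) (y - q) \<or> A 6 (x - q) (y - q) \<or> A 7 (x - q) (y - q)"
  by (simp_all add: lift_pieces_def amp_def dir_x_def dir_y_def algebra_simps)

end

context octant_board begin

lemma b0: "A 0 x y \<Longrightarrow> y < x \<and> - y < x \<and> x < q \<and> y < q - p \<and> - y < q - p \<and> x + y < p + q \<and> x - y < p + q"
  using bounds0[of x y] by linarith

lemma b1: "A 1 x y \<Longrightarrow> 0 < x \<and> 0 < y \<and> x < q \<and> y < q \<and> x + y < p + q \<and> x - y < 2 * p \<and> y - x < 2 * p"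
  using bounds1[of x y] by linarith

lemma b2: "A 2 x y \<Longrightarrow> - x < y \<and> x < y \<and> y < q \<and> x < q - p \<and> - x < q - p \<and> y - x < p + q \<and> x + y < p + q"
  unfolding rotated(1) by (drule b0) linarith

lemma b4: "A 4 x y \<Longrightarrow> x < y \<and> x < - y \<and> - q < x \<and> y < q - p \<and> - y < q - p \<and> - x - y < p + q \<and> y - x < p + q"
  unfolding rotated(2) by (drule b0) linarith

lemma b6: "A 6 x y \<Longrightarrow> y < x \<and> y < - x \<and> - q < y \<and> x < q - p \<and> - x < q - p \<and> - x - y < p + q \<and> x - y < p + q"
  unfolding rotated(3) by (drule b0) linarith

lemma b3: "A 3 x y \<Longrightarrow> x < 0 \<and> 0 < y \<and> - q < x \<and> y < q \<and> y - x < p + q \<and> - x - y < 2 * p \<and> x + y < 2 * p"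
  unfolding rotated(4) by (drule b1) linarith

lemma b5: "A 5 x y \<Longrightarrow> x < 0 \<and> y < 0 \<and> - q < x \<and> - q < y \<and> - x - y < p + q \<and> x - y < 2 * p \<and> y - x < 2 * p"
  unfolding rotated(5) by (drule b1) linarith

lemma b7: "A 7 x y \<Longrightarrow> 0 < x \<and> y < 0 \<and> x < q \<and> - q < y \<and> x - y < p + q \<and> - x - y < 2 * p \<and> x + y < 2 * p"
  unfolding rotated(6) by (drule b1) linarith

lemmas geo = b0 b1 b2 b3 b4 b5 b6 b7

lemma lift_bounds0:
  assumes "lift_pieces t p q A 0 x y" "lift_params t (p, q) = (p', q')"
  shows "\<bar>y\<bar> < x \<and> x < q' \<and> \<bar>y\<bar> < q' - p' \<and> x + \<bar>y\<bar> < p' + q'"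
  using assms p_pos p_less
  by (cases t) (auto simp: lift_pieces_0 dest!: geo)

lemma lift_bounds1:
  assumes "lift_pieces t p q A 1 x y" "lift_params t (p, q) = (p', q')"
  shows "0 < x \<and> 0 < y \<and> x < q' \<and> y < q' \<and> x + y < p' + q' \<and> \<bar>x - y\<bar> < 2 * p'"
  using assms p_pos p_less
  by (cases t) (auto simp: lift_pieces_1 dest!: geo)

lemma bounds: "i < 8 \<Longrightarrow> A i x y \<Longrightarrow> \<bar>x\<bar> < q \<and> \<bar>y\<bar> < q \<and> \<bar>x\<bar> + \<bar>y\<bar> < p + q"
  using p_less unfolding less_8_cases by (elim disjE) (auto dest!: geo)

text \<open>Illegal edges are shortened by a legal move, which stays on the board.\<close>

lemma no_edge03:
  assumes A: "A 0 x y" and B: "A k (x - p) (y + q)" and "k < 8"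
  shows False
  using \<open>k < 8\<close> unfolding less_8_cases
proof (elim disjE)
  show False if "k = 0" using geo(1)[OF A] B p_pos p_less that by (auto dest!: geo)
  show False if "k = 1" using separate01[OF A] B that by simp
  show False if "k = 2"
  proof -
    \<comment> \<open>Traversed backwards, the edge is a legal move from piece 2, so
      \<open>(x, y)\<close> would also lie in piece 6 or 7. Piece 6 violates the bounds and piece 7
      is the mirror image of piece 1.\<close>
    have "A 0 (y + q) (x - p)" using B that mirror0[of "y + q" "p - x"] by (simp add: rotated)
    from west0'[OF this] have "A 7 x y \<or> A 6 x y" using mirror0[of "- y" x] mirror1 by (simp add: rotated)
    with geo(1)[OF A] disjoint01[of x "- y"] A show False by (auto simp: rotated(6) mirror0 mirror1 dest!: b6)
  qed
  show False if "k = 3"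
  proof -
    have "A 1 (y + q) (p - x)" using B that by (simp add: rotated)
    from west1'[OF this] have "A 6 x y \<or> A 7 x y" by (simp add: rotated)
    with geo(1)[OF A] disjoint01[of x "- y"] A show False by (auto simp: rotated(6) mirror0 mirror1 dest!: b6)
  qed
qed (use geo(1)[OF A] B p_pos p_less in \<open>auto dest!: geo\<close>)

text \<open>Direction 4 is, up to reflection in the diagonal, the only illegal direction from piece
  1 that the bounds leave open.\<close>

lemma no_edge14:
  assumes A: "A 1 x y" and B: "A k (x - q) (y + p)" and "k < 8"
  shows False
  using \<open>k < 8\<close> unfolding less_8_cases
proof (elim disjE)
  show False if "k = 2"
    \<comment> \<open>The reversed edge, reflected in the diagonal, is the one that
      \<open>separate01\<close> forbids.\<close>
    using separate01[of "y + p" "x - q"] B that A mirror0[of "y + p" "q - x"] by (simp add: rotated mirror1)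
  show False if "k = 3"
  proof -
    have "A 1 (q - x) (y + p)" using B that by (simp add: rotated mirror1)
    from west1'[OF this] have "A 0 x y \<or> A 1 x (- y)" by (simp add: mirror0)
    with disjoint01 b1[of x "- y"] A b1[OF A] show False by auto
  qed
  show False if "k = 4"
  proof -
    have "A 0 (q - x) (- p - y)" using B that by (simp add: rotated algebra_simps)
    from west0'[OF this] have "A 0 x y \<or> A 1 (- y) x" by (auto simp: mirror0)
    with disjoint01 b1[of "- y" x] A b1[OF A] show False by auto
  qed
qed (use geo(2)[OF A] B p_pos p_less in \<open>auto dest!: geo\<close>)

text \<open>Directions 0, 1, 2 and 7 leave the board by the bounds, and direction 6 is the mirror
  image of direction 3.\<close>

lemma no_edge_0:
  assumes "A 0 x y" "A k (x + move_x p q d) (y + move_y p q d)" "k < 8" "d < 8"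
  shows "d = 4 \<or> d = 5"
proof -
  have k: "A ((8 - k) mod 8) u (- v)" if "A k u v" for u v using mirror[of k] that \<open>k < 8\<close> by blast
  show ?thesis
    using assms(4)[unfolded less_8_cases] assms(1,2) geo(1)[OF assms(1)] bounds[OF assms(3,2)] no_edge03[OF assms(1) _ assms(3)]
      no_edge03[of x "- y" "(8 - k) mod 8"] k[of "x - p" "y - q"] p_pos p_less
    by (elim disjE) (simp_all add: move_x_def move_y_def mirror0)
qed

lemma no_edge_1:
  assumes "A 1 x y" "A k (x + move_x p q d) (y + move_y p q d)" "k < 8" "d < 8"
  shows "d = 5 \<or> d = 6"
proof -
  \<comment> \<open>Reflection in the diagonal takes piece \<open>k\<close> to piece
    \<open>2 - k\<close>, and direction 7 to direction 4.\<close>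
  have k: "A ((10 - k) mod 8) v u" if "A k u v" for u v
  proof -
    have "((8 - k) mod 8 + 2) mod 8 = (10 - k) mod 8" using assms(3) by (auto simp: less_8_cases)
    then show ?thesis using rotate[OF _ mirror[OF assms(3) that]] by simp
  qed
  show ?thesis
    using assms(4)[unfolded less_8_cases] assms(1,2) geo(2)[OF assms(1)] bounds[OF assms(3,2)] no_edge14[OF assms(1) _ assms(3)]
      no_edge14[of y x "(10 - k) mod 8"] k[of "x + p" "y - q"] p_pos p_less
    by (elim disjE) (simp_all add: move_x_def move_y_def mirror1)
qed

lemma unrotate: "i < 8 \<Longrightarrow> A i x y \<Longrightarrow> A ((i + 6) mod 8) y (- x)"
  using rotate[OF _ rotate[OF _ rotate[of i x y]]] by (simp add: mod_simps add.commute)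

text \<open>Quarter turns backwards, that is, adding 6 to pieces and directions, reduce all pieces
  to 0 and 1; hence the induction in steps of two.\<close>

lemma no_edge:
  assumes "A i x y" "A k (x + move_x p q d) (y + move_y p q d)" "i < 8" "k < 8" "d < 8"
  shows "d = (i + 4) mod 8 \<or> d = (i + 5) mod 8"
proof -
  have *: "A ((k + 6) mod 8) (y + move_x p q ((d + 6) mod 8)) (- x + move_y p q ((d + 6) mod 8))"
    if "A k (x + move_x p q d) (y + move_y p q d)" "k < 8" "d < 8" for k d :: nat and x y
    using unrotate[OF that(2,1)] that(3) unfolding less_8_cases
    by (elim disjE) (simp_all add: move_x_def move_y_def algebra_simps)
  have "d = (i + 4) mod 8 \<or> d = (i + 5) mod 8"
    if "A (i mod 8) x y" "A k (x + move_x p q d) (y + move_y p q d)" "k < 8" "d < 8" for k d x y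
    using that
  proof (induction i arbitrary: x y k d rule: nat_induct2)
    case 0
    then show ?case using no_edge_0 by auto
  next
    case 1
    then show ?case using no_edge_1 by auto
  next
    case (step i)
    have "(i + 2) mod 8 < 8" by simp
    from unrotate[OF this step.prems(1)] have "A (i mod 8) y (- x)" by (simp add: mod_simps)
    from step.IH[OF this *[OF step.prems(2-4)]]
    have "(d + 6) mod 8 = (i + 4) mod 8 \<or> (d + 6) mod 8 = (i + 5) mod 8" by simp
    moreover have "d = ((d + 6) mod 8 + 2) mod 8" using \<open>d < 8\<close> by (simp add: mod_simps)
    ultimately have "d = ((i + 4) mod 8 + 2) mod 8 \<or> d = ((i + 5) mod 8 + 2) mod 8" by metis
    then show ?case by (simp add: mod_simps algebra_simps)
  qed
  then show ?thesis using assms by simp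
qed

text \<open>The translations of the new pieces 0 and 1 differ by a move of the old leaper. A common
  square would therefore come from two old squares joined by a move, and its direction (4, 6, 3 and
  7 for the four types) is illegal for the old pieces in question.\<close>

lemma lift_disjoint01:
  assumes "lift_pieces t p q A 0 x y"
  shows "\<not> lift_pieces t p q A 1 x y"
proof
  assume B: "lift_pieces t p q A 1 x y"
  show False
  proof (cases t)
    case Tf
    then have "\<not> A k (x - p - q) y" if "k < 8" for k
      using B that no_edge[of 1 "x - p" "y - p" k 4] by (auto simp: lift_pieces_1 move_x_def move_y_def)
    then show ?thesis using assms Tf by (simp add: lift_pieces_0)
  next
    case Tg
    then have "\<not> A k (x - q) (y - q)" if "k < 8" for k
      using assms that no_edge[of 0 "x + p - q" y k 6] by (auto simp: lift_pieces_0 move_x_def move_y_def)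
    then show ?thesis using B Tg by (simp add: lift_pieces_1)
  next
    case Th
    have "\<not> A k (x - p - q) y" if "k < 8" "i \<in> {0, 1, 2}" "A i (x - q) (y - q)" for i k
      using that no_edge[of i "x - q" "y - q" k 3] by (auto simp: cancel_ab_semigroup_add_class.diff_right_commute[of x q p] move_x_def move_y_def)
    from this[of _ 0] this[of _ 1] this[of _ 2] show ?thesis
      using assms B Th by (auto simp: lift_pieces_0 lift_pieces_1)
  next
    case Thbar
    have "\<not> A k (x - q) (y - q)" if "k < 8" "i \<in> {7, 0, 1}" "A i (x - p - q) y" for i k
      using that no_edge[of i "x - p - q" y k 7] by (auto simp: move_x_def move_y_def)
    from this[of _ 0] this[of _ 1] this[of _ 7] show ?thesis
      using assms B Thbar by (auto simp: lift_pieces_0 lift_pieces_1)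
  qed
qed

text \<open>Translated back, the two squares differ by a sum of two moves of the old leaper. From
  most of the old pieces the first move is legal, so the intermediate square is on the board; but
  then the second move is an illegal edge. The other old pieces contradict the bounds.\<close>

lemma lift_separate01:
  assumes "lift_pieces t p q A 0 x y" "lift_params t (p, q) = (p', q')"
  shows "\<not> lift_pieces t p q A 1 (x - p') (y + q')"
proof
  assume B: "lift_pieces t p q A 1 (x - p') (y + q')"
  have b: "\<bar>u\<bar> < q" "\<bar>v\<bar> < q" "\<bar>u\<bar> + \<bar>v\<bar> < p + q" if "A k u v" "k < 8" for k u v
    using bounds[OF that(2,1)] by auto
  show False
  proof (cases t)
    case Tf
    then have [simp]: "p' = p" "q' = 2 * p + q" using assms(2) by simp_all
    \<comment> \<open>\<open>(X, y)\<close> is the old square under \<open>(x, y)\<close>; the other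
      old square is reached from it by moves in the directions 1 and 3.\<close>
    define X where "X = x - p - q"
    have 1: "A 1 (X + (q - p)) (y + (p + q))"
      using B Tf by (simp add: lift_pieces_1 X_def algebra_simps)
    have "\<not> A k (X + q) (y + p)" if "k = 0 \<or> k = 1" for k
      using no_edge[of k "X + q" "y + p" 1 3] 1 that by (auto simp: move_x_def move_y_def algebra_simps)
    then have "\<not> A 4 X y \<and> \<not> A 5 X y"
      using legal_move[of 4 X y 1] legal_move[of 5 X y 1] by (auto simp: move_x_def move_y_def)
    moreover have "\<not> A 3 X y" using b3[of X y] b1[OF 1] p_pos by auto
    ultimately show ?thesis using assms(1) Tf by (simp add: lift_pieces_0 X_def)
  next
    case Tg
    then have [simp]: "p' = q" "q' = 2 * q - p" using assms(2) by simp_all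
    define X Y where "X = x - 2 * q" and "Y = y + q - p"
    have 0: "A 0 (X + (p + q)) (Y + (p - q))"
      using assms(1) Tg by (simp add: lift_pieces_0 X_def Y_def algebra_simps)
    have "\<not> A k (X + q) (Y + p)" if "k = 0 \<or> k = 1" for k
      using no_edge[of k "X + q" "Y + p" 0 7] 0 that by (auto simp: move_x_def move_y_def algebra_simps)
    then have "\<not> A 4 X Y \<and> \<not> A 5 X Y"
      using legal_move[of 4 X Y 1] legal_move[of 5 X Y 1] by (auto simp: move_x_def move_y_def)
    moreover have "\<not> A 6 X Y" using b6[of X Y] b0[OF 0] p_pos by auto
    ultimately show ?thesis using B Tg by (simp add: lift_pieces_1 X_def Y_def algebra_simps)
  next
    case Th
    then have [simp]: "p' = q" "q' = p + 2 * q" using assms(2) by simp_all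
    define X where "X = x - p - q"
    obtain i where i: "i = 0 \<or> i = 1 \<or> i = 2" "A i (X + (p - q)) (y + (p + q))"
      using B Th by (auto simp: lift_pieces_1 X_def algebra_simps)
    have "\<not> A k (X + p) (y + q)" if "k = 1 \<or> k = 2" for k
      using no_edge[of k "X + p" "y + q" i 4] i that by (auto simp: move_x_def move_y_def algebra_simps)
    then have "\<not> A 5 X y \<and> \<not> A 6 X y"
      using legal_move[of 5 X y 2] legal_move[of 6 X y 2] by (auto simp: move_x_def move_y_def)
    moreover have "\<not> A 2 X y" "\<not> A 3 X y" "\<not> A 4 X y"
      using b2[of X y] b3[of X y] b4[of X y] b[OF i(2)] i p_pos p_less by (auto dest!: geo)
    ultimately show ?thesis using assms(1) Th by (simp add: lift_pieces_0 X_def)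
  next
    case Thbar
    then have [simp]: "p' = q" "q' = p + 2 * q" using assms(2) by simp_all
    define X Y where "X = x - 2 * q" and "Y = y + p + q"
    obtain i where i: "i = 7 \<or> i = 0 \<or> i = 1" "A i (X + (q - p)) (Y + (- p - q))"
      using assms(1) Thbar by (auto simp: lift_pieces_0 X_def Y_def algebra_simps)
    have "\<not> A k (X + q) (Y + - p)" if "k = 7 \<or> k = 0" for k
      using no_edge[of k "X + q" "Y + - p" i 6] i that by (auto simp: move_x_def move_y_def algebra_simps)
    then have "\<not> A 3 X Y \<and> \<not> A 4 X Y"
      using legal_move[of 3 X Y 0] legal_move[of 4 X Y 0] by (auto simp: move_x_def move_y_def)
    moreover have "\<not> A 5 X Y" "\<not> A 6 X Y" "\<not> A 7 X Y"
      using b5[of X Y] b6[of X Y] b7[of X Y] b[OF i(2)] i p_pos p_less by (auto dest!: geo)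
    ultimately show ?thesis using B Thbar by (simp add: lift_pieces_1 X_def Y_def algebra_simps)
  qed
qed

lemma disjoint_0: "A 0 x y \<Longrightarrow> A k x y \<Longrightarrow> k < 8 \<Longrightarrow> k = 0"
  using geo(1)[of x y] disjoint01[of x y] disjoint01[of x "- y"] p_pos p_less
  unfolding less_8_cases by (elim disjE) (auto simp: mirror0 rotated(6) mirror1 dest: geo(3-7))

lemma disjoint_1: "A 1 x y \<Longrightarrow> A k x y \<Longrightarrow> k < 8 \<Longrightarrow> k = 1"
  using geo(2)[of x y] disjoint01[of x y] disjoint01[of y x] mirror0[of y x] p_pos p_less
  unfolding less_8_cases by (elim disjE) (auto simp: rotated(1) mirror1 dest: geo(4-8))

lemma disjoint:
  assumes "A i x y" "A k x y" "i < 8" "k < 8"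
  shows "i = k"
proof -
  have "i mod 8 = k" if "A (i mod 8) x y" "A k x y" "k < 8" for k x y
    using that
  proof (induction i arbitrary: x y k rule: nat_induct2)
    case 0
    then show ?case using disjoint_0 by auto
  next
    case 1
    then show ?case using disjoint_1 by auto
  next
    case (step i)
    have "(i + 2) mod 8 < 8" by simp
    from unrotate[OF this step.prems(1)] have "A (i mod 8) y (- x)" by (simp add: mod_simps)
    from step.IH[OF this unrotate[OF step.prems(3,2)]]
    have "i mod 8 = (k + 6) mod 8" by simp
    then have "(i mod 8 + 2) mod 8 = ((k + 6) mod 8 + 2) mod 8" by simp
    then show ?case using step.prems by (simp add: mod_simps)
  qed
  then show ?thesis using assms by simp
qed

end

section \<open>Squares as words of piece indices\<close>

fun backward :: "ltype \<Rightarrow> nat \<Rightarrow> bool" where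
  "backward Tf i = even i"
| "backward Tg i = odd i"
| "backward Th i = even i"
| "backward Thbar i = odd i"

text \<open>The head of a word is the piece in the final cycle, its last letter the piece in the
  initial one. Reversing the concatenation also traverses each path backwards, as the lifts
  require.\<close>

fun words :: "ltype list \<Rightarrow> nat \<Rightarrow> nat list list" where
  "words [] i = [[i]]"
| "words (t # e) i = map ((#) i)
     ((if backward t i then rev else id) (concat (map (\<lambda>k. words e ((i + k) mod 8)) (offsets t i))))"

fun level :: "int \<times> int \<Rightarrow> ltype list \<Rightarrow> int \<times> int" where
  "level b [] = b"
| "level b (t # e) = lift_params t (level b e)"

definition anchor :: "int \<times> int \<Rightarrow> nat \<Rightarrow> square" where
  "anchor b i = vector [amp b i * dir_x i, amp b i * dir_y i]"

fun pos :: "int \<times> int \<Rightarrow> ltype list \<Rightarrow> nat list \<Rightarrow> square" where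
  "pos b e [] = 0"
| "pos b [] (i # w) = anchor b i"
| "pos b (t # e) (i # w) = anchor (level b (t # e)) i + pos b e w"

definition step :: "int \<times> int \<Rightarrow> nat \<Rightarrow> square" where
  "step b d = vector [move_x (fst b) (snd b) d, move_y (fst b) (snd b) d]"

text \<open>A square of piece \<open>j\<close> has exactly two neighbours on the board, in the directions \<open>j + 4\<close> and \<open>j + 5\<close>;
  the flag tells by which of them the first cycle leaves it.\<close>

fun out_dir :: "nat list \<times> bool \<Rightarrow> nat" where
  "out_dir (w, up) = (hd w + (if up then 4 else 5)) mod 8"

fun in_dir :: "nat list \<times> bool \<Rightarrow> nat" where
  "in_dir (w, up) = (hd w + (if up then 1 else 0)) mod 8"

text \<open>The first component inverts \<open>offsets\<close>: it gives the new pieces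
  \<open>j + k\<close> that contain a copy of the old piece \<open>j\<close>. Its order is that of
  the new cycle: a move of C that keeps the flag changes the piece by 3 if the flag is
  \<open>True\<close> and by -3 otherwise, whence the steps of 3 here and the reversal in
  \<open>fibre\<close>.\<close>

fun fibre_spec :: "ltype \<Rightarrow> nat \<Rightarrow> bool \<Rightarrow> nat list \<times> bool" where
  "fibre_spec Tf j up = (if even j then ([4], \<not> up) else ([5, 0, 3], up))"
| "fibre_spec Tg j up = (if odd j then ([4], \<not> up) else ([5, 0, 3], up))"
| "fibre_spec Th j up = (if even j then ([6, 1, 4, 7, 2], up) else ([5, 0, 3], \<not> up))"
| "fibre_spec Thbar j up = (if odd j then ([6, 1, 4, 7, 2], up) else ([5, 0, 3], \<not> up))"

definition fibre :: "ltype \<Rightarrow> nat list \<times> bool \<Rightarrow> (nat list \<times> bool) list" where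
  "fibre t x = (case x of (w, up) \<Rightarrow> case fibre_spec t (hd w) up of (ks, up') \<Rightarrow>
     map (\<lambda>k. (((hd w + k) mod 8) # w, up')) (if up' then ks else rev ks))"

fun C_words :: "ltype list \<Rightarrow> (nat list \<times> bool) list" where
  "C_words [] = map (\<lambda>i. ([i], True)) [0, 3, 6, 1, 4, 7, 2, 5]"
| "C_words (t # e) = concat (map (fibre t) (C_words e))"

definition C_edge :: "int \<times> int \<Rightarrow> ltype list \<Rightarrow> nat list \<times> bool \<Rightarrow> nat list \<times> bool \<Rightarrow> bool" where
  "C_edge b e x y \<longleftrightarrow> out_dir x = in_dir y \<and> pos b e (fst y) = pos b e (fst x) + step (level b e) (out_dir x)"

definition cyclic :: "('a \<Rightarrow> 'a \<Rightarrow> bool) \<Rightarrow> 'a list \<Rightarrow> bool" where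
  "cyclic R xs \<longleftrightarrow> xs \<noteq> [] \<and> successively R xs \<and> R (last xs) (hd xs)"

lemma successively_concat:
  assumes "xs \<noteq> []" "\<And>x. x \<in> set xs \<Longrightarrow> f x \<noteq> [] \<and> successively R' (f x)"
    "successively R xs" "\<And>x y. x \<in> set xs \<Longrightarrow> y \<in> set xs \<Longrightarrow> R x y \<Longrightarrow> R' (last (f x)) (hd (f y))"
  shows "successively R' (concat (map f xs)) \<and> concat (map f xs) \<noteq> [] \<and>
    hd (concat (map f xs)) = hd (f (hd xs)) \<and> last (concat (map f xs)) = last (f (last xs))"
  using assms
proof (induction xs rule: induct_list012)
  case (3 x y zs)
  have IH: "successively R' (concat (map f (y # zs))) \<and> concat (map f (y # zs)) \<noteq> [] \<and>
    hd (concat (map f (y # zs))) = hd (f (hd (y # zs))) \<and> last (concat (map f (y # zs))) = last (f (last (y # zs)))"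
    using 3 by auto
  have "concat (map f (x # y # zs)) = f x @ concat (map f (y # zs))" by simp
  moreover have "successively R' (f x)" "f x \<noteq> []" "R' (last (f x)) (hd (f y))"
    using 3 by auto
  ultimately show ?case using IH
    by (simp only: successively_append_iff) auto
qed auto

lemma cyclic_concat:
  assumes "cyclic R xs" "\<And>x. x \<in> set xs \<Longrightarrow> f x \<noteq> [] \<and> successively R' (f x)"
    "\<And>x y. x \<in> set xs \<Longrightarrow> y \<in> set xs \<Longrightarrow> R x y \<Longrightarrow> R' (last (f x)) (hd (f y))"
  shows "cyclic R' (concat (map f xs))"
proof -
  have xs: "xs \<noteq> []" "successively R xs" "R (last xs) (hd xs)" using assms(1) by (auto simp: cyclic_def)
  from successively_concat[OF xs(1) assms(2) xs(2) assms(3)]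
  show ?thesis using assms(3)[of "last xs" "hd xs"] xs unfolding cyclic_def by auto
qed

lemma vec2_eq_iff: "(u :: 'a^2) = v \<longleftrightarrow> u $ 1 = v $ 1 \<and> u $ 2 = v $ 2"
  by (simp add: vec_eq_iff forall_2)

lemma vec2_simps:
  "(vector [a, b] :: int^2) + vector [c, d] = vector [a + c, b + d]"
  "(vector [a, b] :: int^2) - vector [c, d] = vector [a - c, b - d]"
  "- (vector [a, b] :: int^2) = vector [- a, - b]"
  "(vector [a, b] :: int^2) = vector [c, d] \<longleftrightarrow> a = c \<and> b = d"
  by (simp_all add: vec2_eq_iff)

lemma anchor_simps:
  "anchor (p, q) 0 = vector [q - p, 0]" "anchor (p, q) 1 = vector [p, p]"
  "anchor (p, q) 2 = vector [0, q - p]" "anchor (p, q) 3 = vector [- p, p]"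
  "anchor (p, q) 4 = vector [p - q, 0]" "anchor (p, q) 5 = vector [- p, - p]"
  "anchor (p, q) 6 = vector [0, p - q]" "anchor (p, q) 7 = vector [p, - p]"
  by (simp_all add: anchor_def amp_def dir_x_def dir_y_def)

lemma step_simps:
  "step (p, q) 0 = vector [q, - p]" "step (p, q) 1 = vector [q, p]"
  "step (p, q) 2 = vector [p, q]" "step (p, q) 3 = vector [- p, q]"
  "step (p, q) 4 = vector [- q, p]" "step (p, q) 5 = vector [- q, - p]"
  "step (p, q) 6 = vector [- p, - q]" "step (p, q) 7 = vector [p, - q]"
  by (simp_all add: step_def move_x_def move_y_def)

lemma square_cancel:
  "(u :: square) + v = w + v + z \<longleftrightarrow> u = w + z"
  "(u :: square) + (v + s) = w + v + z \<longleftrightarrow> u + s = w + z"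
  by (auto simp: algebra_simps)

text \<open>Two copies of one square differ by two anchors only, wherever the square is, and for
  consecutive copies this difference is a move of the lifted leaper.\<close>

lemma fibre_successively:
  assumes "w \<noteq> []" "hd w < 8"
  shows "fibre t (w, up) \<noteq> [] \<and> successively (C_edge b (t # e)) (fibre t (w, up))"
proof -
  obtain p q where pq: "level b e = (p, q)" by fastforce
  show ?thesis
    using assms(2) unfolding less_8_cases
    apply (elim disjE)
    apply (cases t; cases up; simp add: C_edge_def fibre_def pq square_cancel anchor_simps step_simps vec2_simps; fail)+
    done
qed

text \<open>An old move of C, corrected by the anchors of the last copy of its start and the first
  copy of its end, becomes a move of the lifted leaper.\<close>

lemma fibre_link:
  assumes "fst x \<noteq> []" "hd (fst x) < 8" "fst y \<noteq> []" "hd (fst y) < 8" "C_edge b e x y"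
  shows "C_edge b (t # e) (last (fibre t x)) (hd (fibre t y))"
proof -
  obtain p q where pq: "level b e = (p, q)" by fastforce
  obtain w up w' up' where xy: "x = (w, up)" "y = (w', up')" by (metis surj_pair)
  define j where "j = hd w"
  have e: "out_dir x = in_dir y" "pos b e w' = pos b e w + step (p, q) (out_dir x)"
    using assms(5) by (simp_all add: C_edge_def xy pq)
  have "j < 8" "hd w' < 8" using assms xy j_def by auto
  \<comment> \<open>The direction shared by both ends expresses the head of \<open>w'\<close>
    through \<open>j\<close> and the flags, which leaves finitely many cases.\<close>
  have "hd w' = (in_dir y + (if up' then 7 else 8)) mod 8"
    using \<open>hd w' < 8\<close> by (simp add: xy mod_simps)
  then have j': "hd w' = (j + (if up then 4 else 5) + (if up' then 7 else 8)) mod 8"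
    unfolding e(1)[symmetric] by (simp add: xy j_def mod_simps)
  show ?thesis
    using \<open>j < 8\<close> unfolding less_8_cases
    apply (elim disjE)
    apply (cases t; cases up; cases up'; simp add: C_edge_def xy j' j_def[symmetric] e fibre_def pq square_cancel anchor_simps step_simps vec2_simps; fail)+
    done
qed

text \<open>These are identities in the parameters, valid for every pair \<open>b\<close>; the
  potentials below exploit this.\<close>

lemma cyclic_C_words:
  "cyclic (C_edge b e) (C_words e) \<and> (\<forall>x\<in>set (C_words e). fst x \<noteq> [] \<and> hd (fst x) < 8)"
proof (induction e)
  case Nil
  obtain p q where "b = (p, q)" by fastforce
  then show ?case
    by (simp add: C_edge_def cyclic_def anchor_simps step_simps vec2_simps)
next
  case (Cons t e)
  have "cyclic (C_edge b (t # e)) (C_words (t # e))"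
    unfolding C_words.simps
  proof (rule cyclic_concat)
    show "cyclic (C_edge b e) (C_words e)" using Cons by simp
    show "fibre t x \<noteq> [] \<and> successively (C_edge b (t # e)) (fibre t x)" if "x \<in> set (C_words e)" for x
      using fibre_successively[of "fst x" t "snd x"] Cons that by auto
    show "C_edge b (t # e) (last (fibre t x)) (hd (fibre t y))"
      if "x \<in> set (C_words e)" "y \<in> set (C_words e)" "C_edge b e x y" for x y
      using fibre_link[OF _ _ _ _ that(3)] Cons that by blast
  qed
  then show ?case by (auto simp: fibre_def split: prod.splits)
qed

lemma hd_words: "w \<in> set (words e i) \<Longrightarrow> w \<noteq> [] \<and> hd w = i"
  by (cases e) auto

lemma set_words_Cons:
  "set (words (t # e) i) = (#) i ` (\<Union>k\<in>set (offsets t i). set (words e ((i + k) mod 8)))"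
  by simp

section \<open>Both cycles run through the same words\<close>

definition all_words :: "ltype list \<Rightarrow> nat list set" where
  "all_words e = (\<Union>i<8. set (words e i))"

lemma all_words_Cons:
  "all_words (t # e) = {i # w | i w. i < 8 \<and> w \<in> all_words e \<and> hd w \<in> (\<lambda>k. (i + k) mod 8) ` set (offsets t i)}"
  (is "?A = ?B")
proof
  show "?A \<subseteq> ?B"
  proof
    fix v assume "v \<in> ?A"
    then obtain i k w where "v = i # w" "i < 8" "k \<in> set (offsets t i)" "w \<in> set (words e ((i + k) mod 8))"
      by (auto simp: all_words_def set_words_Cons simp del: words.simps)
    then show "v \<in> ?B" using hd_words[of w] by (auto simp: all_words_def)
  qed
  show "?B \<subseteq> ?A"
  proof
    fix v assume "v \<in> ?B"
    then obtain i w k j where "v = i # w" "i < 8" "j < 8" "w \<in> set (words e j)" "k \<in> set (offsets t i)" "hd w = (i + k) mod 8"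
      by (auto simp: all_words_def)
    moreover from this have "j = (i + k) mod 8" using hd_words by metis
    ultimately show "v \<in> ?A"
      by (auto simp: all_words_def set_words_Cons simp del: words.simps)
  qed
qed

text \<open>Both sides say that the new piece \<open>i\<close> contains a copy of the old piece
  \<open>j\<close>, seen from either end; a finite table.\<close>

lemma fibre_spec_offsets:
  assumes "i < 8" "j < 8"
  shows "j \<in> (\<lambda>k. (i + k) mod 8) ` set (offsets t i) \<longleftrightarrow> i \<in> (\<lambda>k. (j + k) mod 8) ` set (fst (fibre_spec t j up))"
proof -
  have "\<forall>t\<in>{Tf, Tg, Th, Thbar}. \<forall>up\<in>{True, False}. \<forall>i\<in>{..<8}. \<forall>j\<in>{..<8}.
      j \<in> (\<lambda>k. (i + k) mod 8) ` set (offsets t i) \<longleftrightarrow> i \<in> (\<lambda>k. (j + k) mod 8) ` set (fst (fibre_spec t j up))"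
    by code_simp
  moreover have "t \<in> {Tf, Tg, Th, Thbar}" by (cases t) auto
  ultimately show ?thesis using assms by blast
qed

lemma fst_set_fibre:
  "fst ` set (fibre t x) = (\<lambda>k. ((hd (fst x) + k) mod 8) # fst x) ` set (fst (fibre_spec t (hd (fst x)) (snd x)))"
  by (simp add: fibre_def case_prod_beta image_image)

text \<open>Grouping the new words by their tails gives the fibres, grouping them by their heads
  gives the pieces.\<close>

lemma set_C_words: "fst ` set (C_words e) = all_words e"
proof (induction e)
  case Nil
  then show ?case by (auto simp: all_words_def less_8_cases)
next
  case (Cons t e)
  \<comment> \<open>The bound on heads does not involve the parameters, so \<open>undefined\<close>
    may stand for them.\<close>
  have hd: "hd (fst x) < 8" if "x \<in> set (C_words e)" for x
    using cyclic_C_words[of undefined e] that by blast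
  have "v \<in> fst ` set (C_words (t # e)) \<longleftrightarrow> v \<in> all_words (t # e)" for v
  proof -
    have "v \<in> fst ` set (C_words (t # e)) \<longleftrightarrow> (\<exists>x\<in>set (C_words e). v \<in> fst ` set (fibre t x))" by auto
    also have "\<dots> \<longleftrightarrow> (\<exists>x\<in>set (C_words e). \<exists>i<8. v = i # fst x \<and>
        i \<in> (\<lambda>k. (hd (fst x) + k) mod 8) ` set (fst (fibre_spec t (hd (fst x)) (snd x))))"
      unfolding fst_set_fibre by (intro bex_cong refl) auto
    also have "\<dots> \<longleftrightarrow> (\<exists>x\<in>set (C_words e). \<exists>i<8. v = i # fst x \<and> hd (fst x) \<in> (\<lambda>k. (i + k) mod 8) ` set (offsets t i))"
    proof (intro bex_cong refl ex_cong1 conj_cong)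
      fix x i assume "x \<in> set (C_words e)" "(i :: nat) < 8"
      then show "i \<in> (\<lambda>k. (hd (fst x) + k) mod 8) ` set (fst (fibre_spec t (hd (fst x)) (snd x))) \<longleftrightarrow>
          hd (fst x) \<in> (\<lambda>k. (i + k) mod 8) ` set (offsets t i)"
        using fibre_spec_offsets hd by blast
    qed
    also have "\<dots> \<longleftrightarrow> v \<in> all_words (t # e)"
      unfolding all_words_Cons Cons[symmetric] by blast
    finally show ?thesis .
  qed
  then show ?case by blast
qed

text \<open>Words of one fibre differ in their heads, words of different fibres in their
  tails.\<close>

lemma distinct_C_words: "distinct (map fst (C_words e))"
proof (induction e)
  case Nil
  show ?case by simp
next
  case (Cons t e)
  have f: "map fst (fibre t x) = map (\<lambda>i. i # fst x) (map (\<lambda>k. (hd (fst x) + k) mod 8)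
      (if snd (fibre_spec t (hd (fst x)) (snd x)) then fst (fibre_spec t (hd (fst x)) (snd x))
       else rev (fst (fibre_spec t (hd (fst x)) (snd x)))))" for x
    by (simp add: fibre_def case_prod_beta)
  have d: "distinct (map (\<lambda>k. (j + k) mod 8) (fst (fibre_spec t j up)))" if "j < 8" for j up
  proof -
    have "fst (fibre_spec t j up) \<in> {[4], [5, 0, 3], [6, 1, 4, 7, 2]}" by (cases t) auto
    with that show ?thesis unfolding less_8_cases by (elim disjE) auto
  qed
  have "distinct (map fst (fibre t x))" if "x \<in> set (C_words e)" for x
    using d[of "hd (fst x)" "snd x"] cyclic_C_words[of undefined e] that unfolding f
    by (simp add: distinct_map rev_map[symmetric] inj_on_def)
  moreover have "fst x = fst y" if "w \<in> set (map fst (fibre t x))" "w \<in> set (map fst (fibre t y))" for w x y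
    using that unfolding f by auto
  moreover have "map fst (C_words (t # e)) = concat (map (\<lambda>x. map fst (fibre t x)) (C_words e))"
    by (simp add: map_concat comp_def)
  moreover have "distinct (concat (map (\<lambda>x. map fst (fibre t x)) xs))"
    if "distinct (map fst xs)" "\<And>x. x \<in> set xs \<Longrightarrow> distinct (map fst (fibre t x))"
      "\<And>w x y. w \<in> set (map fst (fibre t x)) \<Longrightarrow> w \<in> set (map fst (fibre t y)) \<Longrightarrow> fst x = fst y" for xs
    using that(1,2)
  proof (induction xs)
    case (Cons x xs)
    have "fst x \<noteq> fst y" if "y \<in> set xs" for y using Cons.prems(1) that by force
    then have "set (map fst (fibre t x)) \<inter> set (map fst (fibre t y)) = {}" if "y \<in> set xs" for y
      using \<open>\<And>w x y. w \<in> set (map fst (fibre t x)) \<Longrightarrow> w \<in> set (map fst (fibre t y)) \<Longrightarrow> fst x = fst y\<close> that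
      by blast
    moreover have "distinct (concat (map (\<lambda>x. map fst (fibre t x)) xs))" using Cons by simp
    moreover have "distinct (map fst (fibre t x))" using Cons.prems(2) by simp
    moreover have "concat (map (\<lambda>x. map fst (fibre t x)) (x # xs)) =
      map fst (fibre t x) @ concat (map (\<lambda>x. map fst (fibre t x)) xs)" by simp
    moreover have "set (concat (map (\<lambda>x. map fst (fibre t x)) xs)) = (\<Union>y\<in>set xs. set (map fst (fibre t y)))" by auto
    ultimately show ?case by (metis (no_types, lifting) Int_UN_distrib SUP_bot_conv(2) distinct_append)
  qed simp
  ultimately show ?case using Cons by metis
qed

section \<open>The boards of words satisfy the invariants\<close>

definition occupied :: "int \<times> int \<Rightarrow> ltype list \<Rightarrow> nat \<Rightarrow> int \<Rightarrow> int \<Rightarrow> bool" where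
  "occupied b e i x y \<longleftrightarrow> (\<exists>w\<in>set (words e i). pos b e w = vector [x, y])"

lemma occupied_Nil: "occupied b [] i x y \<longleftrightarrow> x = amp b i * dir_x i \<and> y = amp b i * dir_y i"
  by (auto simp: occupied_def anchor_def vec2_simps)

lemma occupied_Cons:
  assumes "level b e = (p, q)"
  shows "occupied b (t # e) i = lift_pieces t p q (occupied b e) i"
proof (intro ext)
  fix x y
  have "pos b (t # e) (i # w) = vector [x, y] \<longleftrightarrow> pos b e w = vector [x - amp (lift_params t (p, q)) i * dir_x i,
      y - amp (lift_params t (p, q)) i * dir_y i]" for w
    by (auto simp: assms anchor_def vec2_eq_iff algebra_simps)
  then show "occupied b (t # e) i x y = lift_pieces t p q (occupied b e) i x y"
    by (auto simp: occupied_def lift_pieces_def set_words_Cons simp del: words.simps pos.simps)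
qed

lemma cyclic_iff:
  "cyclic R xs \<longleftrightarrow> xs \<noteq> [] \<and> (\<forall>i<length xs. R (xs ! i) (xs ! (Suc i mod length xs)))"
proof (cases "xs = []")
  case False
  then have "length xs > 0" by simp
  have "successively R xs \<and> R (last xs) (hd xs)" if R: "\<forall>i<length xs. R (xs ! i) (xs ! (Suc i mod length xs))"
  proof
    show "successively R xs" unfolding successively_conv_nth
    proof (intro allI impI)
      fix i assume "Suc i < length xs"
      then show "R (xs ! i) (xs ! Suc i)" using R[rule_format, of i] by simp
    qed
    show "R (last xs) (hd xs)"
      using R[rule_format, of "length xs - 1"] False by (simp add: last_conv_nth hd_conv_nth)
  qed
  moreover have "R (xs ! i) (xs ! (Suc i mod length xs))"
    if "successively R xs" "R (last xs) (hd xs)" "i < length xs" for i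
  proof (cases "Suc i = length xs")
    case True
    then have "i = length xs - 1" by simp
    with True show ?thesis using that False by (simp add: last_conv_nth hd_conv_nth)
  next
    case False
    then show ?thesis using that by (simp add: successively_conv_nth)
  qed
  ultimately show ?thesis using False unfolding cyclic_def by blast
qed (simp add: cyclic_def)

lemma cyclic_next:
  assumes "cyclic R xs" "x \<in> set xs"
  obtains y where "y \<in> set xs" "R x y"
proof -
  from assms obtain i where i: "i < length xs" "x = xs ! i" by (auto simp: in_set_conv_nth)
  with assms(1) have "R x (xs ! (Suc i mod length xs))" by (auto simp: cyclic_iff)
  moreover have "Suc i mod length xs < length xs" using i(1) by (metis length_pos_if_in_set nth_mem mod_less_divisor)
  ultimately show ?thesis using that nth_mem by blast
qed

lemma cyclic_prev:
  assumes "cyclic R xs" "x \<in> set xs"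
  obtains y where "y \<in> set xs" "R y x"
proof -
  from assms obtain i where i: "i < length xs" "x = xs ! i" by (auto simp: in_set_conv_nth)
  define k where "k = (if i = 0 then length xs - 1 else i - 1)"
  have k: "k < length xs" "Suc k mod length xs = i" using i by (auto simp: k_def)
  with assms(1) have "R (xs ! k) x" using i by (auto simp: cyclic_iff)
  with k show ?thesis using that nth_mem by blast
qed

lemma step_opposite: "d < 8 \<Longrightarrow> step b ((d + 4) mod 8) = - step b d"
  unfolding less_8_cases
  by (cases b) (elim disjE; simp add: step_simps vec2_simps)

lemma in_dir_hd: "hd (fst x) < 8 \<Longrightarrow> hd (fst x) = in_dir x \<or> hd (fst x) = (in_dir x + 7) mod 8"
  by (cases x) (auto simp: mod_simps)

lemma out_dir_hd: "hd (fst x) < 8 \<Longrightarrow> hd (fst x) = (out_dir x + 4) mod 8 \<or> hd (fst x) = (out_dir x + 3) mod 8"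
  by (cases x) (auto simp: mod_simps)

text \<open>The directions \<open>hd w + 4\<close> and \<open>hd w + 5\<close> are, in an order
  given by the flag, the direction in which C leaves \<open>w\<close> and the opposite of the one in
  which it arrives. So both legal moves follow edges of C.\<close>

lemma C_words_neighbour:
  assumes "w \<in> all_words e" "d = (hd w + 4) mod 8 \<or> d = (hd w + 5) mod 8"
  obtains x y where "x \<in> set (C_words e)" "y \<in> set (C_words e)" "C_edge b e x y"
    "fst x = w \<and> d = out_dir x \<or> fst y = w \<and> d = (out_dir x + 4) mod 8"
proof -
  note C = cyclic_C_words[of b e]
  obtain up where up: "(w, up) \<in> set (C_words e)" using assms(1) set_C_words[of e] by force
  show ?thesis
  proof (cases "d = out_dir (w, up)")
    case True
    then show ?thesis using cyclic_next[OF conjunct1[OF C] up] up that by (metis fst_conv)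
  next
    case False
    obtain z where z: "z \<in> set (C_words e)" "C_edge b e z (w, up)"
      using cyclic_prev[OF conjunct1[OF C] up] by blast
    then have "out_dir z = in_dir (w, up)" by (simp add: C_edge_def)
    with False assms(2) have "d = (out_dir z + 4) mod 8" by (cases up) (auto simp: mod_simps ac_simps)
    with z up that show ?thesis by (metis fst_conv)
  qed
qed

text \<open>This supplies the assumption \<open>legal_move\<close> of the locale: a legal move ends
  at a neighbour in C, whose piece is known from the shared direction up to the flag.\<close>

lemma occupied_legal_move:
  assumes "level b e = (p, q)" "i < 8" "occupied b e i x y" "d = (i + 4) mod 8 \<or> d = (i + 5) mod 8"
  shows "occupied b e d (x + move_x p q d) (y + move_y p q d) \<or>
    occupied b e ((d + 7) mod 8) (x + move_x p q d) (y + move_y p q d)"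
proof -
  from assms obtain w where w: "w \<in> set (words e i)" "pos b e w = vector [x, y]" by (auto simp: occupied_def)
  have "w \<in> all_words e" "hd w = i" using w assms hd_words by (auto simp: all_words_def)
  then obtain u v where uv: "u \<in> set (C_words e)" "v \<in> set (C_words e)" "C_edge b e u v"
    "fst u = w \<and> d = out_dir u \<or> fst v = w \<and> d = (out_dir u + 4) mod 8"
    using C_words_neighbour[of w e d b] assms(4) by metis
  have o: "out_dir u < 8" by (cases u) simp
  have hd: "hd (fst z) < 8" "fst z \<in> set (words e (hd (fst z)))" if "z \<in> set (C_words e)" for z
  proof -
    show "hd (fst z) < 8" using cyclic_C_words[of b e] that by blast
    have "fst z \<in> all_words e" using that set_C_words[of e] by auto
    then show "fst z \<in> set (words e (hd (fst z)))" using hd_words by (fastforce simp: all_words_def)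
  qed
  have edge: "out_dir u = in_dir v" "pos b e (fst v) = pos b e (fst u) + step (p, q) (out_dir u)"
    using uv(3) assms(1) by (simp_all add: C_edge_def)
  have step: "step (p, q) d = vector [move_x p q d, move_y p q d]" by (simp add: step_def)
  obtain z where z: "z \<in> set (C_words e)" "pos b e (fst z) = pos b e w + step (p, q) d"
    "hd (fst z) = d \<or> hd (fst z) = (d + 7) mod 8"
  proof (cases "fst u = w \<and> d = out_dir u")
    case True
    then show ?thesis using that[of v] edge in_dir_hd[OF hd(1)[OF uv(2)]] uv(2) by auto
  next
    case False
    with uv(4) have d: "fst v = w" "d = (out_dir u + 4) mod 8" by auto
    have "((out_dir u + 4) mod 8 + 7) mod 8 = (out_dir u + 3) mod 8"
      using o unfolding less_8_cases by auto
    then show ?thesis using that[of u] edge d step_opposite[OF o, of "(p, q)"] out_dir_hd[OF hd(1)[OF uv(1)]] uv(1) by auto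
  qed
  have "pos b e (fst z) = vector [x + move_x p q d, y + move_y p q d]"
    using z(2) w(2) by (simp add: step vec2_simps)
  then show ?thesis using z hd(2)[OF z(1)] unfolding occupied_def by metis
qed

lemma lift_params_less:
  assumes "lift_params t (p, q) = (p', q')" "0 < p" "p < q"
  shows "0 < p' \<and> p' < q'"
  using assms by (cases t) auto

lemma level_less:
  assumes "level b e = (p, q)" "0 < fst b" "fst b < snd b"
  shows "0 < p \<and> p < q"
  using assms(1)
proof (induction e arbitrary: p q)
  case Nil
  then show ?case using assms by auto
next
  case (Cons t e)
  obtain p0 q0 where "level b e = (p0, q0)" by fastforce
  then show ?case using Cons lift_params_less[of t p0 q0 p q] by simp
qed

lemma octant_board_occupied:
  assumes "level b e = (p, q)" "0 < fst b" "fst b < snd b"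
  shows "octant_board p q (occupied b e)"
  using assms(1)
proof (induction e arbitrary: p q)
  case Nil
  then have b: "b = (p, q)" by simp
  then have pq: "0 < p" "p < q" using assms by auto
  show ?case
  proof unfold_locales
    fix i :: nat and x y assume "i < 8"
    then show "occupied b [] i x y \<Longrightarrow> occupied b [] ((i + 2) mod 8) (- y) x"
      "occupied b [] i x y \<Longrightarrow> occupied b [] ((8 - i) mod 8) x (- y)"
      unfolding less_8_cases by (elim disjE; simp add: occupied_Nil b amp_def dir_x_def dir_y_def; fail)+
  qed (use pq occupied_legal_move[of b "[]" p q] b in \<open>auto simp: occupied_Nil amp_def dir_x_def dir_y_def\<close>)
next
  case (Cons t e)
  obtain p0 q0 where pq0: "level b e = (p0, q0)" by fastforce
  interpret octant_board p0 q0 "occupied b e" using Cons.IH[OF pq0] .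
  have pq: "lift_params t (p0, q0) = (p, q)" using Cons.prems pq0 by simp
  note L = occupied_Cons[OF pq0]
  have par: "even ((i + 2) mod 8) = even i" "even ((8 - i) mod 8) = even i" if "i < 8" for i :: nat
    using that unfolding less_8_cases by auto
  have off: "offsets t i = offsets t j" if "even i = even j" for i j using that by (cases t) auto
  have amp: "amp (p, q) i = amp (p, q) j" if "even i = even j" for i j using that by (simp add: amp_def)
  show ?case
  proof unfold_locales
    show "0 < p" "p < q" using lift_params_less[OF pq p_pos p_less] by auto
  next
    fix i x y assume i: "i < 8" and o: "occupied b (t # e) i x y"
    have d: "dir_x ((i + 2) mod 8) = - dir_y i" "dir_y ((i + 2) mod 8) = dir_x i"
      "dir_x ((8 - i) mod 8) = dir_x i" "dir_y ((8 - i) mod 8) = - dir_y i"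
      using i unfolding less_8_cases by (auto simp: dir_x_def dir_y_def)
    from o obtain k where k: "k \<in> set (offsets t i)"
      "occupied b e ((i + k) mod 8) (x - amp (p, q) i * dir_x i) (y - amp (p, q) i * dir_y i)"
      unfolding L lift_pieces_def pq by blast
    have "occupied b e (((i + 2) mod 8 + k) mod 8) (- y + amp (p, q) i * dir_y i) (x - amp (p, q) i * dir_x i)"
      using rotate[OF _ k(2)] by (simp add: mod_simps ac_simps)
    then show "occupied b (t # e) ((i + 2) mod 8) (- y) x"
      unfolding L lift_pieces_def pq off[OF par(1)[OF i]] amp[OF par(1)[OF i]] d
      using k(1) by auto
    \<comment> \<open>All sets of offsets are symmetric under negation modulo 8, which makes the
      lift commute with the reflection.\<close>
    have k8: "(8 - k) mod 8 \<in> set (offsets t i)" using k(1) by (cases t) (auto split: if_splits)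
    have "(8 - (i + k) mod 8) mod 8 = ((8 - i) mod 8 + (8 - k) mod 8) mod 8"
    proof -
      have "k < 8" using k(1) by (cases t) (auto split: if_splits)
      with i show ?thesis unfolding less_8_cases by (elim disjE; simp; fail)+
    qed
    then have "occupied b e (((8 - i) mod 8 + (8 - k) mod 8) mod 8) (x - amp (p, q) i * dir_x i) (- y + amp (p, q) i * dir_y i)"
      using mirror[OF _ k(2)] by simp
    then show "occupied b (t # e) ((8 - i) mod 8) x (- y)"
      unfolding L lift_pieces_def pq off[OF par(2)[OF i]] amp[OF par(2)[OF i]] d
      using k8 by auto
  next
    fix i d x y assume "i < 8" "occupied b (t # e) i x y" "d = (i + 4) mod 8 \<or> d = (i + 5) mod 8"
    then show "occupied b (t # e) d (x + move_x p q d) (y + move_y p q d) \<or>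
      occupied b (t # e) ((d + 7) mod 8) (x + move_x p q d) (y + move_y p q d)"
      using occupied_legal_move[OF Cons.prems] by blast
  next
    fix x y
    show "occupied b (t # e) 0 x y \<Longrightarrow> \<bar>y\<bar> < x \<and> x < q \<and> \<bar>y\<bar> < q - p \<and> x + \<bar>y\<bar> < p + q"
      unfolding L using lift_bounds0 pq by blast
    show "occupied b (t # e) 1 x y \<Longrightarrow> 0 < x \<and> 0 < y \<and> x < q \<and> y < q \<and> x + y < p + q \<and> \<bar>x - y\<bar> < 2 * p"
      unfolding L using lift_bounds1 pq by blast
    show "occupied b (t # e) 0 x y \<Longrightarrow> \<not> occupied b (t # e) 1 x y"
      unfolding L using lift_disjoint01 by blast
    show "occupied b (t # e) 0 x y \<Longrightarrow> \<not> occupied b (t # e) 1 (x - p) (y + q)"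
      unfolding L using lift_separate01 pq by blast
  qed
qed

text \<open>Disjointness of the pieces yields equal heads; cancelling the common anchor leaves two
  words of the previous level.\<close>

lemma pos_inj:
  assumes "0 < fst b" "fst b < snd b" "v \<in> all_words e" "w \<in> all_words e" "pos b e v = pos b e w"
  shows "v = w"
  using assms(3-5)
proof (induction e arbitrary: v w)
  case Nil
  obtain i j where ij: "v = [i]" "w = [j]" "i < 8" "j < 8" using Nil by (auto simp: all_words_def)
  interpret octant_board "fst b" "snd b" "occupied b []"
    using octant_board_occupied[of b "[]" "fst b" "snd b"] assms by simp
  have "occupied b [] i (anchor b i $ 1) (anchor b i $ 2)" "occupied b [] j (anchor b j $ 1) (anchor b j $ 2)"
    by (simp_all add: occupied_Nil anchor_def)
  then show ?case using disjoint Nil(3) ij by (metis pos.simps(2))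
next
  case (Cons t e)
  obtain p q where pq: "level b (t # e) = (p, q)" by fastforce
  obtain p0 q0 where pq0: "level b e = (p0, q0)" by fastforce
  interpret new: octant_board p q "occupied b (t # e)" using octant_board_occupied[OF pq] assms by simp
  from Cons.prems obtain i j v' w' where vw: "v = i # v'" "w = j # w'" "i < 8" "j < 8"
    "v' \<in> all_words e" "w' \<in> all_words e"
    unfolding all_words_Cons by blast
  have occ: "occupied b (t # e) (hd u) (pos b (t # e) u $ 1) (pos b (t # e) u $ 2)" if "u \<in> all_words (t # e)" for u
  proof -
    have "pos b (t # e) u = vector [pos b (t # e) u $ 1, pos b (t # e) u $ 2]" by (simp add: vec2_eq_iff)
    then show ?thesis using that hd_words unfolding occupied_def all_words_def by blast
  qed
  have "occupied b (t # e) i (pos b (t # e) v $ 1) (pos b (t # e) v $ 2)"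
    using occ[OF Cons.prems(1)] by (simp only: vw(1) list.sel)
  moreover have "occupied b (t # e) j (pos b (t # e) v $ 1) (pos b (t # e) v $ 2)"
    using occ[OF Cons.prems(2)] unfolding Cons.prems(3)[symmetric] by (simp only: vw(2) list.sel)
  ultimately have "i = j" using new.disjoint vw by blast
  with Cons vw show ?case by simp
qed

text \<open>\<open>no_edge\<close> leaves only the two legal directions, these lead to the
  neighbours of \<open>v\<close> in C, and by injectivity of positions the neighbour reached is
  \<open>w\<close>.\<close>

lemma no_extra_edge:
  assumes "0 < fst b" "fst b < snd b" "v \<in> all_words e" "w \<in> all_words e" "d < 8"
    "pos b e w = pos b e v + step (level b e) d"
  shows "\<exists>x\<in>set (C_words e). \<exists>y\<in>set (C_words e). C_edge b e x y \<and>
    (fst x = v \<and> fst y = w \<and> d = out_dir x \<or> fst y = v \<and> fst x = w \<and> d = (out_dir x + 4) mod 8)"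
proof -
  obtain p q where pq: "level b e = (p, q)" by fastforce
  interpret octant_board p q "occupied b e" using octant_board_occupied[OF pq] assms by simp
  have occ: "occupied b e (hd u) (pos b e u $ 1) (pos b e u $ 2) \<and> hd u < 8" if "u \<in> all_words e" for u
  proof -
    have "pos b e u = vector [pos b e u $ 1, pos b e u $ 2]" by (simp add: vec2_eq_iff)
    then show ?thesis using that hd_words unfolding occupied_def all_words_def by blast
  qed
  have "pos b e w $ 1 = pos b e v $ 1 + move_x p q d" "pos b e w $ 2 = pos b e v $ 2 + move_y p q d"
    by (simp_all add: assms(6) pq step_def)
  then have "d = (hd v + 4) mod 8 \<or> d = (hd v + 5) mod 8"
    using no_edge[of "hd v" "pos b e v $ 1" "pos b e v $ 2" "hd w" d] occ[OF assms(3)] occ[OF assms(4)] assms(5) by simp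
  then obtain x y where xy: "x \<in> set (C_words e)" "y \<in> set (C_words e)" "C_edge b e x y"
    "fst x = v \<and> d = out_dir x \<or> fst y = v \<and> d = (out_dir x + 4) mod 8"
    using C_words_neighbour[OF assms(3)] by metis
  have all: "fst x \<in> all_words e" "fst y \<in> all_words e" using xy set_C_words[of e] by auto
  have edge: "pos b e (fst y) = pos b e (fst x) + step (level b e) (out_dir x)" using xy(3) by (simp add: C_edge_def)
  have "out_dir x < 8" by (cases x) simp
  then have "fst x = v \<and> fst y = w \<and> d = out_dir x \<or> fst y = v \<and> fst x = w \<and> d = (out_dir x + 4) mod 8"
    using xy(4)
  proof (elim disjE conjE)
    assume x: "fst x = v" "d = out_dir x"
    then have "fst y = w" using edge assms(6) by (intro pos_inj[OF assms(1,2) all(2) assms(4)]) simp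
    with x show ?thesis by simp
  next
    assume y: "fst y = v" "d = (out_dir x + 4) mod 8"
    then have "fst x = w" using edge assms(6) step_opposite[OF \<open>out_dir x < 8\<close>, of "level b e"]
      by (intro pos_inj[OF assms(1,2) all(1) assms(4)]) simp
    with y show ?thesis by simp
  qed
  then show ?thesis using xy by blast
qed

section \<open>The moves along the second cycle\<close>

text \<open>Directions in the cycle \<open>D\<close> refer to the leaper with parameters \<open>(q - 2 p, p)\<close>,
  which is \<open>M\<close> for the origin \<open>h\<close>. For the other origins they are permuted.\<close>

definition base_step :: "int \<times> int \<Rightarrow> nat \<Rightarrow> square" where
  "base_step b = step (snd b - 2 * fst b, fst b)"

text \<open>The direction from the last square of piece 0 to the first square of piece 1, and in general from
  piece \<open>i\<close> to piece \<open>i + 1\<close>.\<close>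

fun next_junction :: "ltype \<Rightarrow> nat \<Rightarrow> nat" where
  "next_junction Tf j = j"
| "next_junction Tg j = j"
| "next_junction Th j = (13 - j) mod 8"
| "next_junction Thbar j = (15 - j) mod 8"

fun junction0 :: "ltype list \<Rightarrow> nat" where
  "junction0 [] = 3"
| "junction0 (t # e) = next_junction t (junction0 e)"

text \<open>Quarter turns carry the junction of pieces 0 and 1 to those with even \<open>i\<close>.
  The junctions with odd \<open>i\<close> are mirror images of these, traversed backwards; a
  reflection negates the direction up to a constant, whence \<open>- j\<close>.\<close>

definition junction :: "nat \<Rightarrow> nat \<Rightarrow> nat" where
  "junction j i = (if even i then (j + i) mod 8 else (14 + i - j) mod 8)"

lemma junction_less [simp]: "junction j i < 8"
  by (simp add: junction_def)

lemma junction0_less: "junction0 e < 8"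
proof (induction e)
  case (Cons t e)
  then show ?case by (cases t) auto
qed simp

text \<open>Twice the positions of the first and the last square of piece \<open>i\<close>, where
  \<open>v\<close> is the move from piece 0 to piece 1; doubling avoids halves. The midpoint of that
  move, doubled, is \<open>(p + q - v$2, q - p + v$1)\<close>, and the symmetries give the
  rest.\<close>

definition corner :: "int \<times> int \<Rightarrow> square \<Rightarrow> nat \<Rightarrow> square \<times> square" where
  "corner b v i = (case b of (p, q) \<Rightarrow>
     (let A = p + q - v $ 1 - v $ 2; B = q - p + v $ 1 - v $ 2; C = p + q + v $ 1 - v $ 2; D = q - p + v $ 1 + v $ 2 in
      [(vector [A, - B], vector [A, B]), (vector [C, D], vector [D, C]),
       (vector [B, A], vector [- B, A]), (vector [- D, C], vector [- C, D]),
       (vector [- A, B], vector [- A, - B]), (vector [- C, - D], vector [- D, - C]),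
       (vector [- B, - A], vector [B, - A]), (vector [D, - C], vector [C, - D])] ! i))"

lemma words_not_Nil [simp]: "words e i \<noteq> []"
proof (induction e arbitrary: i)
  case (Cons t e)
  then show ?case by (cases t) auto
qed simp

lemma hd_concat': "xs \<noteq> [] \<Longrightarrow> f (hd xs) \<noteq> [] \<Longrightarrow> hd (concat (map f xs)) = hd (f (hd xs))"
  by (cases xs) auto

lemma last_concat': "xs \<noteq> [] \<Longrightarrow> f (last xs) \<noteq> [] \<Longrightarrow> last (concat (map f xs)) = last (f (last xs))"
  by (cases xs rule: rev_cases) auto

lemma offsets_not_Nil [simp]: "offsets t i \<noteq> []"
  by (cases t) auto

lemma hd_words_Cons: "hd (words (t # e) i) = i # (if backward t i
     then last (words e ((i + last (offsets t i)) mod 8)) else hd (words e ((i + hd (offsets t i)) mod 8)))"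
  and last_words_Cons: "last (words (t # e) i) = i # (if backward t i
     then hd (words e ((i + hd (offsets t i)) mod 8)) else last (words e ((i + last (offsets t i)) mod 8)))"
  by (simp_all add: hd_map last_map hd_rev last_rev hd_concat' last_concat')

text \<open>Lifts of types f and g keep the junction move; h reflects it in the vertical axis and
  \<open>Thbar\<close> in the antidiagonal.\<close>

lemma base_step_junction0:
  fixes j
  assumes "j < 8" "v = base_step b j"
  shows "base_step b ((13 - j) mod 8) = vector [- v $ 1, v $ 2]"
    "base_step b ((15 - j) mod 8) = vector [- v $ 2, - v $ 1]"
  using assms unfolding less_8_cases
  by (auto simp: base_step_def step_simps)

lemma double_add: "2 *s (u + v) = 2 *s u + (2 *s v :: square)"
  by (simp add: vec2_eq_iff)

text \<open>The ends of a lifted piece are translated ends of old pieces, so they obey a recursion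
  that is closed in the parameters and the junction move.\<close>

lemma corners:
  "i < 8 \<Longrightarrow> 2 *s pos b e (hd (words e i)) = fst (corner (level b e) (base_step b (junction0 e)) i) \<and>
    2 *s pos b e (last (words e i)) = snd (corner (level b e) (base_step b (junction0 e)) i)"
proof (induction e arbitrary: i)
  case Nil
  obtain p q where "b = (p, q)" by fastforce
  with Nil show ?case unfolding less_8_cases
    by (elim disjE) (simp_all add: corner_def Let_def base_step_def step_simps anchor_simps vec2_eq_iff)
next
  case (Cons t e)
  obtain p q where pq: "level b e = (p, q)" by fastforce
  define v where "v = base_step b (junction0 e)"
  define v' where "v' = base_step b (junction0 (t # e))"
  have v': "v' = (case t of Tf \<Rightarrow> v | Tg \<Rightarrow> v | Th \<Rightarrow> vector [- v $ 1, v $ 2] | Thbar \<Rightarrow> vector [- v $ 2, - v $ 1])"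
    using base_step_junction0[OF junction0_less v_def] by (cases t) (simp_all add: v_def v'_def)
  have IH: "2 *s pos b e (hd (words e ((i + k) mod 8))) = fst (corner (p, q) v ((i + k) mod 8))"
    "2 *s pos b e (last (words e ((i + k) mod 8))) = snd (corner (p, q) v ((i + k) mod 8))" for k
    using Cons.IH[of "(i + k) mod 8"] by (simp_all add: pq v_def)
  show ?case
    unfolding hd_words_Cons last_words_Cons v'_def[symmetric] pos.simps double_add if_distrib[of "pos b e"]
      if_distrib[of "(*s) 2"] IH v' level.simps pq
    apply (use Cons.prems in \<open>unfold less_8_cases\<close>)
    apply (elim disjE)
    apply (cases t; simp add: corner_def Let_def anchor_simps vec2_eq_iff; fail)+
    done
qed

section \<open>Entering and leaving directions along the pieces of D\<close>

definition D_edge :: "int \<times> int \<Rightarrow> ltype list \<Rightarrow> nat list \<times> nat \<times> nat \<Rightarrow> nat list \<times> nat \<times> nat \<Rightarrow> bool" where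
  "D_edge b e x y \<longleftrightarrow> snd (snd x) = fst (snd y) \<and> pos b e (fst y) = pos b e (fst x) + base_step b (snd (snd x))"

fun reverse_dirs :: "nat list \<times> nat \<times> nat \<Rightarrow> nat list \<times> nat \<times> nat" where
  "reverse_dirs (w, i, o') = (w, (o' + 4) mod 8, (i + 4) mod 8)"

text \<open>The end squares of a reversed piece get new neighbours, so their outer directions must
  be replaced. The new ones follow from the invariant \<open>D_piece_ends\<close>: at both ends of
  each piece the cycle turns by +1.\<close>

fun fix_first :: "nat list \<times> nat \<times> nat \<Rightarrow> nat list \<times> nat \<times> nat" where
  "fix_first (w, i, o') = (w, (o' + 7) mod 8, o')"

fun fix_last :: "nat list \<times> nat \<times> nat \<Rightarrow> nat list \<times> nat \<times> nat" where
  "fix_last (w, i, o') = (w, i, (i + 1) mod 8)"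

definition on_ends :: "('a \<Rightarrow> 'a) \<Rightarrow> ('a \<Rightarrow> 'a) \<Rightarrow> 'a list \<Rightarrow> 'a list" where
  "on_ends f g xs = f (hd xs) # butlast (tl xs) @ [g (last xs)]"

text \<open>Each square of piece \<open>i\<close> of \<open>D\<close> with the directions of the moves by which it is entered and left.\<close>

fun D_piece :: "ltype list \<Rightarrow> nat \<Rightarrow> (nat list \<times> nat \<times> nat) list" where
  "D_piece [] i = [([i], (i + 2) mod 8, (i + 3) mod 8)]"
| "D_piece (t # e) i = map (apfst ((#) i))
     (let xs = concat (map (\<lambda>k. D_piece e ((i + k) mod 8)) (offsets t i)) in
      if backward t i then on_ends fix_first fix_last (rev (map reverse_dirs xs)) else xs)"

text \<open>Not the sense of the turn but its sense relative to the parity of \<open>i\<close>: this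
  letter is the same for both orientations of the cycle.\<close>

fun turn_type :: "nat list \<times> nat \<times> nat \<Rightarrow> bool" where
  "turn_type (w, i, o') \<longleftrightarrow> (odd i \<longleftrightarrow> o' = (i + 1) mod 8)"

text \<open>Only the parity of the index matters, so it is not reduced modulo 8. The ends of a
  reversed piece are toggled because replacing the outer direction changes the sense of the turn and
  keeps the inner move.\<close>

fun types :: "ltype list \<Rightarrow> nat \<Rightarrow> bool list" where
  "types [] i = [odd i]"
| "types (t # e) i = (let xs = concat (map (\<lambda>k. types e (i + k)) (offsets t i)) in
      if backward t i then on_ends Not Not (rev xs) else xs)"

lemma on_ends_Cons_snoc: "on_ends f g (x # xs @ [y]) = f x # xs @ [g y]"
  by (simp add: on_ends_def)

lemma on_ends_not_Nil [simp]: "on_ends f g xs \<noteq> []"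
  by (simp add: on_ends_def)

lemma concat_ends:
  assumes "2 \<le> length ks" "\<And>k. k \<in> set ks \<Longrightarrow> f k \<noteq> []"
  obtains x xs y where "concat (map f ks) = x # xs @ [y]"
proof -
  obtain k l ls where ks: "ks = k # ls @ [l]"
    using assms(1) by (cases ks; cases "tl ks" rule: rev_cases) auto
  then have "f k \<noteq> []" "f l \<noteq> []" using assms(2) by auto
  then obtain x xs ys y where "f k = x # xs" "f l = ys @ [y]" by (meson list.exhaust rev_exhaust)
  with ks that show ?thesis by simp
qed

lemma backward_offsets: "backward t i \<Longrightarrow> 2 \<le> length (offsets t i)"
  by (cases t) auto

lemma map_on_ends: "2 \<le> length xs \<Longrightarrow> (\<And>x. h (f x) = f' (h x)) \<Longrightarrow> (\<And>x. h (g x) = g' (h x)) \<Longrightarrow>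
    map h (on_ends f g xs) = on_ends f' g' (map h xs)"
  by (cases xs) (simp_all add: on_ends_def hd_map last_map map_butlast map_tl)

lemma set_on_ends: "z \<in> set (on_ends f g xs) \<Longrightarrow> xs \<noteq> [] \<Longrightarrow> \<exists>x\<in>set xs. z = f x \<or> z = x \<or> z = g x"
  unfolding on_ends_def using in_set_butlastD[of z "tl xs"] list.set_sel(2)[of xs]
  by (auto)

lemma D_piece_not_Nil [simp]: "D_piece e i \<noteq> []"
proof (induction e arbitrary: i)
  case (Cons t e)
  then have "concat (map (\<lambda>k. D_piece e ((i + k) mod 8)) (offsets t i)) \<noteq> []"
    using hd_in_set[OF offsets_not_Nil[of t i]] by (auto simp del: hd_in_set)
  then show ?case by (auto simp: Let_def on_ends_def)
qed simp

lemma length_concat_D_piece: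
  "backward t i \<Longrightarrow> 2 \<le> length (concat (map (\<lambda>k. D_piece e ((i + k) mod 8)) (offsets t i)))"
  by (rule concat_ends[OF backward_offsets D_piece_not_Nil, of t i "\<lambda>k. e" "\<lambda>k. (i + k) mod 8"]) simp_all

lemma fst_reverse_dirs: "fst (reverse_dirs x) = fst x" by (cases x) auto
lemma fst_fix: "fst (fix_first x) = fst x" "fst (fix_last x) = fst x" by (cases x; auto)+

lemma on_ends_id: "2 \<le> length xs \<Longrightarrow> on_ends id id xs = xs"
  by (cases xs; cases "tl xs" rule: rev_cases) (auto simp: on_ends_def)

lemma map_fst_D_piece: "map fst (D_piece e i) = words e i"
proof (induction e arbitrary: i)
  case (Cons t e)
  let ?xs = "concat (map (\<lambda>k. D_piece e ((i + k) mod 8)) (offsets t i))"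
  have fst: "map fst ?xs = concat (map (\<lambda>k. words e ((i + k) mod 8)) (offsets t i))"
    by (simp add: map_concat comp_def Cons)
  have "map fst (on_ends fix_first fix_last (rev (map reverse_dirs ?xs))) = rev (map fst ?xs)" if "backward t i"
  proof -
    have len: "2 \<le> length (rev (map reverse_dirs ?xs))" using length_concat_D_piece[OF that] by simp
    have "map fst (on_ends fix_first fix_last (rev (map reverse_dirs ?xs))) =
        on_ends id id (map fst (rev (map reverse_dirs ?xs)))"
      by (rule map_on_ends[OF len]) (simp_all add: fst_fix)
    also have "\<dots> = map fst (rev (map reverse_dirs ?xs))" by (rule on_ends_id) (use len in simp)
    also have "\<dots> = rev (map fst ?xs)" by (simp add: rev_map comp_def fst_reverse_dirs)
    finally show ?thesis .
  qed
  moreover have "map fst (map (apfst ((#) i)) ys) = map ((#) i) (map fst ys)" for ys :: "(nat list \<times> nat \<times> nat) list"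
    by (simp add: comp_def)
  ultimately show ?case unfolding D_piece.simps words.simps Let_def
    by (cases "backward t i") (simp_all only: if_True if_False fst id_apply)
qed simp

lemma D_piece_dirs: "(w, j, k) \<in> set (D_piece e i) \<Longrightarrow> j < 8 \<and> k < 8 \<and> (k = (j + 1) mod 8 \<or> k = (j + 7) mod 8)"
proof -
  define P where "P x \<longleftrightarrow> fst (snd x) < 8 \<and> snd (snd x) < 8 \<and>
    (snd (snd x) = (fst (snd x) + 1) mod 8 \<or> snd (snd x) = (fst (snd x) + 7) mod 8)" for x :: "nat list \<times> nat \<times> nat"
  have rev: "P (reverse_dirs x)" if "P x" for x
    using that unfolding P_def by (cases x) (auto simp: less_8_cases)
  have fixed: "P (fix_first x)" "P (fix_last x)" if "P x" for x
    using that unfolding P_def by (cases x; auto simp: less_8_cases)+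
  have "\<forall>x\<in>set (D_piece e i). P x"
  proof (induction e arbitrary: i)
    case Nil
    then show ?case by (auto simp: P_def mod_simps ac_simps)
  next
    case (Cons t e)
    define xs where "xs = concat (map (\<lambda>k. D_piece e ((i + k) mod 8)) (offsets t i))"
    have xs: "P x" if "x \<in> set xs" for x
      using that Cons.IH by (auto simp: xs_def)
    have "P x" if x: "x \<in> set (on_ends fix_first fix_last (rev (map reverse_dirs xs)))" and "backward t i" for x
    proof -
      have "rev (map reverse_dirs xs) \<noteq> []" using length_concat_D_piece[OF that(2), of e] by (auto simp: xs_def)
      from set_on_ends[OF x this] obtain z where z: "z \<in> set xs"
        "x = fix_first (reverse_dirs z) \<or> x = reverse_dirs z \<or> x = fix_last (reverse_dirs z)" by auto
      from rev[OF xs[OF z(1)]] z(2) fixed show ?thesis by blast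
    qed
    then have "\<forall>x\<in>set (if backward t i then on_ends fix_first fix_last (rev (map reverse_dirs xs)) else xs). P x"
      using xs by (cases "backward t i") auto
    moreover have "P (apfst ((#) i) x) = P x" for x by (simp add: P_def)
    ultimately show ?case unfolding D_piece.simps Let_def xs_def[symmetric] set_map by blast
  qed
  then show "(w, j, k) \<in> set (D_piece e i) \<Longrightarrow> ?thesis" unfolding P_def by fastforce
qed

lemma types_mod: "types e (i mod 8) = types e i"
proof (induction e arbitrary: i)
  case Nil
  show ?case by (simp add: odd_iff_mod_2_eq_one mod_mod_cancel)
next
  case (Cons t e)
  have par: "even (i mod 8) = even i" by (simp add: even_iff_mod_2_eq_zero mod_mod_cancel)
  have "offsets t (i mod 8) = offsets t i" "backward t (i mod 8) = backward t i" using par by (cases t; simp)+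
  moreover have "types e (i mod 8 + k) = types e (i + k)" for k
    using Cons[of "i mod 8 + k"] Cons[of "i + k"] by (simp add: mod_simps)
  ultimately show ?case by simp
qed

text \<open>Reversal and the correction of the ends add up to the constants here: \<open>J\<close>
  becomes \<open>J + 4\<close> and \<open>J - 1\<close> becomes \<open>J + 3\<close> on reversal,
  and \<open>fix_first\<close> then enters in direction \<open>J + 2\<close>; similarly
  \<open>J + 6\<close> for \<open>fix_last\<close>.\<close>

lemma junction_lift:
  assumes "i < 8" "j < 8"
  shows "backward t i \<Longrightarrow> (junction j ((i + last (offsets t i)) mod 8) + 2) mod 8 = junction (next_junction t j) ((i + 7) mod 8)"
    "backward t i \<Longrightarrow> (junction j (((i + hd (offsets t i)) mod 8 + 7) mod 8) + 6) mod 8 = junction (next_junction t j) i"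
    "\<not> backward t i \<Longrightarrow> junction j (((i + hd (offsets t i)) mod 8 + 7) mod 8) = junction (next_junction t j) ((i + 7) mod 8)"
    "\<not> backward t i \<Longrightarrow> junction j ((i + last (offsets t i)) mod 8) = junction (next_junction t j) i"
proof -
  have *: "if backward t i
      then (junction j ((i + last (offsets t i)) mod 8) + 2) mod 8 = junction (next_junction t j) ((i + 7) mod 8) \<and>
        (junction j (((i + hd (offsets t i)) mod 8 + 7) mod 8) + 6) mod 8 = junction (next_junction t j) i
      else junction j (((i + hd (offsets t i)) mod 8 + 7) mod 8) = junction (next_junction t j) ((i + 7) mod 8) \<and>
        junction j ((i + last (offsets t i)) mod 8) = junction (next_junction t j) i"
    using assms[unfolded less_8_cases]
    apply (elim disjE)
    apply (cases t; simp add: junction_def; fail)+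
    done
  show "backward t i \<Longrightarrow> (junction j ((i + last (offsets t i)) mod 8) + 2) mod 8 = junction (next_junction t j) ((i + 7) mod 8)"
    "backward t i \<Longrightarrow> (junction j (((i + hd (offsets t i)) mod 8 + 7) mod 8) + 6) mod 8 = junction (next_junction t j) i"
    "\<not> backward t i \<Longrightarrow> junction j (((i + hd (offsets t i)) mod 8 + 7) mod 8) = junction (next_junction t j) ((i + 7) mod 8)"
    "\<not> backward t i \<Longrightarrow> junction j ((i + last (offsets t i)) mod 8) = junction (next_junction t j) i"
    using * by (simp_all split: if_splits)
qed

lemma hd_on_ends: "hd (on_ends f g xs) = f (hd xs)" and last_on_ends: "last (on_ends f g xs) = g (last xs)"
  by (simp_all add: on_ends_def)

lemma snd_reverse_dirs: "snd (reverse_dirs x) = ((snd (snd x) + 4) mod 8, (fst (snd x) + 4) mod 8)"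
  and snd_fix_first: "snd (fix_first x) = ((snd (snd x) + 7) mod 8, snd (snd x))"
  and snd_fix_last: "snd (fix_last x) = (fst (snd x), (fst (snd x) + 1) mod 8)"
  by (cases x; simp)+

text \<open>The invariant that justifies \<open>fix_first\<close> and \<open>fix_last\<close>: both
  end squares turn by +1, and the outer moves are the junctions with the adjacent pieces.\<close>

lemma D_piece_ends:
  fixes e
  assumes "i < 8"
  defines "J \<equiv> junction (junction0 e)"
  shows "snd (hd (D_piece e i)) = (J ((i + 7) mod 8), (J ((i + 7) mod 8) + 1) mod 8)"
    "snd (last (D_piece e i)) = ((J i + 7) mod 8, J i)"
proof -
  have "snd (hd (D_piece e i)) = (junction (junction0 e) ((i + 7) mod 8), (junction (junction0 e) ((i + 7) mod 8) + 1) mod 8) \<and>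
    snd (last (D_piece e i)) = ((junction (junction0 e) i + 7) mod 8, junction (junction0 e) i)"
    using assms(1)
  proof (induction e arbitrary: i)
    case Nil
    then show ?case unfolding less_8_cases by (elim disjE) (simp_all add: junction_def)
  next
    case (Cons t e)
    define xs where "xs = concat (map (\<lambda>k. D_piece e ((i + k) mod 8)) (offsets t i))"
    define k l where "k = (i + hd (offsets t i)) mod 8" and "l = (i + last (offsets t i)) mod 8"
    define j where "j = junction0 e"
    have xs: "hd xs = hd (D_piece e k)" "last xs = last (D_piece e l)" "xs \<noteq> []"
      using hd_concat'[of "offsets t i" "\<lambda>k. D_piece e ((i + k) mod 8)"]
        last_concat'[of "offsets t i" "\<lambda>k. D_piece e ((i + k) mod 8)"] hd_in_set[OF offsets_not_Nil[of t i]]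
      by (auto simp: xs_def k_def l_def simp del: hd_in_set)
    have "k < 8" "l < 8" by (auto simp: k_def l_def)
    note IH = Cons.IH[OF this(1)] Cons.IH[OF this(2)]
    note J = junction_lift[OF Cons.prems junction0_less[of e], of t, folded k_def l_def j_def]
    have D: "hd (D_piece (t # e) i) = apfst ((#) i) (if backward t i then fix_first (reverse_dirs (last xs)) else hd xs)"
      "last (D_piece (t # e) i) = apfst ((#) i) (if backward t i then fix_last (reverse_dirs (hd xs)) else last xs)"
      using xs(3) by (simp_all add: xs_def[symmetric] Let_def hd_map last_map hd_on_ends last_on_ends hd_rev last_rev)
    have sub: "((x + 1) mod 8 + 4) mod 8 = (x + 5) mod 8" "((x + 7) mod 8 + 4) mod 8 = (x + 3) mod 8"
      "((x + 3) mod 8 + 7) mod 8 = (x + 2) mod 8" "((x + 5) mod 8 + 1) mod 8 = (x + 6) mod 8"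
      "((x + 2) mod 8 + 1) mod 8 = (x + 3) mod 8" "((x + 6) mod 8 + 7) mod 8 = (x + 5) mod 8" if "x < 8" for x :: nat
      using that unfolding less_8_cases by auto
    show ?case
    proof (cases "backward t i")
      case True
      show ?thesis unfolding D junction0.simps j_def[symmetric] J(1,2)[OF True, symmetric]
        using True IH by (simp add: xs snd_fix_first snd_fix_last snd_reverse_dirs sub j_def)
    next
      case False
      show ?thesis unfolding D junction0.simps j_def[symmetric] J(3,4)[OF False, symmetric]
        using False IH by (simp add: xs j_def)
    qed
  qed
  then show "snd (hd (D_piece e i)) = (J ((i + 7) mod 8), (J ((i + 7) mod 8) + 1) mod 8)"
    "snd (last (D_piece e i)) = ((J i + 7) mod 8, J i)"
    by (simp_all add: J_def)
qed

lemma turn_type_reverse: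
  "j < 8 \<Longrightarrow> k < 8 \<Longrightarrow> k = (j + 1) mod 8 \<or> k = (j + 7) mod 8 \<Longrightarrow> turn_type (reverse_dirs (w, j, k)) = turn_type (w, j, k)"
  unfolding less_8_cases[of j] by (elim disjE) auto

lemma turn_type_fix:
  assumes "j < 8"
  shows "turn_type (fix_first (reverse_dirs (w, (j + 7) mod 8, j))) = (\<not> turn_type (w, (j + 7) mod 8, j))"
    "turn_type (fix_last (reverse_dirs (w, j, (j + 1) mod 8))) = (\<not> turn_type (w, j, (j + 1) mod 8))"
  using assms unfolding less_8_cases by auto

lemma types_D_piece: "i < 8 \<Longrightarrow> map turn_type (D_piece e i) = types e i"
proof (induction e arbitrary: i)
  case Nil
  then show ?case unfolding less_8_cases by (elim disjE) auto
next
  case (Cons t e)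
  define xs where "xs = concat (map (\<lambda>k. D_piece e ((i + k) mod 8)) (offsets t i))"
  have types: "map turn_type xs = concat (map (\<lambda>k. types e (i + k)) (offsets t i))"
    by (simp add: xs_def map_concat comp_def Cons types_mod)
  have rev: "turn_type (reverse_dirs x) = turn_type x" if "x \<in> set xs" for x
  proof -
    obtain w j k where x: "x = (w, j, k)" by (metis surj_pair)
    from that obtain l where "x \<in> set (D_piece e l)" by (auto simp: xs_def)
    from D_piece_dirs[OF this[unfolded x]] show ?thesis unfolding x by (intro turn_type_reverse) auto
  qed
  have "map turn_type (on_ends fix_first fix_last (rev (map reverse_dirs xs))) = on_ends Not Not (rev (map turn_type xs))"
    if bw: "backward t i"
  proof -
    obtain x ms y where xs': "xs = x # ms @ [y]"
      unfolding xs_def by (rule concat_ends[OF backward_offsets[OF bw] D_piece_not_Nil])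
    have "x = hd (D_piece e ((i + hd (offsets t i)) mod 8))" "y = last (D_piece e ((i + last (offsets t i)) mod 8))"
      using hd_concat'[of "offsets t i" "\<lambda>k. D_piece e ((i + k) mod 8)"]
        last_concat'[of "offsets t i" "\<lambda>k. D_piece e ((i + k) mod 8)"] arg_cong[OF xs', of hd] arg_cong[OF xs', of last]
      unfolding xs_def by auto
    then have "snd x = (fst (snd x), (fst (snd x) + 1) mod 8)" "fst (snd x) < 8"
      "snd y = ((snd (snd y) + 7) mod 8, snd (snd y))" "snd (snd y) < 8"
      using D_piece_ends[of "(i + hd (offsets t i)) mod 8" e] D_piece_ends[of "(i + last (offsets t i)) mod 8" e] by auto
    then have "turn_type (fix_last (reverse_dirs x)) = (\<not> turn_type x)" "turn_type (fix_first (reverse_dirs y)) = (\<not> turn_type y)"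
      using turn_type_fix[of "fst (snd x)" "fst x"] turn_type_fix[of "snd (snd y)" "fst y"] by (metis prod.collapse)+
    moreover have "map turn_type (map reverse_dirs ms) = map turn_type ms" using rev by (auto simp: xs')
    ultimately show ?thesis by (simp add: xs' on_ends_Cons_snoc rev_map[symmetric] del: map_map)
  qed
  moreover have "map turn_type (map (apfst ((#) i)) ys) = map turn_type ys" for ys
    by (auto simp: comp_def)
  ultimately show ?case unfolding D_piece.simps types.simps Let_def xs_def[symmetric] by (simp add: types del: map_map)
qed

lemma corner_edge:
  assumes "i < 8" "j < 8"
  shows "snd (corner c (base_step b j) i) + 2 *s base_step b (junction j i) = fst (corner c (base_step b j) ((i + 1) mod 8))"
proof -
  obtain p q where c: "c = (p, q)" by fastforce
  show ?thesis
    using assms[unfolded less_8_cases]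
    apply (elim disjE)
    apply (simp add: c corner_def Let_def junction_def base_step_def step_simps vec2_eq_iff; fail)+
    done
qed

lemma double_cancel: "2 *s u = 2 *s v \<longleftrightarrow> u = (v :: square)"
  by (simp add: vec2_eq_iff)

lemma D_edge_junction:
  assumes "i < 8"
  shows "D_edge b e (last (D_piece e i)) (hd (D_piece e ((i + 1) mod 8)))"
proof -
  have "(i + 1) mod 8 < 8" "((i + 1) mod 8 + 7) mod 8 = i" using assms by (auto simp: less_8_cases)
  note ends = D_piece_ends(2)[OF assms, of e] D_piece_ends(1)[OF this(1), of e, unfolded this(2)]
  have "fst (last (D_piece e i)) = last (words e i)" "fst (hd (D_piece e ((i + 1) mod 8))) = hd (words e ((i + 1) mod 8))"
    by (simp_all add: map_fst_D_piece[symmetric] last_map hd_map)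
  moreover have "2 *s pos b e (hd (words e ((i + 1) mod 8))) =
    2 *s (pos b e (last (words e i)) + base_step b (junction (junction0 e) i))"
    using corners[of "(i + 1) mod 8" b e] corners[OF assms, of b e] corner_edge[OF assms junction0_less, of "level b e" b e]
    by (simp add: double_add)
  ultimately show ?thesis using ends unfolding double_cancel by (simp add: D_edge_def)
qed

lemma base_step_opposite: "d < 8 \<Longrightarrow> base_step b ((d + 4) mod 8) = - base_step b d"
  by (simp add: base_step_def step_opposite)

lemma D_edge_reverse:
  assumes "D_edge b e x y" "snd (snd x) < 8" "fst (snd y) < 8"
  shows "D_edge b e (reverse_dirs y) (reverse_dirs x)"
  using assms base_step_opposite[of "fst (snd y)" b] by (cases x; cases y) (simp add: D_edge_def)

lemma D_edge_fix:
  "D_edge b e (fix_first x) y = D_edge b e x y" "D_edge b e x (fix_last y) = D_edge b e x y"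
  by (cases x, cases y, simp add: D_edge_def)+

lemma successively_on_ends:
  assumes "successively R xs" "2 \<le> length xs" "\<And>x y. R (f x) y = R x y" "\<And>x y. R x (g y) = R x y"
  shows "successively R (on_ends f g xs)"
proof -
  obtain x ms y where "xs = x # ms @ [y]"
    using assms(2) by (cases xs; cases "tl xs" rule: rev_cases) auto
  with assms show ?thesis
    by (cases "ms = []") (auto simp: on_ends_Cons_snoc on_ends_def[of f g "[x, y]"] successively_Cons successively_append_iff hd_append)
qed

text \<open>Inside a reversed piece each edge is a reversed edge. The corrections at the ends do not
  show, since \<open>D_edge\<close> disregards the entering direction of its first and the leaving
  direction of its second argument.\<close>

lemma successively_D_piece: "successively (D_edge b e) (D_piece e i)"
proof (induction e arbitrary: i)
  case (Cons t e)
  define xs where "xs = concat (map (\<lambda>k. D_piece e ((i + k) mod 8)) (offsets t i))"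
  have "successively (\<lambda>k l. l mod 8 = (k + 1) mod 8) (offsets t i)" by (cases t) auto
  then have "successively (D_edge b e) xs"
    unfolding xs_def
  proof (rule successively_concat[THEN conjunct1, rotated 2])
    show "D_edge b e (last (D_piece e ((i + k) mod 8))) (hd (D_piece e ((i + l) mod 8)))"
      if "l mod 8 = (k + 1) mod 8" for k l
    proof -
      have "(i + l) mod 8 = (i + l mod 8) mod 8" by (simp add: mod_simps)
      also have "\<dots> = ((i + k) mod 8 + 1) mod 8" unfolding that by (simp add: mod_simps ac_simps)
      finally show ?thesis using D_edge_junction[of "(i + k) mod 8" b e] by simp
    qed
  qed (use Cons in auto)
  moreover have "successively (D_edge b e) (on_ends fix_first fix_last (rev (map reverse_dirs xs)))" if "backward t i"
  proof (rule successively_on_ends)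
    have *: "snd (snd x) < 8 \<and> fst (snd x) < 8" if "x \<in> set xs" for x
      using that D_piece_dirs[of "fst x" "fst (snd x)" "snd (snd x)" e] by (auto simp: xs_def)
    have "successively (\<lambda>x y. D_edge b e (reverse_dirs y) (reverse_dirs x)) xs"
      by (rule successively_mono[OF \<open>successively (D_edge b e) xs\<close>]) (use * D_edge_reverse in blast)
    then show "successively (D_edge b e) (rev (map reverse_dirs xs))"
      by (simp add: successively_rev successively_map)
    show "2 \<le> length (rev (map reverse_dirs xs))" using length_concat_D_piece[OF that] by (simp add: xs_def)
  qed (simp_all add: D_edge_fix)
  moreover have "successively (D_edge b (t # e)) (map (apfst ((#) i)) ys)" if "successively (D_edge b e) ys" for ys
    using that unfolding successively_map by (rule successively_mono) (cases "level b e"; auto simp: D_edge_def)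
  ultimately show ?case unfolding D_piece.simps Let_def xs_def[symmetric] by simp
qed simp

definition D_list :: "ltype list \<Rightarrow> (nat list \<times> nat \<times> nat) list" where
  "D_list e = concat (map (D_piece e) [0..<8])"

lemma cyclic_D_list: "cyclic (D_edge b e) (D_list e)"
  unfolding D_list_def
proof (rule cyclic_concat)
  show "cyclic (\<lambda>i j. i < 8 \<and> j = (i + 1) mod 8) [0..<8]"
    by (auto simp: cyclic_iff Suc_eq_plus1)
  show "D_piece e i \<noteq> [] \<and> successively (D_edge b e) (D_piece e i)" for i
    using successively_D_piece by simp
  show "D_edge b e (last (D_piece e i)) (hd (D_piece e j))" if "i < 8 \<and> j = (i + 1) mod 8" for i j
    using D_edge_junction that by simp
qed

lemma map_fst_D_list: "map fst (D_list e) = concat (map (words e) [0..<8])"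
  by (simp add: D_list_def map_concat comp_def map_fst_D_piece)

lemma types_D_list: "map turn_type (D_list e) = concat (map (types e) [0..<8])"
  unfolding D_list_def map_concat map_map comp_def
  by (rule arg_cong[where f = concat]) (auto simp: types_D_piece)

section \<open>Words of turns and flips\<close>

fun type_letter :: "ltype \<Rightarrow> bool" where
  "type_letter Tf = True"
| "type_letter Tg = False"
| "type_letter Th = True"
| "type_letter Thbar = False"

fun type_long :: "ltype \<Rightarrow> bool" where
  "type_long Tf = False"
| "type_long Tg = False"
| "type_long Th = True"
| "type_long Thbar = True"

text \<open>Alternating blocks that begin and end with \<open>c\<close>, of lengths 1 and 3, or 3
  and 5 if \<open>l\<close>: the parities of the pieces along one fibre.\<close>

definition letter_subst :: "bool \<Rightarrow> bool \<Rightarrow> bool \<Rightarrow> bool list" where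
  "letter_subst c l z = (if l \<and> z = c then [c, \<not> c, c, \<not> c, c] else if l \<or> z \<noteq> c then [c, \<not> c, c] else [c])"

definition subst :: "bool \<Rightarrow> bool \<Rightarrow> bool list \<Rightarrow> bool list" where
  "subst c l zs = concat (map (letter_subst c l) zs)"

lemma subst_append [simp]: "subst c l (xs @ ys) = subst c l xs @ subst c l ys"
  and subst_Nil [simp]: "subst c l [] = []"
  and subst_Cons: "subst c l (x # xs) = letter_subst c l x @ subst c l xs"
  by (simp_all add: subst_def)

text \<open>How the words of turns change when a first lift is inserted: in the free group, they are
  mapped by the automorphism \<open>subst\<close> and multiplied on both sides by \<open>c\<close> or its inverse.\<close>

definition twisted :: "bool \<Rightarrow> bool \<Rightarrow> bool list \<Rightarrow> bool list \<Rightarrow> bool" where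
  "twisted c l W W' \<longleftrightarrow> W \<noteq> [] \<and> W' \<noteq> [] \<and>
     (if (hd W = c) = l then subst c l W = c # W' @ [c] else W' = c # subst c l W @ [c])"

text \<open>Neighbouring factors begin with different letters, so they are twisted in opposite ways;
  the letters \<open>c\<close> between them cancel and the outer ones remain.\<close>

lemma twisted_product:
  assumes "twisted c l W1 W1'" "twisted c l W2 W2'" "hd W2 = (\<not> hd W1)"
  shows "twisted c l (W1 @ W2 @ W1) (W1' @ W2' @ W1')"
  using assms by (cases c; cases l; cases "hd W1") (auto simp: twisted_def)

lemma twisted_product5:
  assumes "twisted c l W1 W1'" "twisted c l W2 W2'" "hd W2 = (\<not> hd W1)"
  shows "twisted c l (W1 @ W2 @ W1 @ W2 @ W1) (W1' @ W2' @ W1' @ W2' @ W1')"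
  using assms by (cases c; cases l; cases "hd W1") (auto simp: twisted_def)

text \<open>Toggling \<open>x\<close> reverses the kind of twist, and the letter gained or lost
  makes up for the different lengths of the blocks of the two letters.\<close>

lemma twisted_on_ends:
  assumes "twisted c l W W'" "W = x # k @ [x]" "W' = y # k' @ [y']"
  shows "twisted c l (on_ends Not Not W) (on_ends Not Not W')"
proof -
  have ends: "on_ends Not Not W = (\<not> x) # k @ [\<not> x]" "on_ends Not Not W' = (\<not> y) # k' @ [\<not> y']"
    by (simp_all add: assms on_ends_Cons_snoc)
  show ?thesis
    using assms unfolding ends
    by (cases x; cases c; cases l) (auto simp: twisted_def subst_Cons letter_subst_def)
qed

lemma types_parity: "types e i = types e (if even i then 0 else 1)"
proof (induction e arbitrary: i)
  case (Cons t e)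
  have "types e (i + k) = types e ((if even i then 0 else 1) + k)" for k
    using Cons[of "i + k"] Cons[of "(if even i then 0 else 1) + k"] by simp
  moreover have "offsets t i = offsets t (if even i then 0 else 1)" "backward t i = backward t (if even i then 0 else 1)"
    by (cases t; simp)+
  ultimately show ?case by (simp only: types.simps)
qed auto

lemma types_not_Nil [simp]: "types e i \<noteq> []"
proof (induction e arbitrary: i)
  case (Cons t e)
  then have "concat (map (\<lambda>k. types e (i + k)) (offsets t i)) \<noteq> []"
    using hd_in_set[OF offsets_not_Nil[of t i]] by (auto simp del: hd_in_set)
  then show ?case by (auto simp: Let_def)
qed simp

lemma types_even_odd: "even i \<Longrightarrow> types e i = types e 0" "odd i \<Longrightarrow> types e i = types e 1"
  using types_parity[of e i] by auto

lemma types_even_odd_numeral: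
  "types e 2 = types e 0" "types e 3 = types e 1" "types e 4 = types e 0" "types e 5 = types e 1"
  "types e 6 = types e 0" "types e 7 = types e 1" "types e 8 = types e 0"
  by (rule types_even_odd; simp)+

lemma rev_on_ends:
  assumes "2 \<le> length xs"
  shows "rev (on_ends f f xs) = on_ends f f (rev xs)"
proof -
  obtain x ms y where "xs = x # ms @ [y]"
    using assms by (cases xs; cases "tl xs" rule: rev_cases) auto
  then show ?thesis by (simp add: on_ends_def)
qed

lemma types_lift:
  fixes e defines "U \<equiv> types e 0" and "V \<equiv> types e 1"
  assumes "rev U = U" "rev V = V"
  shows "types (Tf # e) 0 = on_ends Not Not (V @ U @ V)" "types (Tf # e) 1 = V"
    "types (Tg # e) 0 = U" "types (Tg # e) 1 = on_ends Not Not (U @ V @ U)"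
    "types (Th # e) 0 = on_ends Not Not (U @ V @ U @ V @ U)" "types (Th # e) 1 = U @ V @ U"
    "types (Thbar # e) 0 = V @ U @ V" "types (Thbar # e) 1 = on_ends Not Not (V @ U @ V @ U @ V)"
  using assms(3,4) by (simp_all add: Let_def U_def V_def types_even_odd_numeral)

lemma length_types: "1 \<le> length (types e i)"
  using types_not_Nil[of e i] by (cases "types e i") auto

text \<open>Each piece is symmetric about its own ray. This removes the reversals from the recursion
  and leaves products and toggled ends.\<close>

lemma rev_types: "rev (types e i) = types e i"
proof (induction e arbitrary: i)
  case (Cons t e)
  note lift = types_lift[OF Cons Cons]
  have len: "2 \<le> length (types e i @ types e j @ zs)" for i j zs
    using length_types[of e i] length_types[of e j] by simp
  have "rev (types (t # e) 0) = types (t # e) 0 \<and> rev (types (t # e) 1) = types (t # e) 1"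
    by (cases t) (simp_all only: lift rev_on_ends[OF len] rev_append Cons append_assoc)
  then show ?case using types_parity[of "t # e" i] by auto
qed simp

text \<open>This provides the opposite twists that \<open>twisted_product\<close> needs.\<close>

lemma hd_types: "hd (types e 1) = (\<not> hd (types e 0))"
proof (induction e)
  case (Cons t e)
  have "hd (on_ends Not Not (types e i @ zs)) = (\<not> hd (types e i))" for i zs
    by (simp add: on_ends_def)
  then show ?case using Cons by (cases t) (simp_all only: types_lift[OF rev_types rev_types] hd_append2[OF types_not_Nil], auto)
qed simp

lemma last_types: "last (types e i) = hd (types e i)"
  using rev_types[of e i] by (metis hd_rev)

text \<open>A lift only forms products of the words of pieces 0 and 1 and toggles ends; both
  operations respect the twist.\<close>

lemma twisted_types_lift:
  assumes "twisted c l (types e 0) (types e' 0)" "twisted c l (types e 1) (types e' 1)"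
  shows "twisted c l (types (t # e) i) (types (t # e') i)"
proof -
  note lift = types_lift[OF rev_types rev_types]
  have ends: "\<exists>k. types e i @ zs @ types e i = hd (types e i) # k @ [hd (types e i)]" for e i zs
  proof -
    have "types e i @ zs @ types e i = hd (types e i) # (tl (types e i) @ zs @ butlast (types e i)) @ [last (types e i)]"
      by simp
    then show ?thesis unfolding last_types by blast
  qed
  have ends5: "\<exists>k. types e i @ y @ z @ w @ types e i = hd (types e i) # k @ [hd (types e i)]" for e i y z w
    using ends[of e i "y @ z @ w"] by simp
  have 3: "twisted c l (types e i @ types e j @ types e i) (types e' i @ types e' j @ types e' i)"
    "twisted c l (types e i @ types e j @ types e i @ types e j @ types e i)
      (types e' i @ types e' j @ types e' i @ types e' j @ types e' i)"
    if "i = 0 \<and> j = 1 \<or> i = 1 \<and> j = 0" for i j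
    using that assms hd_types[of e] by (auto intro: twisted_product twisted_product5)
  have 4: "twisted c l (on_ends Not Not (types e i @ types e j @ types e i))
      (on_ends Not Not (types e' i @ types e' j @ types e' i))"
    "twisted c l (on_ends Not Not (types e i @ types e j @ types e i @ types e j @ types e i))
      (on_ends Not Not (types e' i @ types e' j @ types e' i @ types e' j @ types e' i))"
    if "i = 0 \<and> j = 1 \<or> i = 1 \<and> j = 0" for i j
    using twisted_on_ends[OF 3(1)[OF that]] twisted_on_ends[OF 3(2)[OF that]]
      ends[of e i "types e j"] ends[of e' i "types e' j"]
      ends5[of e i "types e j" "types e i" "types e j"] ends5[of e' i "types e' j" "types e' i" "types e' j"]
    by blast+
  have "twisted c l (types (t # e) 0) (types (t # e') 0) \<and> twisted c l (types (t # e) 1) (types (t # e') 1)"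
    by (cases t) (simp_all only: lift assms 3 4 simp_thms)
  then show ?thesis using types_parity[of "t # e" i] types_parity[of "t # e'" i] by auto
qed

text \<open>The induction runs over the lifts applied after the inserted \<open>t\<close>; its base
  compares the initial words with those after the single lift \<open>t\<close>.\<close>

lemma twisted_types:
  "twisted (type_letter (flip_type t)) (type_long t) (types e i) (types (e @ [t]) i)"
proof (induction e arbitrary: i)
  case Nil
  show ?case
    by (cases t; cases "even i") (simp_all add: twisted_def subst_def letter_subst_def on_ends_def)
next
  case (Cons s e)
  then show ?case using twisted_types_lift[OF Cons Cons] by simp
qed

section \<open>The cyclic words of the two cycles\<close>

definition D_types :: "ltype list \<Rightarrow> bool list" where
  "D_types e = concat (map (types e) [0..<8])"

text \<open>The parity of the piece is the letter of the turn whatever the flag, once directions are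
  tripled; see \<open>turning_C\<close>.\<close>

definition C_types :: "ltype list \<Rightarrow> bool list" where
  "C_types e = map (\<lambda>x. even (hd (fst x))) (C_words e)"

lemma upto_8: "[0..<8] = [0, 1, 2, 3, 4, 5, 6, 7]"
  by code_simp

definition repeat4 :: "'a list \<Rightarrow> 'a list" where
  "repeat4 xs = xs @ xs @ xs @ xs"

lemma D_types_eq: "D_types e = repeat4 (types e 0 @ types e 1)"
  by (simp add: D_types_def repeat4_def upto_8 types_even_odd_numeral)

definition rotation :: "'a list \<Rightarrow> 'a list \<Rightarrow> bool" where
  "rotation xs ys \<longleftrightarrow> (\<exists>n. ys = rotate n xs)"

lemma rotation_append: "rotation (xs @ ys) (ys @ xs)"
  unfolding rotation_def by (metis rotate_append)

lemma rotation_trans: "rotation xs ys \<Longrightarrow> rotation ys zs \<Longrightarrow> rotation xs zs"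
  unfolding rotation_def by (metis rotate_rotate)

lemma rotation_iff: "rotation xs ys \<longleftrightarrow> (\<exists>us vs. xs = us @ vs \<and> ys = vs @ us)"
proof
  assume "rotation xs ys"
  then show "\<exists>us vs. xs = us @ vs \<and> ys = vs @ us"
    unfolding rotation_def by (metis append_take_drop_id rotate_drop_take)
qed (auto simp: rotation_append)

lemma rotation_concat_map: "rotation xs ys \<Longrightarrow> rotation (concat (map f xs)) (concat (map f ys))"
  unfolding rotation_iff by force

text \<open>The words of pieces 0 and 1 are twisted in opposite ways: the letters \<open>c\<close>
  that one of them loses at its ends are gained by the other. Around the cycle this only shifts
  where the word starts, by one letter.\<close>

lemma D_types_snoc: "rotation (subst (type_letter (flip_type t)) (type_long t) (D_types e)) (D_types (e @ [t]))"
proof -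
  define c l where "c = type_letter (flip_type t)" and "l = type_long t"
  let ?U = "types e 0" and ?V = "types e 1" and ?U' = "types (e @ [t]) 0" and ?V' = "types (e @ [t]) 1"
  have S: "subst c l (D_types e) = repeat4 (subst c l ?U @ subst c l ?V)"
    by (simp add: D_types_eq repeat4_def)
  note tw = twisted_types[of t e 0, folded c_def l_def, unfolded twisted_def]
    twisted_types[of t e 1, folded c_def l_def, unfolded twisted_def]
  have rot: "rotation (repeat4 (xs @ ys)) (repeat4 (ys @ xs))" for xs ys :: "bool list"
    using rotation_append[of xs "ys @ xs @ ys @ xs @ ys @ xs @ ys"] by (simp add: repeat4_def)
  show ?thesis
  proof (cases "(hd ?U = c) = l")
    case True
    then have "subst c l ?U = c # ?U' @ [c]" "?V' = c # subst c l ?V @ [c]" using tw hd_types[of e] by (cases c; cases l; cases "hd ?U"; auto)+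
    then show ?thesis unfolding c_def[symmetric] l_def[symmetric] S D_types_eq[of "e @ [t]"]
      using rot[of "[c]" "?U' @ [c] @ subst c l ?V"] by simp
  next
    case False
    then have "?U' = c # subst c l ?U @ [c]" "subst c l ?V = c # ?V' @ [c]" using tw hd_types[of e] by (cases c; cases l; cases "hd ?U"; auto)+
    then show ?thesis unfolding c_def[symmetric] l_def[symmetric] S D_types_eq[of "e @ [t]"]
      using rot[of "subst c l ?U @ [c] @ ?V'" "[c]"] by simp
  qed
qed

text \<open>Along a fibre the piece changes by 3 or -3, so parities alternate; as the blocks are
  palindromes, the orientation given by the flag does not show.\<close>

lemma C_types_Cons: "C_types (t # e) = subst (type_letter t) (type_long t) (C_types e)"
proof -
  have "map (\<lambda>y. even (hd (fst y))) (fibre t x) = letter_subst (type_letter t) (type_long t) (even (hd (fst x)))" for x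
  proof (cases x)
    case (Pair w up)
    have ev: "even (n mod 8) = even n" for n :: nat by (simp add: even_iff_mod_2_eq_zero mod_mod_cancel)
    show ?thesis by (cases t; cases up; cases "even (hd w)"; simp add: Pair fibre_def letter_subst_def ev)
  qed
  then show ?thesis by (simp add: C_types_def subst_def map_concat comp_def)
qed

lemma flip_type_flip_type [simp]: "flip_type (flip_type t) = t"
  by (cases t) auto

lemma flip_flip [simp]: "flip (flip e) = e"
  by (simp add: flip_def rev_map comp_def)

lemma flip_Cons: "flip (t # e) = flip e @ [flip_type t]"
  by (simp add: flip_def)

text \<open>A character prepended to \<open>e\<close> is appended, flipped, to
  \<open>flip e\<close>, and both words undergo the same substitution up to rotation.\<close>

lemma D_types_flip: "rotation (C_types e) (D_types (flip e))"
proof (induction e)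
  case Nil
  have "C_types [] = [True] @ [False, True, False, True, False, True, False]"
    "D_types (flip []) = [False, True, False, True, False, True, False] @ [True]"
    by (simp_all add: C_types_def D_types_def flip_def upto_8)
  then show ?case using rotation_append[of "[True]" "[False, True, False, True, False, True, False]"] by simp
next
  case (Cons t e)
  have "rotation (C_types (t # e)) (subst (type_letter t) (type_long t) (D_types (flip e)))"
    unfolding C_types_Cons subst_def using rotation_concat_map[OF Cons] .
  moreover have "type_long (flip_type t) = type_long t" by (cases t) auto
  ultimately show ?case using rotation_trans D_types_snoc[of "flip_type t" "flip e"] by (simp add: flip_Cons)
qed

section \<open>Labelled cycles\<close>

lemma Suc_mod_less: "i < n \<Longrightarrow> Suc i mod n < n"
  by (intro mod_less_divisor) auto

lemma cycle_graph_arcs: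
  assumes "distinct cs" "a < length cs" "b < length cs"
  shows "(cs ! a, cs ! b) \<in> parcs (cycle_graph cs) \<longleftrightarrow> b = Suc a mod length cs \<or> a = Suc b mod length cs"
proof -
  have eq: "cs ! i = cs ! j \<longleftrightarrow> i = j" if "i < length cs" "j < length cs" for i j
    using assms(1) that by (simp add: nth_eq_iff_index_eq)
  have "(cs ! a, cs ! b) \<in> parcs (cycle_graph cs) \<longleftrightarrow>
    (\<exists>i<length cs. cs ! a = cs ! i \<and> cs ! b = cs ! (Suc i mod length cs) \<or> cs ! a = cs ! (Suc i mod length cs) \<and> cs ! b = cs ! i)"
    by (auto simp: cycle_graph_def cyclic_next_def)
  also have "\<dots> \<longleftrightarrow> (\<exists>i<length cs. a = i \<and> b = Suc i mod length cs \<or> a = Suc i mod length cs \<and> b = i)"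
    using assms(2,3) by (intro ex_cong1 conj_cong refl) (simp add: eq Suc_mod_less)
  finally show ?thesis using assms(2,3) by auto
qed

lemma cycle_graph_arcE:
  assumes "(x, y) \<in> parcs (cycle_graph cs)"
  obtains a where "a < length cs" "x = cs ! a" "y = cyclic_next cs a"
    | a where "a < length cs" "y = cs ! a" "x = cyclic_next cs a"
  using assms by (auto simp: cycle_graph_def)

lemma cyclic_next_in: "a < length cs \<Longrightarrow> cyclic_next cs a \<in> set cs"
  unfolding cyclic_next_def using Suc_mod_less nth_mem by blast

lemma pair_sym_digraph_cycle_graph: "pair_sym_digraph (cycle_graph cs)"
proof
  fix e assume "e \<in> parcs (cycle_graph cs)"
  then show "fst e \<in> pverts (cycle_graph cs)" "snd e \<in> pverts (cycle_graph cs)"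
    using cyclic_next_in by (auto simp: cycle_graph_def)
next
  show "symmetric (with_proj (cycle_graph cs))"
    unfolding symmetric_def with_proj_simps by (rule symI) (auto simp: cycle_graph_def)
qed

lemma cycle_graph_reachable:
  assumes "x \<in> set cs" "y \<in> set cs"
  shows "x \<rightarrow>\<^sup>*\<^bsub>with_proj (cycle_graph cs)\<^esub> y"
proof -
  interpret pair_sym_digraph "cycle_graph cs" by (rule pair_sym_digraph_cycle_graph)
  have V: "pverts (cycle_graph cs) = set cs" by (simp add: cycle_graph_def)
  have up: "cs ! 0 \<rightarrow>\<^sup>*\<^bsub>with_proj (cycle_graph cs)\<^esub> cs ! i" if "i < length cs" for i
    using that
  proof (induction i)
    case 0
    then show ?case by (simp add: reachable_def V)
  next
    case (Suc i)
    then have "(cs ! i, cs ! Suc i) \<in> parcs (cycle_graph cs)"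
      by (auto simp: cycle_graph_def cyclic_next_def intro!: bexI[of _ i])
    with Suc show ?case unfolding reachable_def by (auto intro: rtrancl_on_into_rtrancl_on simp: V)
  qed
  have "u \<rightarrow>\<^sup>*\<^bsub>with_proj (cycle_graph cs)\<^esub> v \<Longrightarrow> v \<rightarrow>\<^sup>*\<^bsub>with_proj (cycle_graph cs)\<^esub> u" for u v
    using symmetric_reachable[OF pair_sym_arcs] by simp
  then show ?thesis using up assms reachable_trans unfolding in_set_conv_nth by metis
qed

lemma connected_cycle_graph: "cs \<noteq> [] \<Longrightarrow> Digraph_Component.connected (with_proj (cycle_graph cs))"
proof -
  assume "cs \<noteq> []"
  interpret pair_sym_digraph "cycle_graph cs" by (rule pair_sym_digraph_cycle_graph)
  have V: "pverts (cycle_graph cs) = set cs" by (simp add: cycle_graph_def)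
  show ?thesis unfolding Digraph_Component.connected_def
  proof (rule strongly_connectedI)
    show "verts (with_proj (mk_symmetric (with_proj (cycle_graph cs)))) \<noteq> {}" using \<open>cs \<noteq> []\<close> by (simp add: V)
    fix u v assume "u \<in> verts (with_proj (mk_symmetric (with_proj (cycle_graph cs))))"
      "v \<in> verts (with_proj (mk_symmetric (with_proj (cycle_graph cs))))"
    then have "u \<in> set cs" "v \<in> set cs" by (simp_all add: V)
    from reachable_mk_symmetricI[OF cycle_graph_reachable[OF this]]
    show "u \<rightarrow>\<^sup>*\<^bsub>with_proj (mk_symmetric (with_proj (cycle_graph cs)))\<^esub> v" by simp
  qed
qed

definition index :: "'a list \<Rightarrow> 'a \<Rightarrow> nat" where
  "index cs x = (SOME i. i < length cs \<and> cs ! i = x)"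

lemma index_nth: "distinct cs \<Longrightarrow> i < length cs \<Longrightarrow> index cs (cs ! i) = i"
  unfolding index_def by (rule some_equality) (auto simp: nth_eq_iff_index_eq)

lemma bij_betw_index:
  assumes "distinct cs" "distinct ds" "length cs = length ds"
  shows "bij_betw (\<lambda>x. ds ! index cs x) (set cs) (set ds)"
proof (rule bij_betw_imageI)
  show "inj_on (\<lambda>x. ds ! index cs x) (set cs)"
    using assms by (auto simp: inj_on_def in_set_conv_nth index_nth nth_eq_iff_index_eq)
  show "(\<lambda>x. ds ! index cs x) ` set cs = set ds"
    using assms by (force simp: image_def in_set_conv_nth index_nth)
qed

lemma cycle_graph_iso_arcs:
  assumes "distinct cs" "distinct ds" "length cs = length ds" "x \<in> set cs" "y \<in> set cs"
  shows "(ds ! index cs x, ds ! index cs y) \<in> parcs (cycle_graph ds) \<longleftrightarrow> (x, y) \<in> parcs (cycle_graph cs)"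
  using assms by (auto simp: in_set_conv_nth index_nth cycle_graph_arcs)

lemma digraph_iso_cycle_graph:
  assumes "distinct cs" "distinct ds" "length cs = length ds"
  shows "digraph_iso (with_proj (cycle_graph cs)) (with_proj (cycle_graph ds))"
proof -
  define f where "f x = ds ! index cs x" for x
  interpret pair_sym_digraph "cycle_graph cs" by (rule pair_sym_digraph_cycle_graph)
  interpret d: pair_sym_digraph "cycle_graph ds" by (rule pair_sym_digraph_cycle_graph)
  define h where "h = \<lparr> iso_verts = f, iso_arcs = map_prod f f, iso_head = snd, iso_tail = fst \<rparr>"
  have V: "pverts (cycle_graph cs) = set cs" "pverts (cycle_graph ds) = set ds" by (simp_all add: cycle_graph_def)
  have f: "bij_betw f (set cs) (set ds)" unfolding f_def using bij_betw_index[OF assms] .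
  have arcs: "(f x, f y) \<in> parcs (cycle_graph ds) \<longleftrightarrow> (x, y) \<in> parcs (cycle_graph cs)" if "x \<in> set cs" "y \<in> set cs" for x y
    unfolding f_def using cycle_graph_iso_arcs[OF assms that] .
  have sub: "parcs (cycle_graph cs) \<subseteq> set cs \<times> set cs" "parcs (cycle_graph ds) \<subseteq> set ds \<times> set ds"
    using arc_fst_in_verts arc_snd_in_verts d.arc_fst_in_verts d.arc_snd_in_verts by (auto simp: V) 
  have "map_prod f f ` parcs (cycle_graph cs) = parcs (cycle_graph ds)"
  proof (intro equalityI subsetI)
    fix a assume "a \<in> map_prod f f ` parcs (cycle_graph cs)"
    then show "a \<in> parcs (cycle_graph ds)" using sub(1) arcs by auto
  next
    fix a assume a: "a \<in> parcs (cycle_graph ds)"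
    then obtain u v where "a = (u, v)" "u \<in> set ds" "v \<in> set ds" using sub(2) by auto
    moreover from this have "u \<in> f ` set cs" "v \<in> f ` set cs" using f by (simp_all add: bij_betw_def)
    moreover from this obtain x y where "u = f x" "v = f y" "x \<in> set cs" "y \<in> set cs" by blast
    ultimately show "a \<in> map_prod f f ` parcs (cycle_graph cs)" using a arcs by force
  qed
  then have "with_proj (cycle_graph ds) = app_iso h (with_proj (cycle_graph cs))"
    using f by (simp add: app_iso_def h_def V with_proj_def bij_betw_def)
  moreover have "inj_on (map_prod f f) (parcs (cycle_graph cs))"
    by (rule inj_on_subset[OF map_prod_inj_on sub(1)]) (use f in \<open>auto simp: bij_betw_def\<close>)
  then have "pre_digraph.digraph_isomorphism (with_proj (cycle_graph cs)) h"
    using f wf_digraph by (auto simp: pre_digraph.digraph_isomorphism_def h_def V bij_betw_def)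
  ultimately show ?thesis unfolding digraph_iso_def by blast
qed

lemma shift_image:
  fixes k n :: nat
  assumes "0 < n"
  shows "(\<lambda>i. (k + i) mod n) ` {..<n} = {..<n}" "inj_on (\<lambda>i. (k + i) mod n) {..<n}"
proof -
  show *: "(\<lambda>i. (k + i) mod n) ` {..<n} = {..<n}"
  proof (intro equalityI subsetI)
    fix j assume j: "j \<in> {..<n}"
    have "k mod n < n" using assms by simp
    have "(k + (j + (n - k mod n)) mod n) mod n = (k mod n + (j + (n - k mod n))) mod n" by (simp add: mod_simps)
    also have "k mod n + (j + (n - k mod n)) = j + n" using \<open>k mod n < n\<close> by linarith
    finally show "j \<in> (\<lambda>i. (k + i) mod n) ` {..<n}"
      using j assms by (intro image_eqI[of _ _ "(j + (n - k mod n)) mod n"]) auto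
  qed (use assms in auto)
  show "inj_on (\<lambda>i. (k + i) mod n) {..<n}" by (rule eq_card_imp_inj_on) (simp_all add: *)
qed

lemma cycle_graph_rotate: "cycle_graph (rotate k cs) = cycle_graph cs"
proof (cases "cs = []")
  case False
  let ?n = "length cs"
  define g where "g i = {(cs ! i, cyclic_next cs i), (cyclic_next cs i, cs ! i)}" for i
  have nxt: "cyclic_next (rotate k cs) i = cyclic_next cs ((k + i) mod ?n)" if "i < ?n" for i
    using that Suc_mod_less[OF that] by (simp add: cyclic_next_def nth_rotate mod_simps)
  have "(\<lambda>i. (k + i) mod ?n) ` {..<?n} = {..<?n}" using shift_image(1)[of ?n k] False by simp
  moreover have "parcs (cycle_graph (rotate k cs)) = (\<Union>i<?n. g ((k + i) mod ?n))"
    by (auto simp: cycle_graph_def g_def nth_rotate nxt)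
  moreover have "parcs (cycle_graph cs) = (\<Union>i<?n. g i)" by (simp add: cycle_graph_def g_def)
  ultimately have "parcs (cycle_graph (rotate k cs)) = parcs (cycle_graph cs)" by (metis image_image)
  then show ?thesis by (simp add: cycle_graph_def)
qed simp

text \<open>Residues modulo 8 make opposites and turns additive; residue 0 stands for direction
  8.\<close>

definition label :: "nat \<Rightarrow> nat" where "label d = (if d = 0 then 8 else d)"

definition labelled_cycle :: "'v lab_digraph \<Rightarrow> 'v list \<Rightarrow> nat list \<Rightarrow> bool" where
  "labelled_cycle \<Phi> cs ls \<longleftrightarrow> base \<Phi> = cycle_graph cs \<and> distinct cs \<and> 3 \<le> length cs \<and> length ls = length cs \<and>
     (\<forall>i<length cs. ls ! i < 8 \<and> lab \<Phi> (cs ! i, cyclic_next cs i) = label (ls ! i) \<and>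
        lab \<Phi> (cyclic_next cs i, cs ! i) = label ((ls ! i + 4) mod 8))"

lemma labelled_cycle_rotate:
  assumes "labelled_cycle \<Phi> cs ls"
  shows "labelled_cycle \<Phi> (rotate k cs) (rotate k ls)"
proof -
  let ?n = "length cs"
  have l: "length ls = ?n" "0 < ?n" using assms by (auto simp: labelled_cycle_def)
  have "cyclic_next (rotate k cs) i = cyclic_next cs ((k + i) mod ?n) \<and> rotate k cs ! i = cs ! ((k + i) mod ?n) \<and>
      rotate k ls ! i = ls ! ((k + i) mod ?n) \<and> (k + i) mod ?n < ?n" if "i < ?n" for i
    using that Suc_mod_less[OF that] l by (simp add: cyclic_next_def nth_rotate mod_simps)
  with assms show ?thesis by (simp add: labelled_cycle_def cycle_graph_rotate)
qed

lemma same_dg_labelled_cycle: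
  assumes "labelled_cycle \<Phi> cs ls" "labelled_cycle \<Psi> ds ls"
  shows "same_dg \<Phi> \<Psi>"
  unfolding same_dg_def
proof (intro exI conjI ballI)
  have d: "distinct cs" "distinct ds" "length cs = length ds" and b: "base \<Phi> = cycle_graph cs" "base \<Psi> = cycle_graph ds"
    using assms by (auto simp: labelled_cycle_def)
  show "bij_betw (\<lambda>x. ds ! index cs x) (pverts (base \<Phi>)) (pverts (base \<Psi>))"
    using bij_betw_index[OF d] by (simp add: b cycle_graph_def)
  fix x y assume xy: "x \<in> pverts (base \<Phi>)" "y \<in> pverts (base \<Phi>)"
  then show "(x, y) \<in> parcs (base \<Phi>) \<longleftrightarrow> (ds ! index cs x, ds ! index cs y) \<in> parcs (base \<Psi>)"
    using cycle_graph_iso_arcs[OF d] by (simp add: b cycle_graph_def)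
  show "(x, y) \<in> parcs (base \<Phi>) \<longrightarrow> lab \<Psi> (ds ! index cs x, ds ! index cs y) = lab \<Phi> (x, y)"
  proof
    assume "(x, y) \<in> parcs (base \<Phi>)"
    moreover have nxt: "ds ! index cs (cyclic_next cs a) = cyclic_next ds a" if "a < length cs" for a
      using that d Suc_mod_less[OF that] by (simp add: cyclic_next_def index_nth)
    ultimately show "lab \<Psi> (ds ! index cs x, ds ! index cs y) = lab \<Phi> (x, y)"
      using assms d unfolding b
      by (elim cycle_graph_arcE) (simp_all add: labelled_cycle_def index_nth nxt)
  qed
qed

lemma relabel_labelled_cycle:
  assumes "labelled_cycle \<Phi> cs ls" "\<And>d. d < 8 \<Longrightarrow> \<sigma> d < 8 \<and> \<sigma> ((d + 4) mod 8) = (\<sigma> d + 4) mod 8 \<and> \<pi> (label d) = label (\<sigma> d)"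
  shows "labelled_cycle (relabel \<pi> \<Phi>) cs (map \<sigma> ls)"
  using assms by (auto simp: labelled_cycle_def relabel_def)

section \<open>Direction matrices, potentials and coherence\<close>

abbreviation dirm :: "nat \<Rightarrow> real^2^2" where "dirm d \<equiv> dir_mat (label d)"

text \<open>A potential makes sums along walks telescope: closed walks sum to zero, and distances
  are differences of values at the vertices.\<close>

definition potential :: "(nat \<Rightarrow> real^2^2) \<Rightarrow> nat list \<Rightarrow> bool" where
  "potential Y ls \<longleftrightarrow> (\<forall>i<length ls. Y (Suc i mod length ls) - Y i = dirm (ls ! i))"

lemma mat2_eq_iff: "mat2 a b c d = mat2 a' b' c' d' \<longleftrightarrow> a = a' \<and> b = b' \<and> c = c' \<and> d = d'"
  by (auto simp: mat2_def vec_eq_iff forall_2)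

lemma mat2_uminus: "- mat2 a b c d = (mat2 (- a) (- b) (- c) (- d) :: 'a::comm_ring_1^2^2)"
  by (simp add: mat2_def vec_eq_iff forall_2)

lemma mat2_mult: "mat2 a b c d ** mat2 a' b' c' d' =
    (mat2 (a * a' + b * c') (a * b' + b * d') (c * a' + d * c') (c * b' + d * d') :: 'a::comm_ring_1^2^2)"
  by (simp add: mat2_def vec_eq_iff forall_2 matrix_matrix_mult_def sum_2)

lemma mat2_mult_vec: "mat2 a b c d *v vector [x, y] = (vector [a * x + b * y, c * x + d * y] :: 'a::comm_ring_1^2)"
  by (simp add: mat2_def vec_eq_iff forall_2 matrix_vector_mult_def sum_2)

lemma dir_mat_label:
  "dir_mat (label 0) = (mat2 0 1 (- 1) 0 :: 'a::comm_ring_1^2^2)" "dir_mat (label 1) = (mat2 0 1 1 0 :: 'a^2^2)"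
  "dir_mat (label 2) = (mat2 1 0 0 1 :: 'a^2^2)" "dir_mat (label 3) = (mat2 (- 1) 0 0 1 :: 'a^2^2)"
  "dir_mat (label 4) = (mat2 0 (- 1) 1 0 :: 'a^2^2)" "dir_mat (label 5) = (mat2 0 (- 1) (- 1) 0 :: 'a^2^2)"
  "dir_mat (label 6) = (mat2 (- 1) 0 0 (- 1) :: 'a^2^2)" "dir_mat (label 7) = (mat2 1 0 0 (- 1) :: 'a^2^2)"
  by (simp_all add: dir_mat_def label_def mat2_uminus eval_nat_numeral One_nat_def)

lemma dir_mat_mult_vec: "d < 8 \<Longrightarrow> dir_mat (label d) *v vector [p, q] = step (p, q) d"
  unfolding less_8_cases by (elim disjE) (simp_all add: dir_mat_label mat2_mult_vec step_simps)

lemma dirm_inj: "c < 8 \<Longrightarrow> d < 8 \<Longrightarrow> dirm c = dirm d \<longleftrightarrow> c = d"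
  unfolding less_8_cases by (elim disjE; simp add: dir_mat_label mat2_eq_iff)

lemma dirm_opposite: "d < 8 \<Longrightarrow> dirm ((d + 4) mod 8) = - dirm d"
  unfolding less_8_cases by (elim disjE) (simp_all add: dir_mat_label mat2_uminus)

lemma label_range: "label ` {..<8} = {1..8}"
proof -
  have "label ` {..<8} = label ` {0, 1, 2, 3, 4, 5, 6, 7}" by (rule arg_cong[where f = "(`) label"]) (auto simp: less_8_cases)
  also have "\<dots> = {1..8}" by (auto simp: label_def)
  finally show ?thesis .
qed

lemma dir_mat_image: "dir_mat ` {1..8} = dirm ` {..<8}"
  by (simp add: label_range[symmetric] image_image)

text \<open>Coherence as a property of the label sequence alone, so that it can be carried along
  rotations and equivalences. The converse implications come from the potential itself.\<close>

definition coherent_labels :: "nat list \<Rightarrow> bool" where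
  "coherent_labels ls \<longleftrightarrow> (\<exists>Y. potential Y ls \<and> (\<forall>a<length ls. \<forall>b<length ls.
     (Y a = Y b \<longrightarrow> a = b) \<and> (Y b - Y a \<in> dirm ` {..<8} \<longrightarrow> b = Suc a mod length ls \<or> a = Suc b mod length ls)))"

context
  fixes \<Phi> :: "'v lab_digraph" and cs ls Y
  assumes lc: "labelled_cycle \<Phi> cs ls" and pot: "potential Y ls"
begin

lemma base_eq: "base \<Phi> = cycle_graph cs" and distinct_cs: "distinct cs" and len: "3 \<le> length cs" "length ls = length cs"
  using lc by (auto simp: labelled_cycle_def)

lemma arc_potential:
  assumes "(x, y) \<in> parcs (base \<Phi>)"
  shows "dir_mat (lab \<Phi> (x, y)) = Y (index cs y) - Y (index cs x) \<and> lab \<Phi> (x, y) \<in> {1..8}"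
  using assms unfolding base_eq
proof (cases rule: cycle_graph_arcE)
  case (1 a)
  then have "index cs x = a" "index cs y = Suc a mod length ls"
    using distinct_cs Suc_mod_less[OF 1(1)] by (simp_all add: index_nth cyclic_next_def len)
  moreover have "lab \<Phi> (x, y) = label (ls ! a)" "ls ! a < 8" using lc 1 by (auto simp: labelled_cycle_def)
  ultimately show ?thesis using pot 1(1) label_range by (auto simp: potential_def len)
next
  case (2 a)
  then have "index cs y = a" "index cs x = Suc a mod length ls"
    using distinct_cs Suc_mod_less[OF 2(1)] by (simp_all add: index_nth cyclic_next_def len)
  moreover have "lab \<Phi> (x, y) = label ((ls ! a + 4) mod 8)" "ls ! a < 8" using lc 2 by (auto simp: labelled_cycle_def)
  moreover have "label ((ls ! a + 4) mod 8) \<in> {1..8}" unfolding label_range[symmetric] by simp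
  moreover have "Y (Suc a mod length ls) - Y a = dirm (ls ! a)" using pot 2(1) by (simp add: potential_def len)
  ultimately show ?thesis using dirm_opposite by (metis minus_diff_eq)
qed

lemma walk_potential:
  "pcas u w v \<Longrightarrow> set w \<subseteq> parcs (base \<Phi>) \<Longrightarrow> direction_sum \<Phi> w = Y (index cs v) - Y (index cs u)"
proof (induction w arbitrary: u)
  case (Cons a w)
  have "direction_sum \<Phi> (a # w) = dir_mat (lab \<Phi> a) + direction_sum \<Phi> w" by (simp add: direction_sum_def)
  also have "\<dots> = (Y (index cs (snd a)) - Y (index cs u)) + (Y (index cs v) - Y (index cs (snd a)))"
    using Cons arc_potential[of "fst a" "snd a"] by (cases a) simp
  finally show ?case by simp
qed (simp add: direction_sum_def)

lemma direction_graph_labelled_cycle: "direction_graph \<Phi>"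
proof -
  interpret pair_sym_digraph "base \<Phi>" unfolding base_eq by (rule pair_sym_digraph_cycle_graph)
  have "direction_sum \<Phi> w = 0" if "pre_digraph.cycle (ugr \<Phi>) w" for w
    using that walk_potential by (auto simp: cycle_def awalk_def)
  then show ?thesis unfolding direction_graph_def using arc_potential pair_sym_digraph_axioms by auto
qed

lemma dg_distance_labelled_cycle:
  assumes "x \<in> set cs" "y \<in> set cs"
  shows "dg_distance \<Phi> x y = Y (index cs y) - Y (index cs x)"
proof -
  interpret pair_sym_digraph "base \<Phi>" unfolding base_eq by (rule pair_sym_digraph_cycle_graph)
  have "x \<rightarrow>\<^sup>*\<^bsub>ugr \<Phi>\<^esub> y" using cycle_graph_reachable[OF assms] by (simp only: base_eq)
  then obtain w where w: "apath x w y" unfolding reachable_apath by (elim exE)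
  have "direction_sum \<Phi> w = Y (index cs y) - Y (index cs x)" if "apath x w y" for w
    using that walk_potential by (auto simp: apath_def awalk_def)
  with w show ?thesis unfolding dg_distance_def by (intro the_equality) auto
qed

lemma connected_labelled_cycle: "Digraph_Component.connected (ugr \<Phi>)"
  unfolding base_eq by (rule connected_cycle_graph) (use len in auto)

end

lemma coherent_labelled_cycle:
  assumes lc: "labelled_cycle \<Phi> cs ls" and "coherent_labels ls"
  shows "coherent \<Phi>"
proof -
  obtain Y where Y: "potential Y ls" "\<And>a b. a < length ls \<Longrightarrow> b < length ls \<Longrightarrow> Y a = Y b \<Longrightarrow> a = b"
    "\<And>a b. a < length ls \<Longrightarrow> b < length ls \<Longrightarrow> Y b - Y a \<in> dirm ` {..<8} \<Longrightarrow> b = Suc a mod length ls \<or> a = Suc b mod length ls"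
    using assms(2) unfolding coherent_labels_def by blast
  have b: "base \<Phi> = cycle_graph cs" "distinct cs" "length ls = length cs" using lc by (auto simp: labelled_cycle_def)
  have "(dg_distance \<Phi> x y = 0 \<longleftrightarrow> x = y) \<and> (dg_distance \<Phi> x y \<in> dir_mat ` {1..8} \<longleftrightarrow> (x, y) \<in> parcs (base \<Phi>))"
    if xy: "x \<in> set cs" "y \<in> set cs" for x y
  proof -
    obtain i j where ij: "x = cs ! i" "y = cs ! j" "i < length cs" "j < length cs" using xy by (auto simp: in_set_conv_nth)
    have d: "dg_distance \<Phi> x y = Y j - Y i"
      using dg_distance_labelled_cycle[OF lc Y(1) xy] b ij by (simp add: index_nth)
    have "Y j - Y i = 0 \<longleftrightarrow> x = y" using Y(2)[of i j] ij b by (auto simp: nth_eq_iff_index_eq)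
    moreover have "(x, y) \<in> parcs (base \<Phi>)" if "Y j - Y i \<in> dirm ` {..<8}"
      using Y(3)[OF _ _ that] ij b by (simp add: cycle_graph_arcs)
    moreover have "Y j - Y i \<in> dir_mat ` {1..8}" if "(x, y) \<in> parcs (base \<Phi>)"
    proof -
      have "dir_mat (lab \<Phi> (x, y)) = Y j - Y i" "lab \<Phi> (x, y) \<in> {1..8}"
        using arc_potential[OF lc Y(1) that] ij b by (simp_all add: index_nth)
      then show ?thesis by (metis image_eqI)
    qed
    ultimately show ?thesis unfolding d dir_mat_image by blast
  qed
  then show ?thesis unfolding coherent_def b by (simp add: cycle_graph_def)
qed

section \<open>Equivalence of labels\<close>

text \<open>An involution for either letter. On matrices it multiplies \<open>dirm d\<close> from
  the right by the swap of coordinates for \<open>True\<close> and by the sign change of the first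
  coordinate for \<open>False\<close>.\<close>

definition turn :: "bool \<Rightarrow> nat \<Rightarrow> nat" where
  "turn \<tau> d = (if odd d = \<tau> then (d + 1) mod 8 else (d + 7) mod 8)"

text \<open>Invertibility of \<open>P\<close> and \<open>Q\<close> is part of the notion so that
  equivalences can be inverted and coherence transported.\<close>

definition label_equiv :: "(nat \<Rightarrow> nat) \<Rightarrow> bool" where
  "label_equiv \<sigma> \<longleftrightarrow> (\<forall>d<8. \<sigma> d < 8) \<and>
     (\<exists>P Q. invertible P \<and> invertible Q \<and> (\<forall>d<8. dirm (\<sigma> d) = P ** dirm d ** Q))"

lemma invertible_mat2: "a * d - b * c \<noteq> 0 \<Longrightarrow> invertible (mat2 a b c d :: real^2^2)"
  by (simp add: invertible_det_nz det_2 mat2_def)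

lemma label_equiv_matI:
  assumes "invertible P" "invertible Q" "\<And>d. d < 8 \<Longrightarrow> \<sigma> d < 8" "\<And>d. d < 8 \<Longrightarrow> dirm (\<sigma> d) = P ** dirm d ** Q"
  shows "label_equiv \<sigma>"
  unfolding label_equiv_def using assms by (intro conjI exI[of _ P] exI[of _ Q]) simp_all

lemma label_equivI:
  assumes "\<And>d. d < 8 \<Longrightarrow> \<sigma> d < 8 \<and> dirm (\<sigma> d) = mat2 a b c e ** dirm d ** mat2 a' b' c' e'"
    "a * e - b * c \<noteq> 0" "a' * e' - b' * c' \<noteq> 0"
  shows "label_equiv \<sigma>"
  by (rule label_equiv_matI[OF invertible_mat2[OF assms(2)] invertible_mat2[OF assms(3)]]) (use assms(1) in auto)

lemma label_equiv_id: "label_equiv id"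
  by (rule label_equivI[where a = 1 and b = 0 and c = 0 and e = 1 and a' = 1 and b' = 0 and c' = 0 and e' = 1])
    (auto simp: less_8_cases dir_mat_label mat2_mult)

text \<open>The matrix \<open>P\<close> with rows (1, 1) and (1, -1) is twice its own inverse, and
  \<open>Q\<close> is minus that inverse. Up to sign, conjugation by \<open>P\<close> exchanges the
  reflections in the axes with those in the diagonals.\<close>

lemma label_equiv_triple: "label_equiv (\<lambda>d. 3 * d mod 8)"
  by (rule label_equivI[where a = 1 and b = 1 and c = 1 and e = "- 1" and a' = "- 1 / 2" and b' = "- 1 / 2" and c' = "- 1 / 2" and e' = "1 / 2"])
    (auto simp: less_8_cases dir_mat_label mat2_mult mat2_eq_iff)

lemma label_equiv_turn: "label_equiv (turn True)" "label_equiv (turn False)"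
  by (rule label_equivI[where a = 1 and b = 0 and c = 0 and e = 1 and a' = 0 and b' = 1 and c' = 1 and e' = 0];
      auto simp: turn_def less_8_cases dir_mat_label mat2_mult mat2_eq_iff)
    (rule label_equivI[where a = 1 and b = 0 and c = 0 and e = 1 and a' = "- 1" and b' = 0 and c' = 0 and e' = 1];
      auto simp: turn_def less_8_cases dir_mat_label mat2_mult mat2_eq_iff)

lemma label_equiv_rot: "label_equiv (\<lambda>d. (d + 2) mod 8)"
  by (rule label_equivI[where a = 0 and b = "- 1" and c = 1 and e = 0 and a' = 1 and b' = 0 and c' = 0 and e' = 1])
    (auto simp: less_8_cases dir_mat_label mat2_mult mat2_eq_iff)

lemma label_equiv_refl: "label_equiv (\<lambda>d. (9 - d) mod 8)"
  by (rule label_equivI[where a = 1 and b = 0 and c = 0 and e = "- 1" and a' = 1 and b' = 0 and c' = 0 and e' = 1])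
    (auto simp: less_8_cases dir_mat_label mat2_mult mat2_eq_iff)

lemma label_equiv_comp:
  assumes "label_equiv \<sigma>" "label_equiv \<tau>"
  shows "label_equiv (\<sigma> \<circ> \<tau>)"
proof -
  obtain P Q where s: "invertible P" "invertible Q" "\<And>d. d < 8 \<Longrightarrow> dirm (\<sigma> d) = P ** dirm d ** Q"
    using assms(1) unfolding label_equiv_def by blast
  obtain P' Q' where t: "invertible P'" "invertible Q'" "\<And>d. d < 8 \<Longrightarrow> dirm (\<tau> d) = P' ** dirm d ** Q'"
    using assms(2) unfolding label_equiv_def by blast
  show ?thesis
  proof (rule label_equiv_matI[OF invertible_mult[OF s(1) t(1)] invertible_mult[OF t(2) s(2)]])
    fix d :: nat assume that: "d < 8"
    show "(\<sigma> \<circ> \<tau>) d < 8" using assms that unfolding label_equiv_def by auto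
    show "dirm ((\<sigma> \<circ> \<tau>) d) = (P ** P') ** dirm d ** (Q' ** Q)"
      using s(3)[of "\<tau> d"] t(3)[OF that] assms(2) that unfolding label_equiv_def by (simp add: matrix_mul_assoc)
  qed
qed

lemma label_equiv_less: "label_equiv \<sigma> \<Longrightarrow> d < 8 \<Longrightarrow> \<sigma> d < 8"
  by (simp add: label_equiv_def)

lemma invertible_cancel:
  fixes P Q :: "real^2^2"
  assumes "invertible P" "invertible Q" "P ** X ** Q = P ** Z ** Q"
  shows "X = Z"
proof -
  obtain P' Q' where "P' ** P = mat 1" "Q ** Q' = mat 1" using assms unfolding invertible_def by blast
  then have "P' ** (P ** W ** Q) ** Q' = W" for W
    by (metis matrix_mul_assoc matrix_mul_lid matrix_mul_rid)
  then show ?thesis using assms(3) by metis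
qed

lemma label_equiv_inj: "label_equiv \<sigma> \<Longrightarrow> inj_on \<sigma> {..<8}"
  unfolding label_equiv_def inj_on_def using invertible_cancel dirm_inj by (metis lessThan_iff)

lemma label_equiv_bij: "label_equiv \<sigma> \<Longrightarrow> bij_betw \<sigma> {..<8} {..<8}"
  using label_equiv_inj label_equiv_less by (metis bij_betw_def endo_inj_surj finite_lessThan image_subsetI lessThan_iff)

lemma matrix_conj_diff: "P ** X ** Q - P ** Z ** Q = P ** (X - Z) ** (Q :: real^2^2)"
  by (simp add: vec_eq_iff matrix_matrix_mult_def forall_2 sum_2 sum_subtractf sum_negf algebra_simps)

lemma matrix_conj_uminus: "P ** (- X) ** Q = - (P ** X ** (Q :: real^2^2))"
  by (simp add: vec_eq_iff matrix_matrix_mult_def forall_2 sum_2 sum_subtractf sum_negf algebra_simps)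

lemma label_equiv_opposite:
  assumes "label_equiv \<sigma>" "d < 8"
  shows "\<sigma> ((d + 4) mod 8) = (\<sigma> d + 4) mod 8"
proof -
  obtain P Q where s: "\<And>d. d < 8 \<Longrightarrow> dirm (\<sigma> d) = P ** dirm d ** Q"
    using assms(1) unfolding label_equiv_def by blast
  have "dirm (\<sigma> ((d + 4) mod 8)) = - dirm (\<sigma> d)"
    using s[of "(d + 4) mod 8"] s[OF assms(2)] dirm_opposite[OF assms(2)] by (simp add: matrix_conj_uminus)
  also have "\<dots> = dirm ((\<sigma> d + 4) mod 8)" using dirm_opposite label_equiv_less[OF assms] by simp
  finally show ?thesis using dirm_inj label_equiv_less[OF assms(1)] by simp
qed

lemma label_equiv_inverse:
  assumes "label_equiv \<sigma>"
  obtains \<tau> where "label_equiv \<tau>" "\<And>d. d < 8 \<Longrightarrow> \<tau> (\<sigma> d) = d"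
proof -
  define \<tau> where "\<tau> = inv_into {..<8} \<sigma>"
  have bij: "bij_betw \<sigma> {..<8} {..<8}" using label_equiv_bij[OF assms] .
  have inv: "\<tau> (\<sigma> d) = d" if "d < 8" for d
    unfolding \<tau>_def using that label_equiv_inj[OF assms] by (simp add: inv_into_f_f)
  have less: "\<tau> d < 8" if "d < 8" for d
    using bij_betw_inv_into[OF bij] that unfolding \<tau>_def by (auto simp: bij_betw_def)
  have inv': "\<sigma> (\<tau> d) = d" if "d < 8" for d
    unfolding \<tau>_def using that bij by (simp add: bij_betw_inv_into_right)
  obtain P Q where s: "invertible P" "invertible Q" "\<And>d. d < 8 \<Longrightarrow> dirm (\<sigma> d) = P ** dirm d ** Q"
    using assms unfolding label_equiv_def by blast
  obtain P' Q' where P': "P ** P' = mat 1" "P' ** P = mat 1" and Q': "Q ** Q' = mat 1" "Q' ** Q = mat 1"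
    using s(1,2) unfolding invertible_def by blast
  have "dirm (\<tau> d) = P' ** dirm d ** Q'" if "d < 8" for d
  proof -
    have "dirm d = P ** dirm (\<tau> d) ** Q" using s(3)[OF less[OF that]] inv'[OF that] by simp
    then have "P' ** dirm d ** Q' = (P' ** P) ** dirm (\<tau> d) ** (Q ** Q')" by (simp add: matrix_mul_assoc)
    then show ?thesis by (simp add: P' Q')
  qed
  moreover have "invertible P'" "invertible Q'" using P' Q' unfolding invertible_def by blast+
  ultimately have "label_equiv \<tau>" using less by (intro label_equiv_matI)
  then show ?thesis using that[OF _ inv] by simp
qed

lemma label_mod: "d < 8 \<Longrightarrow> label d mod 8 = d"
  by (auto simp: label_def)

lemma label_equiv_permutation:
  assumes "label_equiv \<sigma>"
  obtains \<pi> where "equivalence_permutation \<pi>" "\<And>d. d < 8 \<Longrightarrow> \<pi> (label d) = label (\<sigma> d)"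
proof -
  \<comment> \<open>Reduction modulo 8 undoes \<open>label\<close>; outside the labels
    \<open>\<pi>\<close> is the identity, as \<open>permutes\<close> demands.\<close>
  define \<pi> where "\<pi> n = (if n \<in> {1..8} then label (\<sigma> (n mod 8)) else n)" for n
  have \<pi>: "\<pi> (label d) = label (\<sigma> d)" if "d < 8" for d
  proof -
    have "label d \<in> {1..8}" using that label_range by blast
    then show ?thesis using that by (simp add: \<pi>_def label_mod)
  qed
  have "inj_on \<pi> {1..8}"
  proof (rule inj_onI)
    fix x y assume "x \<in> {1..8}" "y \<in> {1..8}" and eq: "\<pi> x = \<pi> y"
    then obtain c d where cd: "x = label c" "y = label d" "c < 8" "d < 8" unfolding label_range[symmetric] by auto
    then have "label (\<sigma> c) mod 8 = label (\<sigma> d) mod 8" using eq \<pi> by simp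
    then have "\<sigma> c = \<sigma> d" using cd label_equiv_less[OF assms] by (simp add: label_mod)
    then show "x = y" using cd label_equiv_inj[OF assms] by (auto simp: inj_on_def)
  qed
  moreover have "\<pi> ` {1..8} \<subseteq> {1..8}"
    unfolding label_range[symmetric] using \<pi> label_equiv_less[OF assms] by auto
  ultimately have "bij_betw \<pi> {1..8} {1..8}" by (simp add: bij_betw_def endo_inj_surj)
  then have "\<pi> permutes {1..8}" by (rule bij_imp_permutes) (simp only: \<pi>_def if_False)
  moreover obtain P Q where s: "\<And>d. d < 8 \<Longrightarrow> dirm (\<sigma> d) = P ** dirm d ** Q"
    using assms unfolding label_equiv_def by blast
  have "\<forall>i\<in>{1..8}. dir_mat (\<pi> i) = P ** dir_mat i ** Q"
    unfolding label_range[symmetric] using \<pi> s by simp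
  ultimately show ?thesis using that \<pi> unfolding equivalence_permutation_def by blast
qed

lemma equivalent_dg_labelled_cycle:
  assumes "labelled_cycle \<Phi> cs (map \<alpha> ls)" "labelled_cycle \<Psi> ds (map \<beta> ls)"
    "label_equiv \<alpha>" "label_equiv \<beta>" "\<And>l. l \<in> set ls \<Longrightarrow> l < 8"
  shows "equivalent_dg \<Phi> \<Psi>"
proof -
  obtain \<alpha>' where \<alpha>': "label_equiv \<alpha>'" "\<And>d. d < 8 \<Longrightarrow> \<alpha>' (\<alpha> d) = d"
    using label_equiv_inverse[OF assms(3)] by blast
  define \<sigma> where "\<sigma> = \<beta> \<circ> \<alpha>'"
  have \<sigma>: "label_equiv \<sigma>" unfolding \<sigma>_def by (rule label_equiv_comp[OF assms(4) \<alpha>'(1)])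
  obtain \<pi> where \<pi>: "equivalence_permutation \<pi>" "\<And>d. d < 8 \<Longrightarrow> \<pi> (label d) = label (\<sigma> d)"
    using label_equiv_permutation[OF \<sigma>] by blast
  have "labelled_cycle (relabel \<pi> \<Phi>) cs (map \<sigma> (map \<alpha> ls))"
    by (rule relabel_labelled_cycle[OF assms(1)]) (use \<pi> \<sigma> label_equiv_opposite label_equiv_less in auto)
  moreover have "map \<sigma> (map \<alpha> ls) = map \<beta> ls" using assms(5) \<alpha>'(2) by (auto simp: \<sigma>_def)
  ultimately have "same_dg (relabel \<pi> \<Phi>) \<Psi>" using same_dg_labelled_cycle assms(2) by metis
  then show ?thesis using \<pi>(1) unfolding equivalent_dg_def by blast
qed

lemma coherent_labels_map:
  assumes "coherent_labels ls" "label_equiv \<sigma>" "\<And>l. l \<in> set ls \<Longrightarrow> l < 8"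
  shows "coherent_labels (map \<sigma> ls)"
proof -
  obtain Y where Y: "potential Y ls" "\<And>a b. a < length ls \<Longrightarrow> b < length ls \<Longrightarrow> Y a = Y b \<Longrightarrow> a = b"
    "\<And>a b. a < length ls \<Longrightarrow> b < length ls \<Longrightarrow> Y b - Y a \<in> dirm ` {..<8} \<Longrightarrow> b = Suc a mod length ls \<or> a = Suc b mod length ls"
    using assms(1) unfolding coherent_labels_def by blast
  obtain P Q where s: "invertible P" "invertible Q" "\<And>d. d < 8 \<Longrightarrow> dirm (\<sigma> d) = P ** dirm d ** Q"
    using assms(2) unfolding label_equiv_def by blast
  \<comment> \<open>The same pair \<open>P\<close>, \<open>Q\<close> that maps the labels also maps
    the potential.\<close>
  define Z where "Z a = P ** Y a ** Q" for a
  have "potential Z (map \<sigma> ls)"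
    using Y(1) s(3) assms(3) by (simp add: potential_def Z_def matrix_conj_diff)
  moreover have "Z a = Z b \<Longrightarrow> a = b" if "a < length ls" "b < length ls" for a b
    using Y(2)[OF that] invertible_cancel[OF s(1,2)] unfolding Z_def by blast
  moreover have "Y b - Y a \<in> dirm ` {..<8}" if "Z b - Z a \<in> dirm ` {..<8}" for a b
  proof -
    from that obtain d where d: "d < 8" "Z b - Z a = dirm d" by auto
    obtain c where "c < 8" "d = \<sigma> c" using label_equiv_bij[OF assms(2)] d(1) by (auto simp: bij_betw_def image_iff set_eq_iff)
    with d s(3) have "P ** (Y b - Y a) ** Q = P ** dirm c ** Q" by (simp add: Z_def matrix_conj_diff)
    then show ?thesis using invertible_cancel[OF s(1,2)] \<open>c < 8\<close> by blast
  qed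
  ultimately show ?thesis using Y(3) unfolding coherent_labels_def length_map by (intro exI[of _ Z] conjI allI impI) simp_all
qed

lemma coherent_labels_rotate:
  assumes "coherent_labels ls"
  shows "coherent_labels (rotate k ls)"
proof (cases "ls = []")
  case False
  let ?n = "length ls"
  obtain Y where Y: "potential Y ls" "\<And>a b. a < ?n \<Longrightarrow> b < ?n \<Longrightarrow> Y a = Y b \<Longrightarrow> a = b"
    "\<And>a b. a < ?n \<Longrightarrow> b < ?n \<Longrightarrow> Y b - Y a \<in> dirm ` {..<8} \<Longrightarrow> b = Suc a mod ?n \<or> a = Suc b mod ?n"
    using assms unfolding coherent_labels_def by blast
  define f where "f i = (k + i) mod ?n" for i
  have n: "0 < ?n" using False by simp
  have f: "f i < ?n" for i using n by (simp add: f_def)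
  have S: "Suc (f i) mod ?n = f (Suc i mod ?n)" for i by (simp add: f_def mod_simps)
  have inj: "f a = f b \<Longrightarrow> a = b" if "a < ?n" "b < ?n" for a b
    using shift_image(2)[OF n, of k] that by (auto simp: f_def inj_on_def)
  have "potential (Y \<circ> f) (rotate k ls)"
    using Y(1) f n by (simp add: potential_def nth_rotate f_def[symmetric] S[symmetric])
  moreover have "b = Suc a mod ?n \<or> a = Suc b mod ?n"
    if "a < ?n" "b < ?n" "(Y \<circ> f) b - (Y \<circ> f) a \<in> dirm ` {..<8}" for a b
    using Y(3)[OF f f, of b a] that inj[OF that(2), of "Suc a mod ?n"] inj[OF that(1), of "Suc b mod ?n"] n
    by (auto simp: S)
  moreover have "a = b" if "a < ?n" "b < ?n" "(Y \<circ> f) a = (Y \<circ> f) b" for a b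
    using Y(2)[OF f f] inj that by auto
  ultimately show ?thesis unfolding coherent_labels_def length_rotate by (intro exI[of _ "Y \<circ> f"] conjI allI impI) simp_all
qed (use assms in simp)

section \<open>A word of turns determines the labels up to equivalence\<close>

definition turning :: "bool list \<Rightarrow> nat list \<Rightarrow> bool" where
  "turning \<tau>s ls \<longleftrightarrow> length \<tau>s = length ls \<and> (\<forall>l\<in>set ls. l < 8) \<and>
     (\<forall>i<length ls. ls ! (Suc i mod length ls) = turn (\<tau>s ! (Suc i mod length ls)) (ls ! i))"

lemma turning_rotate:
  assumes "turning \<tau>s ls"
  shows "turning (rotate k \<tau>s) (rotate k ls)"
proof (cases "ls = []")
  case False
  then have n: "0 < length ls" by simp
  have S: "(k + Suc i mod length ls) mod length ls = Suc ((k + i) mod length ls) mod length ls" for i by (simp add: mod_simps)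
  show ?thesis using assms n by (simp add: turning_def nth_rotate S)
qed (use assms in \<open>simp add: turning_def\<close>)

text \<open>Turns are right multiplications and so commute with left multiplication by a quarter
  turn (\<open>R\<close>) and by a reflection (\<open>F\<close>). \<open>R\<close> reaches all
  labels of one parity and \<open>F\<close> changes the parity.\<close>

lemma label_equiv_transitive:
  assumes "c < 8" "d < 8"
  obtains g where "label_equiv g" "g c = d" "\<And>\<tau> x. x < 8 \<Longrightarrow> g (turn \<tau> x) = turn \<tau> (g x)"
proof -
  define R where "R k = (\<lambda>d :: nat. (d + 2) mod 8) ^^ k" for k
  define F where "F = (\<lambda>d :: nat. (9 - d) mod 8)"
  have R: "label_equiv (R k) \<and> (\<forall>\<tau>. \<forall>x<8. R k (turn \<tau> x) = turn \<tau> (R k x))" for k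
  proof (induction k)
    case 0
    then show ?case using label_equiv_id by (simp add: R_def id_def)
  next
    case (Suc k)
    have "(turn \<tau> x + 2) mod 8 = turn \<tau> ((x + 2) mod 8)" if "x < 8" for \<tau> x
      using that unfolding less_8_cases by (elim disjE; cases \<tau>; simp add: turn_def)
    with Suc label_equiv_comp[OF label_equiv_rot] label_equiv_less show ?case by (auto simp: R_def comp_def)
  qed
  have F: "label_equiv F" "\<And>\<tau> x. x < 8 \<Longrightarrow> F (turn \<tau> x) = turn \<tau> (F x)" "\<And>x. x < 8 \<Longrightarrow> F x < 8"
  proof -
    show "F (turn \<tau> x) = turn \<tau> (F x)" if "x < 8" for \<tau> x
      using that unfolding less_8_cases by (elim disjE; cases \<tau>; simp add: turn_def F_def)
  qed (simp_all add: F_def label_equiv_refl)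
  have RF: "label_equiv (R k \<circ> F) \<and> (\<forall>\<tau>. \<forall>x<8. (R k \<circ> F) (turn \<tau> x) = turn \<tau> ((R k \<circ> F) x))" for k
    using R[of k] F label_equiv_comp[of "R k" F] by simp
  have Rk: "R k x = (x + 2 * k) mod 8" if "x < 8" for k x
    using that by (induction k) (simp_all add: R_def mod_simps algebra_simps)
  have hit: "\<exists>k. R k x = d" if "x < 8" "even x = even d" for x
  proof -
    have "even (d + 8 - x)" using that assms(2) by simp
    then obtain k where "d + 8 - x = 2 * k" by blast
    then have "x + 2 * k = d + 8" using that by linarith
    then show ?thesis using Rk[OF that(1), of k] assms(2) by (intro exI[of _ k]) simp
  qed
  show ?thesis
  proof (cases "even c = even d")
    case True
    from hit[OF assms(1) True] R that show ?thesis by blast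
  next
    case False
    have "even (F c) = odd c" using assms(1) unfolding less_8_cases by (elim disjE) (simp_all add: F_def)
    with False have "even (F c) = even d" by simp
    from hit[OF F(3)[OF assms(1)] this] obtain k where "(R k \<circ> F) c = d" by auto
    then show ?thesis using RF[of k] that by blast
  qed
qed

text \<open>Choose \<open>g\<close> to match the first labels; since \<open>g\<close> commutes with
  turns, it then matches all labels.\<close>

lemma turning_unique:
  assumes "turning \<tau>s ls" "turning \<tau>s ls'" "ls \<noteq> []"
  obtains g where "label_equiv g" "ls' = map g ls"
proof -
  have len: "length \<tau>s = length ls" "length ls' = length ls" "0 < length ls" using assms by (auto simp: turning_def)
  have less: "ls ! i < 8" "ls' ! i < 8" if "i < length ls" for i using assms that len by (auto simp: turning_def)
  obtain g where g: "label_equiv g" "g (ls ! 0) = ls' ! 0" "\<And>\<tau> x. x < 8 \<Longrightarrow> g (turn \<tau> x) = turn \<tau> (g x)"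
    using label_equiv_transitive[OF less[OF len(3)]] by blast
  have "ls' ! i = g (ls ! i)" if "i < length ls" for i
    using that
  proof (induction i)
    case (Suc i)
    then have "Suc i mod length ls = Suc i" "i < length ls" by simp_all
    then have "ls ! Suc i = turn (\<tau>s ! Suc i) (ls ! i)" "ls' ! Suc i = turn (\<tau>s ! Suc i) (ls' ! i)"
      using assms(1,2) len unfolding turning_def by metis+
    then show ?case using Suc g(3) less by simp
  qed (simp add: g)
  then have "ls' = map g ls" using len by (intro nth_equalityI) auto
  then show ?thesis using that g(1) by blast
qed

section \<open>The extracted direction graphs\<close>

lemma lift_params_matrix:
  "type_mat t *v vector [of_int p, of_int q] =
    (vector [of_int (fst (lift_params t (p, q))), of_int (snd (lift_params t (p, q)))] :: 'a::comm_ring_1^2)"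
  by (cases t) (simp_all add: mat2_mult_vec)

lemma level_matrix:
  "string_mat e *v vector [of_int (fst b), of_int (snd b)] =
    (vector [of_int (fst (level b e)), of_int (snd (level b e))] :: 'a::comm_ring_1^2)"
proof (induction e)
  case (Cons t e)
  then show ?case
    using lift_params_matrix[of t "fst (level b e)" "snd (level b e)", where 'a = 'a]
    by (simp add: matrix_vector_mul_assoc[symmetric])
qed simp

lemma params_matrix:
  "(string_mat e ** type_mat og) *v vector [of_int r, of_int s] =
    (vector [of_int (fst (level (lift_params og (r, s)) e)), of_int (snd (level (lift_params og (r, s)) e))] :: 'a::comm_ring_1^2)"
  using level_matrix[of e "lift_params og (r, s)", where 'a = 'a] lift_params_matrix[of og r s, where 'a = 'a]
  by (simp add: matrix_vector_mul_assoc[symmetric])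

lemma params_eq: "params r s og e = vector [fst (level (lift_params og (r, s)) e), snd (level (lift_params og (r, s)) e)]"
  using params_matrix[of e og r s, where 'a = int] by (simp add: params_def)

lemma dvec_eq: "i < 8 \<Longrightarrow> dvec i = vector [dir_x i, dir_y i]"
  unfolding less_8_cases by (elim disjE) (simp_all add: dvec_def dir_x_def dir_y_def)

lemma anchor_eq: "i < 8 \<Longrightarrow> anchor (p, q) i = (if even i then q - p else p) *s dvec i"
  by (simp add: anchor_def amp_def dvec_eq vec2_eq_iff)

text \<open>For the origins f, g, h the parameters give \<open>q - p\<close> equal to
  \<open>r + s\<close>, \<open>s - r\<close>, \<open>r + s\<close> and \<open>p\<close> equal to
  \<open>r\<close>, \<open>s\<close>, \<open>s\<close>, which are the prescribed amplitudes.\<close>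

lemma initial_eq: "og \<in> origins \<Longrightarrow> i < 8 \<Longrightarrow> initial r s og i = [anchor (lift_params og (r, s)) i]"
  by (auto simp: origins_def octet_of_def anchor_eq)

lemma translate_map_pos:
  assumes "v = anchor (level b (t # e)) i"
  shows "translate v (map (pos b e) ws) = map (pos b (t # e)) (map ((#) i) ws)"
  using assms by (simp add: translate_def)

lemma D_octet_eq:
  assumes "og \<in> origins"
  defines "b r s \<equiv> lift_params og (r, s)"
  shows "i < 8 \<Longrightarrow> D_octet r s og e i = map (pos (b r s) e) (words e i)"
proof (induction e arbitrary: i)
  case Nil
  then show ?case using initial_eq[OF assms(1)] by (simp add: b_def)
next
  case (Cons t e)
  obtain p q where pq: "level (b r s) e = (p, q)" by fastforce
  have par: "params r s og e $ 1 = p" "params r s og e $ 2 = q"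
    using pq by (simp_all add: params_eq b_def)
  have IH: "D_octet r s og e ((i + k) mod 8) = map (pos (b r s) e) (words e ((i + k) mod 8))" for k
    using Cons.IH by simp
  have IH1: "D_octet r s og e ((1 + i) mod 8) = map (pos (b r s) e) (words e ((1 + i) mod 8))"
    using IH[of 1] by (simp add: add.commute)
  define A where "A = anchor (level (b r s) (t # e)) i"
  have a: "A = (if even i then snd (lift_params t (p, q)) - fst (lift_params t (p, q))
      else fst (lift_params t (p, q))) *s dvec i"
    using anchor_eq[OF Cons.prems, of "fst (lift_params t (p, q))" "snd (lift_params t (p, q))"] by (simp add: pq A_def)
  have T: "translate A (map (pos (b r s) e) ws) = map (pos (b r s) (t # e)) (map ((#) i) ws)" for ws
    by (rule translate_map_pos) (simp add: A_def)
  have "D_octet r s og (t # e) i = translate A (map (pos (b r s) e)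
      ((if backward t i then rev else id) (concat (map (\<lambda>k. words e ((i + k) mod 8)) (offsets t i)))))"
    using Cons.prems IH[of 0]
    by (cases t; cases "even i") (simp_all add: par a Let_def IH IH1 rev_map[symmetric] algebra_simps)
  then show ?case unfolding T words.simps .
qed

lemma D_cycle_eq: "og \<in> origins \<Longrightarrow> D_cycle r s og e = map (pos (lift_params og (r, s)) e) (map fst (D_list e))"
  unfolding D_cycle_def map_fst_D_list map_concat map_map comp_def
  by (rule arg_cong[where f = concat]) (auto simp: D_octet_eq)

lemma distinct_offsets: "distinct (map (\<lambda>k. (i + k) mod 8) (offsets t i))" if "i < 8"
  using that unfolding less_8_cases by (elim disjE; cases t; simp)

lemma distinct_concat_words:
  "distinct js \<Longrightarrow> (\<And>j. j \<in> set js \<Longrightarrow> distinct (words e j)) \<Longrightarrow> distinct (concat (map (words e) js))"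
proof (induction js)
  case (Cons j js)
  have "set (words e j) \<inter> set (words e k) = {}" if "k \<in> set js" for k
  proof -
    have "j \<noteq> k" using Cons.prems(1) that by auto
    then show ?thesis using hd_words[of _ e j] hd_words[of _ e k] by blast
  qed
  then have "set (words e j) \<inter> set (concat (map (words e) js)) = {}" by auto
  then show ?case using Cons by simp
qed simp

lemma distinct_words: "i < 8 \<Longrightarrow> distinct (words e i)"
proof (induction e arbitrary: i)
  case (Cons t e)
  have "distinct (concat (map (words e) (map (\<lambda>k. (i + k) mod 8) (offsets t i))))"
  proof (rule distinct_concat_words[OF distinct_offsets[OF Cons.prems]])
    fix j assume "j \<in> set (map (\<lambda>k. (i + k) mod 8) (offsets t i))"
    then have "j < 8" by auto
    then show "distinct (words e j)" by (rule Cons.IH)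
  qed
  then have "distinct (concat (map (\<lambda>k. words e ((i + k) mod 8)) (offsets t i)))"
    unfolding map_map comp_def .
  then show ?case by (simp add: distinct_map)
qed simp

lemma set_D_list: "set (map fst (D_list e)) = all_words e"
  unfolding map_fst_D_list all_words_def by auto

lemma distinct_D_list: "distinct (map fst (D_list e))"
  unfolding map_fst_D_list by (intro distinct_concat_words distinct_upt distinct_words) simp

text \<open>Both lists enumerate \<open>all_words e\<close> without repetition.\<close>

lemma length_D_list: "length (D_list e) = length (C_words e)"
  using distinct_card[OF distinct_D_list[of e]] distinct_card[OF distinct_C_words[of e]] set_D_list[of e] set_C_words[of e]
  by simp

lemma length_C_words: "8 \<le> length (C_words e)"
proof (induction e)
  case (Cons t e)
  have "length xs \<le> length (concat (map (fibre t) xs))" for xs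
  proof (induction xs)
    case (Cons x xs)
    have "fibre t x \<noteq> []" by (cases x; cases t) (auto simp: fibre_def)
    then have "1 \<le> length (fibre t x)" by (cases "fibre t x") auto
    then show ?case using Cons by simp
  qed simp
  from le_trans[OF Cons this[of "C_words e"]] show ?case by (simp only: C_words.simps)
qed simp

section \<open>The directions of both cycles as turning sequences\<close>

definition C_dirs :: "ltype list \<Rightarrow> nat list" where "C_dirs e = map out_dir (C_words e)"
definition D_dirs :: "ltype list \<Rightarrow> nat list" where "D_dirs e = map (\<lambda>x. snd (snd x)) (D_list e)"

lemma D_list_dirs: "x \<in> set (D_list e) \<Longrightarrow> fst (snd x) < 8 \<and> snd (snd x) < 8 \<and> snd (snd x) = turn (turn_type x) (fst (snd x))"
proof -
  assume "x \<in> set (D_list e)"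
  then obtain i where "(fst x, fst (snd x), snd (snd x)) \<in> set (D_piece e i)" by (auto simp: D_list_def)
  from D_piece_dirs[OF this] show ?thesis by (cases x) (auto simp: turn_def)
qed

lemma turning_map:
  assumes "\<And>x. x \<in> set xs \<Longrightarrow> h x < 8"
    "\<And>i. i < length xs \<Longrightarrow> h (xs ! (Suc i mod length xs)) = turn (\<tau> (xs ! (Suc i mod length xs))) (h (xs ! i))"
  shows "turning (map \<tau> xs) (map h xs)"
proof -
  have "map h xs ! (Suc i mod length xs) = turn (map \<tau> xs ! (Suc i mod length xs)) (map h xs ! i)" if "i < length xs" for i
    unfolding nth_map[OF Suc_mod_less[OF that]] nth_map[OF that] by (rule assms(2)[OF that])
  then show ?thesis using assms(1) by (simp add: turning_def)
qed

lemma turning_D: "turning (D_types e) (D_dirs e)"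
proof -
  have D_types_eq: "D_types e = map turn_type (D_list e)" by (simp add: D_types_def types_D_list)
  \<comment> \<open>Only the matching of directions is used here, so the parameters may be any
    pair.\<close>
  have "\<forall>i<length (D_list e). D_edge (0, 0) e (D_list e ! i) (D_list e ! (Suc i mod length (D_list e)))"
    using cyclic_D_list[of "(0, 0)" e] unfolding cyclic_iff by blast
  then have "snd (snd (D_list e ! (Suc i mod length (D_list e)))) =
      turn (turn_type (D_list e ! (Suc i mod length (D_list e)))) (snd (snd (D_list e ! i)))"
    if "i < length (D_list e)" for i
    using that D_list_dirs[OF nth_mem[OF Suc_mod_less[OF that]]] by (simp add: D_edge_def)
  then show ?thesis unfolding D_types_eq D_dirs_def using D_list_dirs by (intro turning_map) blast+
qed

text \<open>C leaves a square in its entering direction plus 3 or plus 5, according to the flag.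
  Tripling turns this into plus 1 or minus 1 and keeps parities, and the flag is absorbed by the
  parity of the entering direction.\<close>

lemma turning_C: "turning (C_types e) (map (\<lambda>d. 3 * d mod 8) (C_dirs e))"
proof -
  have C: "cyclic (C_edge (0, 0) e) (C_words e)" "\<And>x. x \<in> set (C_words e) \<Longrightarrow> hd (fst x) < 8"
    using cyclic_C_words[of "(0, 0)" e] by blast+
  have *: "3 * out_dir x mod 8 = turn (even (hd (fst x))) (3 * in_dir x mod 8)" if "hd (fst x) < 8" for x
  proof -
    obtain w up where x: "x = (w, up)" by fastforce
    show ?thesis using that unfolding x fst_conv less_8_cases by (elim disjE; cases up; simp add: turn_def)
  qed
  have "3 * out_dir (C_words e ! (Suc i mod length (C_words e))) mod 8 =
      turn (even (hd (fst (C_words e ! (Suc i mod length (C_words e)))))) (3 * out_dir (C_words e ! i) mod 8)"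
    if "i < length (C_words e)" for i
  proof -
    have "C_edge (0, 0) e (C_words e ! i) (C_words e ! (Suc i mod length (C_words e)))"
      using C(1) that unfolding cyclic_iff by blast
    then show ?thesis using *[OF C(2)[OF nth_mem[OF Suc_mod_less[OF that]]]] by (simp add: C_edge_def)
  qed
  then have "turning (map (\<lambda>x. even (hd (fst x))) (C_words e)) (map (\<lambda>x. 3 * out_dir x mod 8) (C_words e))"
    by (intro turning_map) simp_all
  then show ?thesis by (simp add: C_dirs_def C_types_def comp_def)
qed

text \<open>In terms of \<open>(r, s)\<close>, \<open>base_step\<close> refers to the parameters
  \<open>(s, r)\<close> for the origin f, \<open>(- r, s)\<close> for g and \<open>(r, s)\<close>
  for h. The exchange and the sign change of coordinates are the two kinds of turn.\<close>

definition origin_equiv :: "ltype \<Rightarrow> nat \<Rightarrow> nat" where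
  "origin_equiv og = (case og of Tf \<Rightarrow> turn True | Tg \<Rightarrow> turn False | _ \<Rightarrow> id)"

lemma label_equiv_origin: "label_equiv (origin_equiv og)"
  using label_equiv_turn label_equiv_id by (auto simp: origin_equiv_def split: ltype.split)

lemma base_step_origin:
  "og \<in> origins \<Longrightarrow> d < 8 \<Longrightarrow> base_step (lift_params og (r, s)) d = step (r, s) (origin_equiv og d)"
  unfolding less_8_cases origins_def
  by (elim disjE) (auto simp: base_step_def step_simps origin_equiv_def turn_def)

lemma C_edge_nth: "i < length (C_words e) \<Longrightarrow> C_edge b e (C_words e ! i) (C_words e ! (Suc i mod length (C_words e)))"
  using cyclic_C_words[of b e] unfolding cyclic_iff by blast

lemma D_edge_nth: "i < length (D_list e) \<Longrightarrow> D_edge b e (D_list e ! i) (D_list e ! (Suc i mod length (D_list e)))"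
  using cyclic_D_list[of b e] unfolding cyclic_iff by blast

lemma step_inj: "0 < p \<Longrightarrow> p < q \<Longrightarrow> d < 8 \<Longrightarrow> c < 8 \<Longrightarrow> step (p, q) d = step (p, q) c \<Longrightarrow> c = d"
  unfolding less_8_cases by (elim disjE; simp add: step_simps vec2_eq_iff)

lemma direction_step:
  assumes "0 < p" "p < q" "d < 8"
  shows "direction p q (step (p, q) d) = label d"
  unfolding direction_def
proof (rule the_equality)
  show "label d \<in> {1..8} \<and> step (p, q) d = dir_mat (label d) *v vector [p, q]"
    using assms(3) label_range dir_mat_mult_vec[OF assms(3)] by auto
  fix i assume i: "i \<in> {1..8} \<and> step (p, q) d = dir_mat i *v vector [p, q]"
  then obtain c where c: "i = label c" "c < 8" unfolding label_range[symmetric] by auto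
  with i have "step (p, q) d = step (p, q) c" using dir_mat_mult_vec by simp
  then have "c = d" using assms(1,2) step_inj[OF _ _ assms(3) c(2)] by simp
  then show "i = label d" using c by simp
qed

lemma leaper_move_step: "leaper_move p q v \<longleftrightarrow> (\<exists>d<8. v = step (p, q) d)"
proof
  assume "leaper_move p q v"
  then have "\<exists>d\<in>{0, 1, 2, 3, 4, 5, 6, 7}. v = step (p, q) d"
    by (auto simp: leaper_move_def step_simps vec2_eq_iff)
  then show "\<exists>d<8. v = step (p, q) d" unfolding less_8_cases by blast
next
  assume "\<exists>d<8. v = step (p, q) d"
  then show "leaper_move p q v" unfolding less_8_cases by (elim exE conjE disjE) (auto simp: leaper_move_def step_simps)
qed

lemma base_less: "og \<in> origins \<Longrightarrow> 0 < r \<Longrightarrow> r < s \<Longrightarrow> 0 < fst (lift_params og (r, s)) \<and> fst (lift_params og (r, s)) < snd (lift_params og (r, s))"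
  by (auto simp: origins_def)

lemma cyclic_next_D_cycle:
  assumes "og \<in> origins" "i < length (D_list e)"
  shows "cyclic_next (D_cycle r s og e) i = D_cycle r s og e ! i + step (r, s) (map (origin_equiv og) (D_dirs e) ! i)"
proof -
  have "D_edge (lift_params og (r, s)) e (D_list e ! i) (D_list e ! (Suc i mod length (D_list e)))" using D_edge_nth[OF assms(2)] .
  then show ?thesis using assms(2) Suc_mod_less[OF assms(2)] D_list_dirs[OF nth_mem[OF assms(2)]]
    by (simp add: D_cycle_eq[OF assms(1)] cyclic_next_def D_edge_def D_dirs_def base_step_origin[OF assms(1)])
qed

lemma labelled_cycle_extracted:
  assumes "0 < p" "p < q" "distinct cs" "3 \<le> length cs" "length ls = length cs"
    and step: "\<And>i. i < length cs \<Longrightarrow> ls ! i < 8 \<and> cyclic_next cs i = cs ! i + step (p, q) (ls ! i)"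
  shows "labelled_cycle (extracted p q (cycle_graph cs)) cs ls"
  unfolding labelled_cycle_def
proof (intro conjI allI impI)
  fix i assume "i < length cs"
  from step[OF this] have l: "ls ! i < 8" and v: "cyclic_next cs i - cs ! i = step (p, q) (ls ! i)"
    by simp_all
  show "ls ! i < 8" by (rule l)
  show "lab (extracted p q (cycle_graph cs)) (cs ! i, cyclic_next cs i) = label (ls ! i)"
    using direction_step[OF assms(1,2) l] v by (simp add: extracted_def)
  have "cs ! i - cyclic_next cs i = step (p, q) ((ls ! i + 4) mod 8)"
    using v step_opposite[OF l, of "(p, q)"] by (metis minus_diff_eq)
  then show "lab (extracted p q (cycle_graph cs)) (cyclic_next cs i, cs ! i) = label ((ls ! i + 4) mod 8)"
    using direction_step[OF assms(1,2), of "(ls ! i + 4) mod 8"] by (simp add: extracted_def)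
qed (use assms in \<open>simp_all add: extracted_def\<close>)

section \<open>The labelled cycles of a given skew leaper\<close>

context
  fixes r s :: int and og :: ltype and e :: "ltype list"
  assumes skew: "0 < r" "r < s" and og: "og \<in> origins"
begin

definition base_params where "base_params = lift_params og (r, s)"
definition C_squares where "C_squares = map (pos base_params e) (map fst (C_words e))"

lemma base_params: "0 < fst base_params" "fst base_params < snd base_params"
  using base_less[OF og skew] by (simp_all add: base_params_def)

lemma pos_inj_on: "inj_on (pos base_params e) (all_words e)"
  using pos_inj[OF base_params] by (auto simp: inj_on_def)

lemma distinct_C_squares: "distinct C_squares"
  unfolding C_squares_def distinct_map[of "pos base_params e"] using distinct_C_words pos_inj_on set_C_words[of e] by simp

lemma distinct_D_cycle: "distinct (D_cycle r s og e)"
  unfolding D_cycle_eq[OF og] base_params_def[symmetric] distinct_map[of "pos base_params e"]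
  using distinct_D_list pos_inj_on set_D_list[of e] by simp

lemma C_params: "(params r s og e $ 1, params r s og e $ 2) = level base_params e"
  by (simp add: params_eq base_params_def)

lemma C_params_less: "0 < params r s og e $ 1" "params r s og e $ 1 < params r s og e $ 2"
  using level_less[OF C_params[symmetric] base_params] by auto

lemma cyclic_next_C_squares:
  assumes "i < length (C_words e)"
  shows "cyclic_next C_squares i = C_squares ! i + step (level base_params e) (C_dirs e ! i)"
proof -
  have "C_edge base_params e (C_words e ! i) (C_words e ! (Suc i mod length (C_words e)))" using C_edge_nth[OF assms] .
  then show ?thesis using assms Suc_mod_less[OF assms]
    by (simp add: C_squares_def cyclic_next_def C_edge_def C_dirs_def)
qed

lemma C_graph_eq: "C_graph r s og e = cycle_graph C_squares"
proof -
  obtain p q where pq: "level base_params e = (p, q)" by fastforce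
  have par: "params r s og e $ 1 = p" "params r s og e $ 2 = q" using C_params pq by auto
  let ?n = "length (C_words e)"
  have board: "board r s og e = set C_squares"
    unfolding board_def D_cycle_eq[OF og] C_squares_def base_params_def[symmetric] set_map[of "pos base_params e"] set_D_list
    using set_C_words[of e] by simp
  have dir: "C_dirs e ! i < 8" if "i < ?n" for i
    using that by (cases "C_words e ! i") (simp add: C_dirs_def)
  have arc: "(x, y) \<in> parcs (cycle_graph C_squares)"
    if x: "x \<in> set C_squares" and y: "y \<in> set C_squares" and m: "leaper_move p q (y - x)" for x y
  proof -
    obtain v w where vw: "x = pos base_params e v" "y = pos base_params e w" "v \<in> all_words e" "w \<in> all_words e"
      using x y set_C_words[of e] by (auto simp: C_squares_def)
    obtain d where d: "d < 8" "y - x = step (p, q) d" using m leaper_move_step by blast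
    then have "pos base_params e w = pos base_params e v + step (level base_params e) d" by (simp add: pq vw(1,2)[symmetric] algebra_simps)
    \<comment> \<open>This is the direction of the equality with content: every move of L within the
      board is an edge of the cycle.\<close>
    from no_extra_edge[OF base_params vw(3,4) d(1) this] obtain u u' where
      u: "u \<in> set (C_words e)" "u' \<in> set (C_words e)" "C_edge base_params e u u'" "fst u = v \<and> fst u' = w \<or> fst u' = v \<and> fst u = w"
      by blast
    then obtain i where i: "i < ?n" "C_words e ! i = u" by (auto simp: in_set_conv_nth)
    have "pos base_params e (fst u') = cyclic_next C_squares i"
      using u(3) i unfolding cyclic_next_C_squares[OF i(1)] by (simp add: C_edge_def C_squares_def C_dirs_def)
    moreover have "pos base_params e (fst u) = C_squares ! i" using i by (simp add: C_squares_def)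
    ultimately show ?thesis
      using u(4) i(1) vw(1,2) by (auto simp: cycle_graph_def C_squares_def intro!: bexI[of _ i])
  qed
  have move: "leaper_move p q (y - x) \<and> x \<in> set C_squares \<and> y \<in> set C_squares"
    if "(x, y) \<in> parcs (cycle_graph C_squares)" for x y
    using that
  proof (cases rule: cycle_graph_arcE)
    case (1 a)
    then have a: "a < ?n" by (simp add: C_squares_def)
    have "y - x = step (p, q) (C_dirs e ! a)" using 1 cyclic_next_C_squares[OF a] by (simp add: pq)
    then show ?thesis using 1 dir[OF a] leaper_move_step cyclic_next_in[OF 1(1)] nth_mem by blast
  next
    case (2 a)
    then have a: "a < ?n" by (simp add: C_squares_def)
    have "y - x = step (p, q) ((C_dirs e ! a + 4) mod 8)"
      using 2 cyclic_next_C_squares[OF a] step_opposite[OF dir[OF a]] by (simp add: pq)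
    moreover have "(C_dirs e ! a + 4) mod 8 < 8" by simp
    ultimately show ?thesis using 2 leaper_move_step cyclic_next_in[OF 2(1)] nth_mem by blast
  qed
  have "{(a, b). a \<in> set C_squares \<and> b \<in> set C_squares \<and> leaper_move p q (b - a)} = parcs (cycle_graph C_squares)"
  proof (rule set_eqI)
    fix z :: "square \<times> square"
    obtain x y where z: "z = (x, y)" by fastforce
    show "z \<in> {(a, b). a \<in> set C_squares \<and> b \<in> set C_squares \<and> leaper_move p q (b - a)} \<longleftrightarrow> z \<in> parcs (cycle_graph C_squares)"
      unfolding z mem_Collect_eq case_prod_conv using arc[of x y] move[of x y] by blast
  qed
  then show ?thesis unfolding C_graph_def leaper_graph_def par board by (simp add: cycle_graph_def)
qed

lemma labelled_cycle_C: "labelled_cycle (C_extracted r s og e) C_squares (C_dirs e)"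
  unfolding C_extracted_def C_graph_eq
proof (rule labelled_cycle_extracted[OF C_params_less distinct_C_squares])
  fix i assume "i < length C_squares"
  then have i: "i < length (C_words e)" by (simp add: C_squares_def)
  then have "C_dirs e ! i < 8" by (cases "C_words e ! i") (simp add: C_dirs_def)
  then show "C_dirs e ! i < 8 \<and> cyclic_next C_squares i =
      C_squares ! i + step (params r s og e $ 1, params r s og e $ 2) (C_dirs e ! i)"
    using cyclic_next_C_squares[OF i] by (simp add: C_params)
qed (use length_C_words[of e] in \<open>simp_all add: C_squares_def C_dirs_def\<close>)

lemma labelled_cycle_D: "labelled_cycle (D_extracted r s og e) (D_cycle r s og e) (map (origin_equiv og) (D_dirs e))"
  unfolding D_extracted_def
proof (rule labelled_cycle_extracted[OF skew distinct_D_cycle])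
  fix i assume "i < length (D_cycle r s og e)"
  then have i: "i < length (D_list e)" by (simp add: D_cycle_eq[OF og])
  then have "map (origin_equiv og) (D_dirs e) ! i < 8"
    using D_list_dirs[OF nth_mem[OF i]] label_equiv_less[OF label_equiv_origin] by (simp add: D_dirs_def)
  then show "map (origin_equiv og) (D_dirs e) ! i < 8 \<and> cyclic_next (D_cycle r s og e) i =
      D_cycle r s og e ! i + step (r, s) (map (origin_equiv og) (D_dirs e) ! i)"
    using cyclic_next_D_cycle[OF og i] by simp
qed (use length_C_words[of e] in \<open>simp_all add: D_cycle_eq[OF og] D_dirs_def length_D_list\<close>)

end

section \<open>Potentials and duality\<close>

definition combine :: "int \<Rightarrow> int \<Rightarrow> int \<times> int \<Rightarrow> int \<times> int \<Rightarrow> int \<times> int" where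
  "combine r s b c = (r * fst b + s * fst c, r * snd b + s * snd c)"

lemma lift_params_combine: "lift_params t (combine r s b c) = combine r s (lift_params t b) (lift_params t c)"
  by (cases b; cases c; cases t) (simp_all add: combine_def algebra_simps)

lemma level_combine: "level (combine r s b c) e = combine r s (level b e) (level c e)"
  by (induction e) (simp_all add: lift_params_combine)

lemma anchor_combine: "anchor (combine r s b c) i = r *s anchor b i + s *s anchor c i"
  by (simp add: anchor_def amp_def combine_def vec2_eq_iff algebra_simps)

lemma pos_combine: "pos (combine r s b c) e w = r *s pos b e w + s *s pos c e w"
proof (induction e arbitrary: w)
  case Nil
  show ?case by (cases w) (simp_all add: anchor_combine)
next
  case (Cons t e)
  show ?case
  proof (cases w)
    case (Cons i v)
    have "level (combine r s b c) (t # e) = combine r s (level b (t # e)) (level c (t # e))" by (rule level_combine)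
    then show ?thesis using \<open>\<And>w. pos (combine r s b c) e w = r *s pos b e w + s *s pos c e w\<close>[of v]
      by (simp only: Cons pos.simps anchor_combine) (simp add: vec2_eq_iff algebra_simps)
  qed simp
qed

definition real_square :: "square \<Rightarrow> real^2" where
  "real_square v = vector [of_int (v $ 1), of_int (v $ 2)]"

lemma real_square_inj: "real_square u = real_square v \<longleftrightarrow> u = v"
  by (simp add: real_square_def vec2_eq_iff)

lemma real_square_add: "real_square (u + v) = real_square u + real_square v"
  by (simp add: real_square_def vec2_eq_iff)

text \<open>The columns are the positions for \<open>(r, s)\<close> equal to \<open>(1, 0)\<close>
  and \<open>(0, 1)\<close>. These need not come from skew leapers, but \<open>pos\<close> is linear
  in all integer parameters.\<close>

definition pos_mat :: "ltype \<Rightarrow> ltype list \<Rightarrow> nat list \<Rightarrow> real^2^2" where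
  "pos_mat og e w = (let u = pos (lift_params og (1, 0)) e w; v = pos (lift_params og (0, 1)) e w in
     mat2 (of_int (u $ 1)) (of_int (v $ 1)) (of_int (u $ 2)) (of_int (v $ 2)))"

lemma pos_mat_vec: "pos_mat og e w *v vector [of_int r, of_int s] = real_square (pos (lift_params og (r, s)) e w)"
proof -
  have "lift_params og (r, s) = combine r s (lift_params og (1, 0)) (lift_params og (0, 1))"
    by (cases og) (simp_all add: combine_def)
  then have "pos (lift_params og (r, s)) e w = r *s pos (lift_params og (1, 0)) e w + s *s pos (lift_params og (0, 1)) e w"
    by (simp only: pos_combine)
  then show ?thesis by (simp add: pos_mat_def Let_def mat2_mult_vec real_square_def vec2_eq_iff algebra_simps)
qed

lemma matrix_eqI_int:
  fixes A B :: "real^2^2"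
  assumes "\<And>r s. A *v vector [of_int r, of_int s] = B *v vector [of_int r, of_int s]"
  shows "A = B"
  using assms[of 1 0] assms[of 0 1]
  by (simp add: vec_eq_iff forall_2 matrix_vector_mult_def sum_2)

lemma dirm_vec: "d < 8 \<Longrightarrow> dirm d *v vector [of_int p, of_int q] = real_square (step (p, q) d)"
  unfolding less_8_cases by (elim disjE) (simp_all add: dir_mat_label mat2_mult_vec step_simps real_square_def)

abbreviation descent_mat :: "ltype \<Rightarrow> ltype list \<Rightarrow> real^2^2" where
  "descent_mat og e \<equiv> string_mat e ** type_mat og"

lemma invertible_descent_mat: "invertible (descent_mat og e)"
proof -
  have t: "invertible (type_mat t :: real^2^2)" for t by (cases t) (simp_all add: invertible_mat2)
  have "invertible (string_mat e :: real^2^2)"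
  proof (induction e)
    case Nil
    show ?case unfolding invertible_def by (intro exI[of _ "mat 1"]) simp
  qed (simp add: t invertible_mult)
  then show ?thesis using t invertible_mult by blast
qed

lemma descent_mat_inverse:
  "descent_mat og e ** matrix_inv (descent_mat og e) = mat 1" "matrix_inv (descent_mat og e) ** descent_mat og e = mat 1"
  using someI_ex[OF invertible_descent_mat[of e og, unfolded invertible_def], folded matrix_inv_def] by blast+

lemma D_dirs_less: "l \<in> set (D_dirs e) \<Longrightarrow> l < 8"
  using D_list_dirs by (auto simp: D_dirs_def)

lemma C_dirs_less: "l \<in> set (C_dirs e) \<Longrightarrow> l < 8"
  by (auto simp: C_dirs_def)

text \<open>The edges of D hold for all integers \<open>r\<close>, \<open>s\<close>, so they are
  identities between matrices.\<close>

lemma potential_D: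
  assumes "og \<in> origins"
  shows "potential (\<lambda>i. pos_mat og e (map fst (D_list e) ! i)) (map (origin_equiv og) (D_dirs e))"
  unfolding potential_def
proof (intro allI impI)
  let ?n = "length (map (origin_equiv og) (D_dirs e))"
  fix i assume "i < ?n"
  then have i: "i < length (D_list e)" and n: "?n = length (D_list e)" by (simp_all add: D_dirs_def)
  let ?d = "map (origin_equiv og) (D_dirs e) ! i"
  have d: "?d < 8" using i D_dirs_less[OF nth_mem, of i e] label_equiv_less[OF label_equiv_origin]
    by (simp add: D_dirs_def)
  show "pos_mat og e (map fst (D_list e) ! (Suc i mod ?n)) - pos_mat og e (map fst (D_list e) ! i) = dirm ?d"
  proof (rule matrix_eqI_int)
    fix r s
    have "pos (lift_params og (r, s)) e (map fst (D_list e) ! (Suc i mod ?n)) =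
      pos (lift_params og (r, s)) e (map fst (D_list e) ! i) + step (r, s) ?d"
      using cyclic_next_D_cycle[OF assms i, of r s] i Suc_mod_less[OF i]
      by (simp add: D_cycle_eq[OF assms] cyclic_next_def n[unfolded length_map])
    then show "(pos_mat og e (map fst (D_list e) ! (Suc i mod ?n)) - pos_mat og e (map fst (D_list e) ! i)) *v
        vector [of_int r, of_int s] = dirm ?d *v vector [of_int r, of_int s]"
      unfolding matrix_vector_mult_diff_rdistrib pos_mat_vec dirm_vec[OF d] by (simp add: real_square_add)
  qed
qed

text \<open>A move of L in direction \<open>d\<close> is \<open>dirm d\<close> applied to the
  parameters of L, which are the descent matrix times \<open>(r, s)\<close>; hence position matrices
  change by \<open>dirm d ** ?A\<close> along C, and the inverse on the right cancels
  \<open>?A\<close>.\<close>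

lemma potential_C:
  "potential (\<lambda>i. pos_mat og e (map fst (C_words e) ! i) ** matrix_inv (descent_mat og e)) (C_dirs e)"
  unfolding potential_def
proof (intro allI impI)
  let ?A = "descent_mat og e" and ?n = "length (C_dirs e)"
  fix i assume "i < ?n"
  then have i: "i < length (C_words e)" and n: "?n = length (C_words e)" by (simp_all add: C_dirs_def)
  let ?d = "C_dirs e ! i" and ?P = "pos_mat og e (map fst (C_words e) ! (Suc i mod ?n)) - pos_mat og e (map fst (C_words e) ! i)"
  have d: "?d < 8" using i C_dirs_less[OF nth_mem, of i e] by (simp add: C_dirs_def)
  have "?P = dirm ?d ** ?A"
  proof (rule matrix_eqI_int)
    fix r s
    have "C_edge (lift_params og (r, s)) e (C_words e ! i) (C_words e ! (Suc i mod length (C_words e)))"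
      using C_edge_nth[OF i] .
    then have "pos (lift_params og (r, s)) e (map fst (C_words e) ! (Suc i mod ?n)) =
      pos (lift_params og (r, s)) e (map fst (C_words e) ! i) + step (level (lift_params og (r, s)) e) ?d"
      using i Suc_mod_less[OF i] by (simp add: C_edge_def C_dirs_def)
    then show "?P *v vector [of_int r, of_int s] = (dirm ?d ** ?A) *v vector [of_int r, of_int s]"
      unfolding matrix_vector_mult_diff_rdistrib pos_mat_vec matrix_vector_mul_assoc[symmetric, of "dirm ?d"]
        params_matrix dirm_vec[OF d] by (simp add: real_square_add)
  qed
  then have "?P ** matrix_inv ?A = dirm ?d ** (?A ** matrix_inv ?A)" by (simp only: matrix_mul_assoc)
  moreover have "X ** matrix_inv ?A - Z ** matrix_inv ?A = (X - Z) ** matrix_inv ?A" for X Z :: "real^2^2"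
    using matrix_conj_diff[of "mat 1" X "matrix_inv ?A" Z] by simp
  ultimately show "pos_mat og e (map fst (C_words e) ! (Suc i mod ?n)) ** matrix_inv ?A -
      pos_mat og e (map fst (C_words e) ! i) ** matrix_inv ?A = dirm ?d"
    by (simp only: descent_mat_inverse matrix_mul_rid)
qed

lemma potential_sum: "potential Y ls \<Longrightarrow> (\<Sum>i<length ls. dirm (ls ! i)) = 0"
proof (cases "ls = []")
  case False
  assume pot: "potential Y ls"
  let ?n = "length ls"
  have n: "0 < ?n" using False by simp
  have "(\<Sum>i<?n. Y (Suc i mod ?n)) = (\<Sum>i\<in>(\<lambda>i. (1 + i) mod ?n) ` {..<?n}. Y i)"
    using shift_image(2)[OF n, of 1] by (subst sum.reindex) (simp_all add: comp_def plus_1_eq_Suc)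
  then have "(\<Sum>i<?n. Y (Suc i mod ?n)) = (\<Sum>i<?n. Y i)" by (simp only: shift_image(1)[OF n])
  moreover have "(\<Sum>i<?n. dirm (ls ! i)) = (\<Sum>i<?n. Y (Suc i mod ?n) - Y i)"
    using pot by (intro sum.cong) (auto simp: potential_def)
  ultimately show ?thesis by (simp add: sum_subtractf)
qed simp

lemma trivial_cycle_labelled:
  assumes "0 < p" "p < q" "3 \<le> length cs" "distinct cs" "length ls = length cs" "potential Y ls"
    "\<And>i. i < length cs \<Longrightarrow> ls ! i < 8 \<and> cyclic_next cs i = cs ! i + step (p, q) (ls ! i)"
  shows "trivial_cycle p q cs"
proof -
  have "(\<Sum>i<length cs. dir_mat (direction p q (cyclic_next cs i - cs ! i)) :: real^2^2) = (\<Sum>i<length ls. dirm (ls ! i))"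
    using assms(7) direction_step[OF assms(1,2)] by (intro sum.cong) (auto simp: assms(5))
  also have "\<dots> = 0" by (rule potential_sum[OF assms(6)])
  finally show ?thesis
    using assms by (auto simp: trivial_cycle_def leaper_cycle_def leaper_move_step)
qed

text \<open>Evaluated at one skew leaper, equal potentials give equal squares, and potentials that
  differ by a direction matrix give squares joined by a move of L. Distinctness of the squares and
  \<open>C_graph_eq\<close> settle the two cases.\<close>

lemma coherent_labels_C: "coherent_labels (C_dirs e)"
proof -
  let ?A = "descent_mat Th e" and ?n = "length (C_dirs e)"
  \<comment> \<open>The labels depend on \<open>e\<close> alone, so the (1, 2)-leaper with origin h
    serves as a test case.\<close>
  have skew: "0 < (1 :: int)" "(1 :: int) < 2" "Th \<in> origins" by (simp_all add: origins_def)
  define Y where "Y i = pos_mat Th e (map fst (C_words e) ! i) ** matrix_inv ?A" for i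
  define b where "b = lift_params Th (1, 2)"
  have n: "?n = length (C_words e)" by (simp add: C_dirs_def)
  have sq: "C_squares 1 2 Th e ! i = pos b e (map fst (C_words e) ! i)" if "i < ?n" for i
    using that n by (simp add: C_squares_def[OF skew] base_params_def[OF skew] b_def)
  have len: "length (C_squares 1 2 Th e) = ?n" by (simp add: C_squares_def[OF skew] n)
  note dist = distinct_C_squares[OF skew, of e]
  have Y: "Y i ** ?A = pos_mat Th e (map fst (C_words e) ! i)" for i
    unfolding Y_def matrix_mul_assoc[symmetric] descent_mat_inverse by simp
  have pos: "real_square (C_squares 1 2 Th e ! i) = Y i ** ?A *v vector [of_int 1, of_int 2]" if "i < ?n" for i
    unfolding Y pos_mat_vec sq[OF that] b_def ..
  have "i = j" if "i < ?n" "j < ?n" "Y i = Y j" for i j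
  proof -
    have "real_square (C_squares 1 2 Th e ! i) = real_square (C_squares 1 2 Th e ! j)"
      unfolding pos[OF that(1)] pos[OF that(2)] that(3) ..
    then show ?thesis using that(1,2) dist by (simp add: real_square_inj nth_eq_iff_index_eq len)
  qed
  moreover have "j = Suc i mod ?n \<or> i = Suc j mod ?n" if ij: "i < ?n" "j < ?n" and "Y j - Y i \<in> dirm ` {..<8}" for i j
  proof -
    from that(3) obtain d where d: "d < 8" "Y j = Y i + dirm d" by (auto simp: algebra_simps)
    have "real_square (C_squares 1 2 Th e ! j) = real_square (C_squares 1 2 Th e ! i) + dirm d *v (?A *v vector [of_int 1, of_int 2])"
      unfolding pos[OF ij(1)] pos[OF ij(2)] d(2)
      by (simp add: matrix_vector_mul_assoc[symmetric] matrix_vector_mult_add_rdistrib)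
    also have "\<dots> = real_square (C_squares 1 2 Th e ! i + step (level b e) d)"
      unfolding params_matrix dirm_vec[OF d(1)] by (simp add: real_square_add b_def)
    finally have "C_squares 1 2 Th e ! j = C_squares 1 2 Th e ! i + step (level b e) d" by (simp only: real_square_inj)
    moreover have "level b e = (params 1 2 Th e $ 1, params 1 2 Th e $ 2)" by (simp add: params_eq b_def)
    ultimately have "leaper_move (params 1 2 Th e $ 1) (params 1 2 Th e $ 2) (C_squares 1 2 Th e ! j - C_squares 1 2 Th e ! i)"
      using d(1) leaper_move_step by auto
    moreover have "board 1 2 Th e = set (C_squares 1 2 Th e)"
      using arg_cong[OF C_graph_eq[OF skew, of e], of pverts] by (simp add: C_graph_def leaper_graph_def cycle_graph_def)
    ultimately have "(C_squares 1 2 Th e ! i, C_squares 1 2 Th e ! j) \<in> parcs (C_graph 1 2 Th e)"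
      using ij len by (simp add: C_graph_def leaper_graph_def)
    then show ?thesis unfolding C_graph_eq[OF skew] using cycle_graph_arcs[OF dist] ij len by simp
  qed
  ultimately show ?thesis
    unfolding coherent_labels_def using potential_C[of Th e] unfolding Y_def[symmetric]
    by (intro exI[of _ Y] conjI allI impI) simp_all
qed

text \<open>The words of turns agree up to a rotation, so the labels agree up to an equivalence as
  well.\<close>

lemma flip_labels:
  obtains k g where "label_equiv g" "D_dirs (flip e) = map g (rotate k (map (\<lambda>d. 3 * d mod 8) (C_dirs e)))"
proof -
  obtain k where k: "D_types (flip e) = rotate k (C_types e)"
    using D_types_flip[of e] unfolding rotation_def by blast
  have "rotate k (map (\<lambda>d. 3 * d mod 8) (C_dirs e)) \<noteq> []"
    using length_C_words[of e] by (auto simp: C_dirs_def)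
  from turning_unique[OF turning_rotate[OF turning_C, of k e] turning_D[of "flip e", unfolded k] this]
  show ?thesis using that by blast
qed

lemma rotate_C_dirs: "rotate k (C_dirs e) = map (\<lambda>d. 3 * d mod 8) (rotate k (map (\<lambda>d. 3 * d mod 8) (C_dirs e)))"
proof -
  have "3 * (3 * d mod 8) mod 8 = d" if "d < 8" for d :: nat using that unfolding less_8_cases by auto
  then have "map (\<lambda>d. 3 * d mod 8) (map (\<lambda>d. 3 * d mod 8) (C_dirs e)) = map id (C_dirs e)"
    unfolding map_map by (intro map_cong refl) (simp add: C_dirs_less)
  then show ?thesis unfolding rotate_map[symmetric] by (simp only: list.map_id)
qed

text \<open>The board argument controls moves of L but not moves of M; instead \<open>e\<close> is
  regarded as the flip of \<open>flip e\<close>, whose first cycle is known to be coherent.\<close>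

lemma coherent_labels_D: "coherent_labels (map (origin_equiv og) (D_dirs e))"
proof -
  obtain k g where g: "label_equiv g" "D_dirs e = map g (rotate k (map (\<lambda>d. 3 * d mod 8) (C_dirs (flip e))))"
    using flip_labels[of "flip e"] unfolding flip_flip by blast
  have "coherent_labels (map (\<lambda>d. 3 * d mod 8) (C_dirs (flip e)))"
    by (rule coherent_labels_map[OF coherent_labels_C label_equiv_triple C_dirs_less])
  then have "coherent_labels (D_dirs e)"
    unfolding g(2) by (rule coherent_labels_map[OF coherent_labels_rotate g(1)]) auto
  then show ?thesis by (rule coherent_labels_map[OF _ label_equiv_origin D_dirs_less])
qed

text \<open>\<open>\<eta>\<close> matches the squares with the same word. Both potentials are
  functions of the word, and their differences are proportional by \<open>A\<close>, which is the
  duality condition.\<close>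

lemma complement_with_labelled:
  assumes \<Phi>: "labelled_cycle \<Phi> (map f u) ls" and \<Psi>: "labelled_cycle \<Psi> (map g v) ms" and uv: "set u = set v"
    and N: "potential (\<lambda>i. N (u ! i)) ls" and N': "potential (\<lambda>i. N' (v ! i)) ms"
    and co: "coherent_labels ls" "coherent_labels ms" and A: "A \<notin> dir_mat ` {1..8}"
    and diff: "\<And>w w'. N w' - N w = (N' w' - N' w) ** A"
  shows "complement_with \<Phi> \<Psi> A"
proof -
  have b: "base \<Phi> = cycle_graph (map f u)" "base \<Psi> = cycle_graph (map g v)"
    and d: "distinct (map f u)" "distinct (map g v)" using \<Phi> \<Psi> by (auto simp: labelled_cycle_def)
  have V: "pverts (base \<Phi>) = f ` set u" "pverts (base \<Psi>) = g ` set u" by (simp_all add: b cycle_graph_def uv)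
  have inj: "inj_on f (set u)" "inj_on g (set u)" using d by (simp_all add: distinct_map uv)
  have len: "length u = length v" using d uv by (metis distinct_card distinct_map)
  define \<eta> where "\<eta> x = g (the_inv_into (set u) f x)" for x
  have \<eta>: "\<eta> (f w) = g w" if "w \<in> set u" for w using that inj by (simp add: \<eta>_def the_inv_into_f_f)
  have iu: "N (u ! index (map f u) (f w)) = N w" if w: "w \<in> set u" for w
  proof -
    obtain i where "w = u ! i" "i < length u" using w by (auto simp: in_set_conv_nth)
    then show ?thesis using index_nth[OF d(1), of i] by simp
  qed
  have iv: "N' (v ! index (map g v) (g w)) = N' w" if w: "w \<in> set u" for w
  proof -
    obtain i where "w = v ! i" "i < length v" using w uv by (auto simp: in_set_conv_nth)
    then show ?thesis using index_nth[OF d(2), of i] by simp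
  qed
  have "bij_betw \<eta> (pverts (base \<Phi>)) (pverts (base \<Psi>))"
    unfolding V by (rule bij_betw_imageI) (use inj \<eta> in \<open>auto simp: inj_on_def image_image\<close>)
  moreover have "dg_distance \<Phi> a b = dir_mat (lab \<Psi> (\<eta> a, \<eta> b)) ** A"
    if ab: "a \<in> pverts (base \<Phi>)" "b \<in> pverts (base \<Phi>)" "(\<eta> a, \<eta> b) \<in> parcs (base \<Psi>)" for a b
  proof -
    obtain w w' where w: "a = f w" "b = f w'" "w \<in> set u" "w' \<in> set u" using ab V by auto
    have "dg_distance \<Phi> a b = N w' - N w"
      using dg_distance_labelled_cycle[OF \<Phi> N, of a b] w by (simp add: iu)
    moreover have "dir_mat (lab \<Psi> (\<eta> a, \<eta> b)) = N' w' - N' w"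
      using arc_potential[OF \<Psi> N' ab(3)] w by (simp add: \<eta> iv)
    ultimately show ?thesis using diff by simp
  qed
  moreover have "digraph_iso (ugr \<Phi>) (ugr \<Psi>)"
    unfolding b by (rule digraph_iso_cycle_graph[OF d]) (simp add: len)
  ultimately show ?thesis
    unfolding complement_with_def
    using direction_graph_labelled_cycle[OF \<Phi> N] direction_graph_labelled_cycle[OF \<Psi> N'] A
      coherent_labelled_cycle[OF \<Phi> co(1)] coherent_labelled_cycle[OF \<Psi> co(2)]
      connected_labelled_cycle[OF \<Phi> N] connected_labelled_cycle[OF \<Psi> N']
    by blast
qed

lemma level_snd_mono: "0 < fst b \<Longrightarrow> fst b < snd b \<Longrightarrow> snd b \<le> snd (level b e)"
proof (induction e)
  case (Cons t e)
  obtain p q where pq: "level b e = (p, q)" by fastforce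
  with level_less[OF pq Cons.prems] Cons show ?case by (cases t) auto
qed simp

text \<open>Applied to \<open>(1, 2)\<close>, the descent matrix yields a second coordinate of at
  least 3, whereas direction matrices yield at most 2.\<close>

lemma descent_mat_not_dir:
  assumes "og \<in> origins"
  shows "descent_mat og e \<notin> dir_mat ` {1..8}" "matrix_inv (descent_mat og e) \<notin> dir_mat ` {1..8}"
proof -
  define b where "b = lift_params og (1, 2)"
  have b: "0 < fst b" "fst b < snd b" "3 \<le> snd b" using assms by (auto simp: b_def origins_def)
  have *: "descent_mat og e \<noteq> dirm d" if d: "d < 8" for d
  proof
    assume "descent_mat og e = dirm d"
    then have "real_square (step (1, 2) d) = vector [of_int (fst (level b e)), of_int (snd (level b e))]"
      using params_matrix[of e og 1 2, where 'a = real] dirm_vec[OF d, of 1 2] by (simp add: b_def)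
    then have "step (1, 2) d $ 2 = snd (level b e)" by (simp add: real_square_def vec2_eq_iff)
    moreover have "step (1, 2) d $ 2 \<le> 2" using d unfolding less_8_cases by (elim disjE) (simp_all add: step_simps)
    ultimately show False using level_snd_mono[OF b(1,2), of e] b(3) by linarith
  qed
  then show "descent_mat og e \<notin> dir_mat ` {1..8}" unfolding dir_mat_image by blast
  \<comment> \<open>Direction matrices are closed under inverses: the quarter turns, labels 0 and 4,
    are inverse to each other and the others are involutions. This reduces the second claim to the
    first.\<close>
  have inv: "\<exists>c<8. dirm d ** dirm c = mat 1" if "d < 8" for d
  proof -
    have "mat 1 = (mat2 1 0 0 1 :: real^2^2)" by (simp add: mat2_def vec_eq_iff forall_2 mat_def)
    moreover have "dirm d ** dirm (if d = 0 then 4 else if d = 4 then 0 else d) = (mat2 1 0 0 1 :: real^2^2)"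
      using that unfolding less_8_cases by (elim disjE) (simp_all add: dir_mat_label mat2_mult)
    ultimately show ?thesis using that by (intro exI[of _ "if d = 0 then 4 else if d = 4 then 0 else d"]) auto
  qed
  show "matrix_inv (descent_mat og e) \<notin> dir_mat ` {1..8}"
  proof
    assume "matrix_inv (descent_mat og e) \<in> dir_mat ` {1..8}"
    then obtain d where d: "d < 8" "matrix_inv (descent_mat og e) = dirm d" unfolding dir_mat_image by blast
    obtain c where c: "c < 8" "dirm d ** dirm c = mat 1" using inv[OF d(1)] by blast
    have "descent_mat og e = (descent_mat og e ** dirm d) ** dirm c"
      unfolding matrix_mul_assoc[symmetric] c(2) by simp
    also have "\<dots> = dirm c" using descent_mat_inverse(1)[of e og] by (simp add: d(2))
    finally show False using *[OF c(1)] by blast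
  qed
qed

theorem theorem20:
  shows "\<exists>(\<Phi> :: ltype list \<Rightarrow> square lab_digraph) (\<Phi>II :: ltype \<Rightarrow> ltype list \<Rightarrow> square lab_digraph).
    (\<forall>r s. \<forall>og\<in>origins. \<forall>e. 0 < r \<and> r < s \<longrightarrow>
       (\<exists>cs. C_graph r s og e = cycle_graph cs \<and>
          trivial_cycle (params r s og e $ 1) (params r s og e $ 2) cs) \<and>
       trivial_cycle r s (D_cycle r s og e)) \<and>
    (\<forall>r s. \<forall>og\<in>origins. \<forall>e. 0 < r \<and> r < s \<longrightarrow>
       same_dg (C_extracted r s og e) (\<Phi> e)) \<and>
    (\<forall>r s. \<forall>og\<in>origins. \<forall>e. 0 < r \<and> r < s \<longrightarrow>
       same_dg (D_extracted r s og e) (\<Phi>II og e)) \<and>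
    (\<forall>r s. \<forall>og\<in>origins. \<forall>e. 0 \<le> r \<and> r \<le> s \<and> 0 < s \<and> initial_exists r s og \<longrightarrow>
       instantiation_of r s (cycle_graph (D_cycle r s og e)) (\<Phi>II og e)) \<and>
    (\<forall>e' e''. e'' = flip e' \<longrightarrow>
       (\<forall>\<Psi>\<in>{\<Phi> e', \<Phi>II Tf e'', \<Phi>II Tg e'', \<Phi>II Th e''}.
        \<forall>\<Psi>'\<in>{\<Phi> e', \<Phi>II Tf e'', \<Phi>II Tg e'', \<Phi>II Th e''}. equivalent_dg \<Psi> \<Psi>')) \<and>
    (\<forall>og\<in>origins. \<forall>e.
       dual_dg (\<Phi> e) \<and> dual_dg (\<Phi>II og e) \<and>
       invertible (string_mat e ** type_mat og :: real^2^2) \<and>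
       complement_with (\<Phi>II og e) (\<Phi> e) (string_mat e ** type_mat og) \<and>
       complement_with (\<Phi> e) (\<Phi>II og e) (matrix_inv (string_mat e ** type_mat og)))"
proof -
  \<comment> \<open>The graphs extracted for the (1, 2)-leaper serve as representatives, with origin
    h for \<open>\<Phi>\<close>.\<close>
  define \<Phi> where "\<Phi> e = C_extracted 1 2 Th e" for e
  define \<Phi>II where "\<Phi>II og e = D_extracted 1 2 og e" for og e
  have Th: "Th \<in> origins" by (simp add: origins_def)
  have labC: "labelled_cycle (\<Phi> e) (C_squares 1 2 Th e) (C_dirs e)" for e
    unfolding \<Phi>_def by (rule labelled_cycle_C[OF _ _ Th]) simp_all
  have labD: "labelled_cycle (\<Phi>II og e) (D_cycle 1 2 og e) (map (origin_equiv og) (D_dirs e))" if "og \<in> origins" for og e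
    unfolding \<Phi>II_def by (rule labelled_cycle_D[OF _ _ that]) simp_all
  have trivial: "(\<exists>cs. C_graph r s og e = cycle_graph cs \<and>
          trivial_cycle (params r s og e $ 1) (params r s og e $ 2) cs) \<and> trivial_cycle r s (D_cycle r s og e)"
    if skew: "0 < r" "r < s" and og: "og \<in> origins" for r s og e
  proof (intro conjI exI)
    show "C_graph r s og e = cycle_graph (C_squares r s og e)" by (rule C_graph_eq[OF skew og])
    note C = labelled_cycle_C[OF skew og, of e, unfolded labelled_cycle_def]
    show "trivial_cycle (params r s og e $ 1) (params r s og e $ 2) (C_squares r s og e)"
    proof (rule trivial_cycle_labelled[OF C_params_less[OF skew og] _ _ _ potential_C[of og e]])
      show "C_dirs e ! i < 8 \<and> cyclic_next (C_squares r s og e) i =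
          C_squares r s og e ! i + step (params r s og e $ 1, params r s og e $ 2) (C_dirs e ! i)"
        if "i < length (C_squares r s og e)" for i
        using cyclic_next_C_squares[OF skew og, of i e] C that unfolding C_params[OF skew og]
        by (simp add: C_squares_def[OF skew og])
    qed (use C in auto)
    note D = labelled_cycle_D[OF skew og, of e, unfolded labelled_cycle_def]
    show "trivial_cycle r s (D_cycle r s og e)"
    proof (rule trivial_cycle_labelled[OF skew _ _ _ potential_D[OF og, of e]])
      show "map (origin_equiv og) (D_dirs e) ! i < 8 \<and> cyclic_next (D_cycle r s og e) i =
          D_cycle r s og e ! i + step (r, s) (map (origin_equiv og) (D_dirs e) ! i)"
        if "i < length (D_cycle r s og e)" for i
      proof
        show "map (origin_equiv og) (D_dirs e) ! i < 8" using D that by blast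
        have "i < length (D_list e)" using that by (simp add: D_cycle_eq[OF og])
        then show "cyclic_next (D_cycle r s og e) i =
            D_cycle r s og e ! i + step (r, s) (map (origin_equiv og) (D_dirs e) ! i)"
          by (rule cyclic_next_D_cycle[OF og])
      qed
    qed (use D in auto)
  qed
  have same: "same_dg (C_extracted r s og e) (\<Phi> e) \<and> same_dg (D_extracted r s og e) (\<Phi>II og e)"
    if "0 < r" "r < s" "og \<in> origins" for r s og e
    using same_dg_labelled_cycle[OF labelled_cycle_C[OF that] labC] same_dg_labelled_cycle[OF labelled_cycle_D[OF that] labD[OF that(3)]]
    by blast
  have inst: "instantiation_of r s (cycle_graph (D_cycle r s og e)) (\<Phi>II og e)" if og: "og \<in> origins" for r s og e
  proof -
    let ?D = "D_cycle 1 2 og e" and ?ls = "map (origin_equiv og) (D_dirs e)"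
    note D = labD[OF og, of e, unfolded labelled_cycle_def]
    have base: "base (\<Phi>II og e) = cycle_graph ?D" and dist: "distinct ?D" using D by auto
    have len: "length ?D = length (D_list e)" "length (D_cycle r s og e) = length (D_list e)"
      by (simp_all add: D_cycle_eq[OF og])
    \<comment> \<open>Squares at the same place of the two lists correspond. For degenerate
      \<open>(r, s)\<close> the list may repeat squares, but its moves have the same
      directions.\<close>
    define \<tau> where "\<tau> x = D_cycle r s og e ! index ?D x" for x
    have \<tau>: "\<tau> (?D ! i) = D_cycle r s og e ! i" if "i < length (D_list e)" for i
      using that index_nth[OF dist] by (simp add: \<tau>_def len)
    have \<tau>': "\<tau> (cyclic_next ?D i) = D_cycle r s og e ! i + step (r, s) (?ls ! i)" if "i < length (D_list e)" for i
      using \<tau>[OF Suc_mod_less[OF that]] cyclic_next_D_cycle[OF og that, of r s] by (simp add: cyclic_next_def len)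
    have "\<tau> ` pverts (base (\<Phi>II og e)) \<subseteq> pverts (cycle_graph (D_cycle r s og e))"
    proof
      fix y assume "y \<in> \<tau> ` pverts (base (\<Phi>II og e))"
      then obtain i where "i < length (D_list e)" "y = \<tau> (?D ! i)"
        unfolding base by (auto simp: cycle_graph_def in_set_conv_nth len)
      then show "y \<in> pverts (cycle_graph (D_cycle r s og e))" using \<tau> by (simp add: cycle_graph_def len)
    qed
    moreover have "\<tau> x + dir_mat (lab (\<Phi>II og e) (x, y)) *v vector [r, s] = \<tau> y"
      if "(x, y) \<in> parcs (base (\<Phi>II og e))" for x y
      using that unfolding base
    proof (cases rule: cycle_graph_arcE)
      case (1 a)
      then have a: "a < length (D_list e)" by (simp add: len)
      have "lab (\<Phi>II og e) (x, y) = label (?ls ! a)" "?ls ! a < 8" using D 1 by auto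
      then show ?thesis using \<tau>[OF a] \<tau>'[OF a] 1 by (simp add: dir_mat_mult_vec)
    next
      case (2 a)
      then have a: "a < length (D_list e)" by (simp add: len)
      have "lab (\<Phi>II og e) (x, y) = label ((?ls ! a + 4) mod 8)" "?ls ! a < 8" using D 2 by auto
      then show ?thesis using \<tau>[OF a] \<tau>'[OF a] 2 step_opposite[of "?ls ! a" "(r, s)"] by (simp add: dir_mat_mult_vec)
    qed
    ultimately show ?thesis unfolding instantiation_of_def by blast
  qed
  have equiv: "equivalent_dg \<Psi> \<Psi>'"
    if \<Psi>: "\<Psi> \<in> {\<Phi> e, \<Phi>II Tf (flip e), \<Phi>II Tg (flip e), \<Phi>II Th (flip e)}"
      "\<Psi>' \<in> {\<Phi> e, \<Phi>II Tf (flip e), \<Phi>II Tg (flip e), \<Phi>II Th (flip e)}" for \<Psi> \<Psi>' e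
  proof -
    obtain k g where g: "label_equiv g" "D_dirs (flip e) = map g (rotate k (map (\<lambda>d. 3 * d mod 8) (C_dirs e)))"
      using flip_labels by blast
    \<comment> \<open>All four label sequences are images of this one under equivalences, so any two
      of them are equivalent.\<close>
    define L where "L = rotate k (map (\<lambda>d. 3 * d mod 8) (C_dirs e))"
    have C: "\<exists>cs \<alpha>. labelled_cycle (\<Phi> e) cs (map \<alpha> L) \<and> label_equiv \<alpha>"
      using labelled_cycle_rotate[OF labC, of e k] label_equiv_triple unfolding rotate_C_dirs L_def[symmetric] by blast
    have D: "\<exists>cs \<alpha>. labelled_cycle (\<Phi>II og (flip e)) cs (map \<alpha> L) \<and> label_equiv \<alpha>" if og: "og \<in> origins" for og
    proof -
      have "map (origin_equiv og) (D_dirs (flip e)) = map (origin_equiv og \<circ> g) L" by (simp add: g(2) L_def)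
      with labD[OF og, of "flip e"] have "labelled_cycle (\<Phi>II og (flip e)) (D_cycle 1 2 og (flip e)) (map (origin_equiv og \<circ> g) L)"
        by (simp only:)
      with label_equiv_comp[OF label_equiv_origin g(1)] show ?thesis by blast
    qed
    have all: "\<exists>cs \<alpha>. labelled_cycle X cs (map \<alpha> L) \<and> label_equiv \<alpha>"
      if "X \<in> {\<Phi> e, \<Phi>II Tf (flip e), \<Phi>II Tg (flip e), \<Phi>II Th (flip e)}" for X
      using that C D by (auto simp: origins_def)
    have L: "l < 8" if "l \<in> set L" for l using that by (auto simp: L_def)
    obtain cs \<alpha> where 1: "labelled_cycle \<Psi> cs (map \<alpha> L)" "label_equiv \<alpha>" using all[OF \<Psi>(1)] by blast
    obtain cs' \<beta> where 2: "labelled_cycle \<Psi>' cs' (map \<beta> L)" "label_equiv \<beta>" using all[OF \<Psi>(2)] by blast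
    show ?thesis by (rule equivalent_dg_labelled_cycle[OF 1(1) 2(1) 1(2) 2(2) L])
  qed
  have dual: "complement_with (\<Phi>II og e) (\<Phi> e) (descent_mat og e) \<and>
      complement_with (\<Phi> e) (\<Phi>II og e) (matrix_inv (descent_mat og e))" if og: "og \<in> origins" for og e
  proof -
    let ?A = "descent_mat og e"
    define N where "N w = pos_mat og e w ** matrix_inv ?A" for w
    have sets: "set (map fst (D_list e)) = set (map fst (C_words e))"
      using set_D_list[of e] set_C_words[of e] by simp
    have D: "labelled_cycle (\<Phi>II og e) (map (pos (lift_params og (1, 2)) e) (map fst (D_list e))) (map (origin_equiv og) (D_dirs e))"
      using labD[OF og, of e] unfolding D_cycle_eq[OF og] .
    have C: "labelled_cycle (\<Phi> e) (map (pos (lift_params Th (1, 2)) e) (map fst (C_words e))) (C_dirs e)"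
      using labC[of e] by (simp only: C_squares_def[OF _ _ Th] base_params_def[OF _ _ Th] zero_less_one one_less_numeral_iff semiring_norm)
    have pot: "potential (\<lambda>i. N (map fst (C_words e) ! i)) (C_dirs e)"
      unfolding N_def by (rule potential_C)
    have N: "N w' - N w = (pos_mat og e w' - pos_mat og e w) ** matrix_inv ?A" for w w'
      using matrix_conj_diff[of "mat 1" "pos_mat og e w'" "matrix_inv ?A" "pos_mat og e w"] by (simp add: N_def)
    have N': "pos_mat og e w' - pos_mat og e w = (N w' - N w) ** ?A" for w w'
      unfolding N matrix_mul_assoc[symmetric] descent_mat_inverse by simp
    show ?thesis
      using complement_with_labelled[OF D C sets potential_D[OF og] pot coherent_labels_D coherent_labels_C descent_mat_not_dir(1)[OF og] N']
        complement_with_labelled[OF C D sets[symmetric] pot potential_D[OF og] coherent_labels_C coherent_labels_D descent_mat_not_dir(2)[OF og] N]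
      by blast
  qed
  show ?thesis
  proof (rule exI[of _ \<Phi>], rule exI[of _ \<Phi>II], intro conjI)
    show "\<forall>og\<in>origins. \<forall>e. dual_dg (\<Phi> e) \<and> dual_dg (\<Phi>II og e) \<and> invertible (string_mat e ** type_mat og :: real^2^2) \<and>
       complement_with (\<Phi>II og e) (\<Phi> e) (string_mat e ** type_mat og) \<and>
       complement_with (\<Phi> e) (\<Phi>II og e) (matrix_inv (string_mat e ** type_mat og))"
      using dual invertible_descent_mat unfolding dual_dg_def by blast
  qed (use trivial same inst equiv in blast)+
qed

end
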